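(* Let $0<\alpha<1$, $\kappa\in\mathbb{R}$, $\kappa_+:=\max\{\kappa,0\}$. Suppose the solution $u$ of the reaction-subdiffusion problem described in the context satisfies, for some $\sigma\in(0,1)\cup(1,2)$, $|\partial_t^{l}u(x,t)|\le C_u(1+t^{\sigma-l})$ for $0<t\le T$, $l=1,2$, and $\|\partial_x^{4}u(t)\|_{L^\infty}\le C_u$. Consider the fully discrete scheme described in the context with $\theta=0$ and the L1 kernels $$A^{(n)}_{n-k}:=\frac1{\tau_k}\int_{t_{k-1}}^{t_k}\omega_{1-\alpha}(t_n-s)\,ds,\qquad 1\le k\le n\le N,$$ on a mesh with $\tau_k/\tau_{k+1}\le\rho$ for $1\le k\le N-1$, where $\rho>0$ is a constant. Let $U_h^n$ be its solution and $e_h^n:=u(x_h,t_n)-U_h^n$. If the maximum step size $\tau:=\max_{1\le k\le N}\tau_k$ satisfies $$\tau\le 1/\sqrt[\alpha]{4\max\{1,\rho\}\Gamma(2-\alpha)\kappa_+}$$ (no restriction if $\kappa_+=0$), then the discrete solution is convergent in the $L^2$-norm: with $C=(\rho+1)E_\alpha(4\max\{1,\rho\}\kappa_+t_n^\alpha)$, $$\|e_h^n\|\le C_uC\Big(\|e_h^0\|+\frac{\tau_1^\sigma}{\sigma}+\sum_{j=2}^n\tau_j\max_{j\le k\le n}\big(t_{k-1}^{\sigma-2}t_k^{\alpha-1}\tau_k^{2-\alpha}\big)+t_n^\alpha h^2\Big),\qquad 1\le n\le N.$$ In particular, for $1\le n\le N$: (a) if the uniform mesh $t_k=kT/N$ is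 used, then $$\|e_h^n\|\le C_uC\Big(\|e_h^0\|+\big(\tfrac1\sigma+\varsigma^L_{n,1}\big)N^{-\min\{\sigma,2-\alpha\}}+t_n^\alpha h^2\Big);$$ (b) if the graded mesh $t_k=T(k/N)^\gamma$, $\gamma\ge1$, is used, then $$\|e_h^n\|\le C_uC\Big(\|e_h^0\|+\big(\tfrac1\sigma+\chi^L_{n,\gamma}\big)N^{-\min\{\sigma\gamma,2-\alpha\}}+t_n^\alpha h^2\Big);$$ (c) if the mesh satisfies condition M1 of the context with parameter $\gamma\ge1$, then, with $n^*=(t_n/\tau_1)^{1/\gamma}$, $$\|e_h^n\|\le C_uC\Big(\|e_h^0\|+\big(\tfrac1\sigma+\chi^L_{n^*,\gamma}\big)\tau^{\min\{\sigma\gamma,2-\alpha\}}+t_n^\alpha h^2\Big).$$ The optimal convergence order is achieved in (b) and (c) by choosing $\gamma=\gamma_{\mathrm{opt}}=\max\{1,(2-\alpha)/\sigma\}$.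
   Context: Continuous problem: on $\Omega=(x_l,x_r)$, $\mathcal{D}_t^\alpha u-\Delta u=\kappa u+f$ for $x\in\Omega$, $0<t\le T$; $u=u_0(x)$ at $t=0$; $u=0$ on $\partial\Omega$ for $0<t<T$. Here $\mathcal{D}_t^\alpha u:=\int_0^t\omega_{1-\alpha}(t-s)\,\partial_su(s)\,ds$ is the Caputo derivative and $\omega_\beta(t):=t^{\beta-1}/\Gamma(\beta)$. Time mesh: $0=t_0<t_1<\cdots<t_N=T$, $\tau_k:=t_k-t_{k-1}$, $\nabla_\tau v^k:=v^k-v^{k-1}$. Discrete Caputo derivative (with $\theta=0$): $\mathcal{D}_\tau^\alpha v^{n}:=\sum_{k=1}^nA^{(n)}_{n-k}\nabla_\tau v^k$. Space grid: $h=(x_r-x_l)/M$, $x_i=x_l+ih$, $\overline\Omega_h=\{x_i:0\le i\le M\}$, $\Omega_h=\overline\Omega_h\cap\Omega$, $\partial\Omega_h=\overline\Omega_h\cap\partial\Omega$. $\Delta_h$ is the standard second-order central difference approximation of $\Delta$. $\|v_h\|:=\big(h\sum_{x\in\Omega_h}v_h(x)^2\big)^{1/2}$. Fully discrete scheme ($\theta=0$): $\mathcal{D}^\alpha_\tau U_h^{n}=\Delta_hU_h^{n}+\kappa U_h^{n}+f(x_h,t_n)$ on $\Omega_h$ for $1\le n\le N$; $U_h^0=u_0(x_h)$ on $\Omega_h$; $U_h^n=0$ on $\partial\Omega_h$ for $n\ge0$. Condition M1: there are constants $C_1,C_\gamma>0$ such that $\tau_1\ge C_1\tau^\gamma$,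 $\tau_k\le C_\gamma\tau\min\{1,t_k^{1-1/\gamma}\}$ for $1\le k\le N$, and $t_k\le C_\gamma t_{k-1}$, $\tau_k\le C_\gamma\tau_{k-1}$ for $2\le k\le N$, where $\tau$ is the maximum step size. Factors (for real $n\ge1$): $$\varsigma^L_{n,\gamma}:=\begin{cases}\frac{1-n^{\sigma\gamma+\alpha-2}}{2-\alpha-\sigma\gamma},&\sigma\gamma<2-\alpha,\\ \ln n,&\sigma\gamma=2-\alpha,\\ \frac{1-n^{2-\alpha-\sigma\gamma}}{\sigma\gamma+\alpha-2},&\sigma\gamma>2-\alpha,\end{cases}\qquad \zeta^L_{n,\gamma}:=\begin{cases}\frac{1-n^{\sigma\gamma+\alpha-2}}{2-\alpha-\sigma\gamma},&\sigma\gamma<2-\alpha,\\ \ln n,&\sigma\gamma\ge2-\alpha,\end{cases}$$ and $\chi^L_{n,\gamma}:=\varsigma^L_{n,\gamma}$ if $0<\sigma<1$, $\chi^L_{n,\gamma}:=\zeta^L_{n,\gamma}$ if $1<\sigma<2$. $E_\alpha(z):=\sum_{j=0}^\infty z^j/\Gamma(j\alpha+1)$ is the Mittag-Leffler function. Empty sums are $0$. $C_u$ denotes a generic positive constant, possibly different at each occurrence, depending only on the regularity of $u$, on $T$ and $\kappa$, and in (b), (c) also on the mesh constants ($\gamma$, respectively $\gamma,\rho,C_1,C_\gamma$); it is independent of the time steps, of $n$, $N$, $h$, and hides no factor that blows up as $\alpha\to1^-$. *)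

theory Defs
  imports "HOL-Analysis.Analysis"
begin

definition omega :: "real \<Rightarrow> real \<Rightarrow> real" where
  "omega \<beta> t = t powr (\<beta> - 1) / Gamma \<beta>"

definition caputo :: "real \<Rightarrow> (real \<Rightarrow> real) \<Rightarrow> real \<Rightarrow> real" where
  "caputo \<alpha> v t = (LINT s:{0<..<t}|lborel. omega (1 - \<alpha>) (t - s) * deriv v s)"

text \<open>
  Functions of space and time take the space variable first: \<open>u x t\<close>.  The derivatives below are
  total functions; their existence is part of \<open>sol_regularity\<close>, with which this predicate is
  always combined.  Continuity on the closed cylinder is what ties the initial and boundary values
  to the values of \<open>u\<close> inside (the boundary condition is imposed for \<open>0 < t < T\<close> only).
\<close>

definition subdiffusion_solution ::
  "real \<Rightarrow> real \<Rightarrow> real \<Rightarrow> real \<Rightarrow> real \<Rightarrow> (real \<Rightarrow> real \<Rightarrow> real) \<Rightarrow> (real \<Rightarrow> real) \<Rightarrow>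
    (real \<Rightarrow> real \<Rightarrow> real) \<Rightarrow> bool" where
  "subdiffusion_solution xl xr T \<kappa> \<alpha> f u0 u \<longleftrightarrow>
     continuous_on ({xl..xr} \<times> {0..T}) (\<lambda>(x, t). u x t) \<and>
     (\<forall>x\<in>{xl<..<xr}. \<forall>t\<in>{0<..T}.
        caputo \<alpha> (u x) t - (deriv ^^ 2) (\<lambda>y. u y t) x = \<kappa> * u x t + f x t) \<and>
     (\<forall>x\<in>{xl<..<xr}. u x 0 = u0 x) \<and>
     (\<forall>t\<in>{0<..<T}. u xl t = 0 \<and> u xr t = 0)"

text \<open>
  \<open>K\<close> is the regularity constant.  At \<open>t = T\<close> the time derivatives are one-sided.  In space,
  \<open>w j\<close> is the \<open>j\<close>-th derivative of \<open>u\<close> at the given time; the first three are classical, and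
  \<open>w 4\<close> is an \<open>L\<^sup>\<infinity>\<close> (weak) derivative, so that \<open>w 3\<close> is its indefinite integral.  A fourth
  derivative existing everywhere and bounded by \<open>K\<close> almost everywhere is a special case.
\<close>

definition sol_regularity ::
  "real \<Rightarrow> real \<Rightarrow> real \<Rightarrow> real \<Rightarrow> real \<Rightarrow> (real \<Rightarrow> real \<Rightarrow> real) \<Rightarrow> bool" where
  "sol_regularity xl xr T \<sigma> K u \<longleftrightarrow>
     (\<forall>x\<in>{xl<..<xr}. \<exists>v1 v2. \<forall>t\<in>{0<..T}.
        (u x has_real_derivative v1 t) (at t within {0<..T}) \<and>
        (v1 has_real_derivative v2 t) (at t within {0<..T}) \<and>
        \<bar>v1 t\<bar> \<le> K * (1 + t powr (\<sigma> - 1)) \<and>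
        \<bar>v2 t\<bar> \<le> K * (1 + t powr (\<sigma> - 2))) \<and>
     (\<forall>t\<in>{0<..T}. \<exists>w :: nat \<Rightarrow> real \<Rightarrow> real.
        w 0 = (\<lambda>x. u x t) \<and>
        (\<forall>j<3. \<forall>x\<in>{xl<..<xr}. (w j has_real_derivative w (Suc j) x) (at x)) \<and>
        (\<forall>a b. xl < a \<and> a \<le> b \<and> b < xr \<longrightarrow>
           set_integrable lborel {a..b} (w 4) \<and>
           w 3 b - w 3 a = (LINT y:{a..b}|lborel. w 4 y)) \<and>
        (AE y in lborel. y \<in> {xl<..<xr} \<longrightarrow> \<bar>w 4 y\<bar> \<le> K))"

definition step :: "(nat \<Rightarrow> real) \<Rightarrow> nat \<Rightarrow> real" where
  "step t k = t k - t (k - 1)"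

definition max_step :: "nat \<Rightarrow> (nat \<Rightarrow> real) \<Rightarrow> real" where
  "max_step N t = Max (step t ` {1..N})"

definition time_mesh :: "real \<Rightarrow> nat \<Rightarrow> (nat \<Rightarrow> real) \<Rightarrow> bool" where
  "time_mesh T N t \<longleftrightarrow> 1 \<le> N \<and> t 0 = 0 \<and> t N = T \<and> (\<forall>k\<in>{1..N}. t (k - 1) < t k)"

definition step_ratio_bound :: "real \<Rightarrow> nat \<Rightarrow> (nat \<Rightarrow> real) \<Rightarrow> bool" where
  "step_ratio_bound \<rho> N t \<longleftrightarrow> (\<forall>k\<in>{1..N-1}. step t k / step t (k + 1) \<le> \<rho>)"

definition step_restriction :: "real \<Rightarrow> real \<Rightarrow> real \<Rightarrow> nat \<Rightarrow> (nat \<Rightarrow> real) \<Rightarrow> bool" where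
  "step_restriction \<alpha> \<kappa> \<rho> N t \<longleftrightarrow>
     (max \<kappa> 0 > 0 \<longrightarrow>
        max_step N t \<le> 1 / (4 * max 1 \<rho> * Gamma (2 - \<alpha>) * max \<kappa> 0) powr (1 / \<alpha>))"

definition uniform_mesh :: "real \<Rightarrow> nat \<Rightarrow> (nat \<Rightarrow> real) \<Rightarrow> bool" where
  "uniform_mesh T N t \<longleftrightarrow> (\<forall>k\<le>N. t k = real k * T / real N)"

definition graded_mesh :: "real \<Rightarrow> real \<Rightarrow> nat \<Rightarrow> (nat \<Rightarrow> real) \<Rightarrow> bool" where
  "graded_mesh \<gamma> T N t \<longleftrightarrow> (\<forall>k\<le>N. t k = T * (real k / real N) powr \<gamma>)"

definition mesh_M1 :: "real \<Rightarrow> real \<Rightarrow> real \<Rightarrow> nat \<Rightarrow> (nat \<Rightarrow> real) \<Rightarrow> bool" where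
  "mesh_M1 \<gamma> C1 C\<gamma> N t \<longleftrightarrow>
     step t 1 \<ge> C1 * max_step N t powr \<gamma> \<and>
     (\<forall>k\<in>{1..N}. step t k \<le> C\<gamma> * max_step N t * min 1 (t k powr (1 - 1 / \<gamma>))) \<and>
     (\<forall>k\<in>{2..N}. t k \<le> C\<gamma> * t (k - 1) \<and> step t k \<le> C\<gamma> * step t (k - 1))"

text \<open>\<open>L1_kernel \<alpha> t n j\<close> is \<open>A\<^sup>(\<^sup>n\<^sup>)\<^sub>j\<close>, belonging to the time interval with right end point \<open>t (n - j)\<close>.\<close>

definition L1_kernel :: "real \<Rightarrow> (nat \<Rightarrow> real) \<Rightarrow> nat \<Rightarrow> nat \<Rightarrow> real" where
  "L1_kernel \<alpha> t n j = (let k = n - j in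
     1 / step t k * (LINT s:{t (k - 1)<..<t k}|lborel. omega (1 - \<alpha>) (t n - s)))"

definition discrete_caputo :: "(nat \<Rightarrow> nat \<Rightarrow> real) \<Rightarrow> (nat \<Rightarrow> real) \<Rightarrow> nat \<Rightarrow> real" where
  "discrete_caputo A v n = (\<Sum>k=1..n. A n (n - k) * (v k - v (k - 1)))"

definition mesh_width :: "real \<Rightarrow> real \<Rightarrow> nat \<Rightarrow> real" where
  "mesh_width xl xr M = (xr - xl) / real M"

definition grid_pt :: "real \<Rightarrow> real \<Rightarrow> nat \<Rightarrow> nat \<Rightarrow> real" where
  "grid_pt xl xr M i = xl + real i * mesh_width xl xr M"

text \<open>
  A grid function is represented by its values at the indices \<open>0, \<dots>, M\<close>; the interior grid points
  are those with index in \<open>{1..<M}\<close>, the boundary points those with index \<open>0\<close> and \<open>M\<close>.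
\<close>

definition discrete_laplacian :: "real \<Rightarrow> (nat \<Rightarrow> real) \<Rightarrow> nat \<Rightarrow> real" where
  "discrete_laplacian h v i = (v (i + 1) - 2 * v i + v (i - 1)) / h\<^sup>2"

definition grid_norm :: "real \<Rightarrow> nat \<Rightarrow> (nat \<Rightarrow> real) \<Rightarrow> real" where
  "grid_norm h M v = sqrt (h * (\<Sum>i\<in>{1..<M}. (v i)\<^sup>2))"

definition L1_scheme ::
  "real \<Rightarrow> real \<Rightarrow> real \<Rightarrow> real \<Rightarrow> (real \<Rightarrow> real \<Rightarrow> real) \<Rightarrow> (real \<Rightarrow> real) \<Rightarrow> nat \<Rightarrow> nat \<Rightarrow>
    (nat \<Rightarrow> real) \<Rightarrow> (nat \<Rightarrow> nat \<Rightarrow> real) \<Rightarrow> bool" where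
  "L1_scheme xl xr \<kappa> \<alpha> f u0 M N t U \<longleftrightarrow>
     (\<forall>n\<in>{1..N}. \<forall>i\<in>{1..<M}.
        discrete_caputo (L1_kernel \<alpha> t) (\<lambda>k. U k i) n =
        discrete_laplacian (mesh_width xl xr M) (U n) i + \<kappa> * U n i
          + f (grid_pt xl xr M i) (t n)) \<and>
     (\<forall>i\<in>{1..<M}. U 0 i = u0 (grid_pt xl xr M i)) \<and>
     (\<forall>n\<le>N. U n 0 = 0 \<and> U n M = 0)"

definition scheme_error ::
  "real \<Rightarrow> real \<Rightarrow> (real \<Rightarrow> real \<Rightarrow> real) \<Rightarrow> nat \<Rightarrow> (nat \<Rightarrow> real) \<Rightarrow> (nat \<Rightarrow> nat \<Rightarrow> real) \<Rightarrow>
    nat \<Rightarrow> nat \<Rightarrow> real" where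
  "scheme_error xl xr u M t U n i = u (grid_pt xl xr M i) (t n) - U n i"

definition mittag_leffler :: "real \<Rightarrow> real \<Rightarrow> real" where
  "mittag_leffler \<alpha> z = (\<Sum>j. z ^ j / Gamma (real j * \<alpha> + 1))"

definition varsigma_L :: "real \<Rightarrow> real \<Rightarrow> real \<Rightarrow> real \<Rightarrow> real" where
  "varsigma_L \<alpha> \<sigma> \<gamma> n =
     (if \<sigma> * \<gamma> < 2 - \<alpha> then (1 - n powr (\<sigma> * \<gamma> + \<alpha> - 2)) / (2 - \<alpha> - \<sigma> * \<gamma>)
      else if \<sigma> * \<gamma> = 2 - \<alpha> then ln n
      else (1 - n powr (2 - \<alpha> - \<sigma> * \<gamma>)) / (\<sigma> * \<gamma> + \<alpha> - 2))"

definition zeta_L :: "real \<Rightarrow> real \<Rightarrow> real \<Rightarrow> real \<Rightarrow> real" where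
  "zeta_L \<alpha> \<sigma> \<gamma> n =
     (if \<sigma> * \<gamma> < 2 - \<alpha> then (1 - n powr (\<sigma> * \<gamma> + \<alpha> - 2)) / (2 - \<alpha> - \<sigma> * \<gamma>)
      else ln n)"

definition chi_L :: "real \<Rightarrow> real \<Rightarrow> real \<Rightarrow> real \<Rightarrow> real" where
  "chi_L \<alpha> \<sigma> \<gamma> n = (if \<sigma> < 1 then varsigma_L \<alpha> \<sigma> \<gamma> n else zeta_L \<alpha> \<sigma> \<gamma> n)"

definition n_star :: "real \<Rightarrow> (nat \<Rightarrow> real) \<Rightarrow> nat \<Rightarrow> real" where
  "n_star \<gamma> t n = (t n / step t 1) powr (1 / \<gamma>)"

definition gamma_opt :: "real \<Rightarrow> real \<Rightarrow> real" where
  "gamma_opt \<alpha> \<sigma> = max 1 ((2 - \<alpha>) / \<sigma>)"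

definition stab_factor :: "real \<Rightarrow> real \<Rightarrow> real \<Rightarrow> real \<Rightarrow> real" where
  "stab_factor \<alpha> \<kappa> \<rho> s =
     (\<rho> + 1) * mittag_leffler \<alpha> (4 * max 1 \<rho> * max \<kappa> 0 * s powr \<alpha>)"

text \<open>
  \<open>l1_setting\<close> collects the hypotheses on the data that vary while the interval, \<open>T\<close>, \<open>\<kappa>\<close> and the
  regularity parameters \<open>\<sigma>\<close>, \<open>K\<close> stay fixed.
\<close>

definition l1_setting ::
  "real \<Rightarrow> real \<Rightarrow> real \<Rightarrow> real \<Rightarrow> real \<Rightarrow> real \<Rightarrow> real \<Rightarrow> real \<Rightarrow> (real \<Rightarrow> real \<Rightarrow> real) \<Rightarrow>
    (real \<Rightarrow> real) \<Rightarrow> (real \<Rightarrow> real \<Rightarrow> real) \<Rightarrow> nat \<Rightarrow> nat \<Rightarrow> (nat \<Rightarrow> real) \<Rightarrow>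
    (nat \<Rightarrow> nat \<Rightarrow> real) \<Rightarrow> bool" where
  "l1_setting xl xr T \<kappa> \<sigma> K \<rho> \<alpha> f u0 u M N t U \<longleftrightarrow>
     0 < \<alpha> \<and> \<alpha> < 1 \<and> 0 < \<rho> \<and> 1 \<le> M \<and>
     subdiffusion_solution xl xr T \<kappa> \<alpha> f u0 u \<and>
     sol_regularity xl xr T \<sigma> K u \<and>
     time_mesh T N t \<and>
     step_ratio_bound \<rho> N t \<and>
     step_restriction \<alpha> \<kappa> \<rho> N t \<and>
     L1_scheme xl xr \<kappa> \<alpha> f u0 M N t U"

definition error_estimate ::
  "real \<Rightarrow> real \<Rightarrow> real \<Rightarrow> real \<Rightarrow> real \<Rightarrow> real \<Rightarrow> (real \<Rightarrow> real \<Rightarrow> real) \<Rightarrow> nat \<Rightarrow> nat \<Rightarrow>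
    (nat \<Rightarrow> real) \<Rightarrow> (nat \<Rightarrow> nat \<Rightarrow> real) \<Rightarrow> (nat \<Rightarrow> real) \<Rightarrow> bool" where
  "error_estimate Cu xl xr \<kappa> \<rho> \<alpha> u M N t U E \<longleftrightarrow>
     (let h = mesh_width xl xr M; e = scheme_error xl xr u M t U in
      \<forall>n\<in>{1..N}. grid_norm h M (e n) \<le>
        Cu * stab_factor \<alpha> \<kappa> \<rho> (t n) * (grid_norm h M (e 0) + E n + t n powr \<alpha> * h\<^sup>2))"

end

theory Submission
  imports Defs
begin

text \<open>
  The error \<open>e\<close> solves the scheme with the consistency errors in time and space as data, so the estimate
  follows from stability and from a sharp bound on how consistency errors accumulate.

  Stability. The L1 kernels \<open>a n k\<close> (the mean of \<open>s \<mapsto> \<omega>\<^bsub>1-\<alpha>\<^esub>(t\<^sub>n - s)\<close> over the \<open>k\<close>-th time interval) increase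
  in \<open>k\<close>. Hence testing the scheme with \<open>e\<^sup>n\<close> gives the scalar inequality
  \<open>\<Sum>k\<le>n. a n k (y\<^sub>k - y\<^bsub>k-1\<^esub>) \<le> \<kappa>\<^sub>+ y\<^sub>n + g\<^sub>n\<close> for \<open>y\<^sub>n = \<parallel>e\<^sup>n\<parallel>\<close> (\<open>energy_inequality\<close>). The same monotonicity
  provides nonnegative weights \<open>P n j\<close> with \<open>\<Sum>j=k..n. P n j * a j k = 1\<close>
  (\<open>complementary_weights_exist\<close>): multiplying by them and summing inverts the discrete derivative.
  Since the Caputo derivative of \<open>\<omega>\<^bsub>1+\<beta>\<^esub>\<close> is \<open>\<omega>\<^bsub>1-\<alpha>+\<beta>\<^esub>\<close>, comparing the integrals interval by interval gives
  \<open>\<Sum>j<n. P n j * \<omega>\<^bsub>1-\<alpha>+\<beta>\<^esub>(t\<^sub>j) \<le> max 1 \<rho> * \<omega>\<^bsub>1+\<beta>\<^esub>(t\<^sub>n)\<close>; the step ratio \<open>\<rho>\<close> enters when \<open>\<omega>\<^sub>\<beta>\<close> increases.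
  Summed over \<open>\<beta> = \<alpha>, 2\<alpha>, \<dots>\<close> this says that the Mittag-Leffler function is a supersolution, which is
  the Gronwall inequality \<open>discrete_fractional_gronwall\<close>.

  Consistency in time. On the \<open>k\<close>-th interval the L1 formula replaces the weight by its mean \<open>a n k\<close>, and so
  only the oscillation of \<open>u\<^sub>t\<close> there matters. By convexity of the weight its distance from the mean is at
  most \<open>a n (k+1) - a n k\<close>, a quantity that telescopes against \<open>P\<close>; thus past intervals cost no more than the
  current one and the accumulated error is at most \<open>3 \<Sum>k. P n k * a k k * g\<^sub>k\<close>, where \<open>g\<^sub>k\<close> is the
  oscillation on the \<open>k\<close>-th interval (\<open>truncation_error_le\<close>, \<open>P_sum_quadrature_le\<close>). Finally,
  for \<open>k \<ge> 2\<close>, \<open>a k k * g\<^sub>k\<close> is \<open>\<omega>\<^bsub>2-\<alpha>\<^esub>(t\<^sub>k)\<close> times \<open>t\<^bsub>k-1\<^esub>\<^bsup>\<sigma>-2\<^esup> t\<^sub>k\<^bsup>\<alpha>-1\<^esup> \<tau>\<^sub>k\<^bsup>2-\<alpha>\<^esup>\<close>, and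
  \<open>\<omega>\<^bsub>2-\<alpha>\<^esub>(t\<^sub>k) = \<Sum>j\<le>k. a k j \<tau>\<^sub>j\<close>, so the maxima over later indices, being nonincreasing in \<open>j\<close>, turn
  the sum into the \<open>\<Sum>j. \<tau>\<^sub>j max\<close> of the theorem; moving the first step to the second costs the factor \<open>\<rho> + 1\<close>
  (\<open>P_sum_local_error_le\<close>). No constant degenerates as \<open>\<alpha> \<rightarrow> 1\<close>, because the Gamma function enters the
  constants only through \<open>\<Gamma>(1+\<alpha>) \<ge> 1/2\<close>.

  Meshes. On a mesh with \<open>\<tau>\<^sub>k \<le> D \<tau> t\<^sub>k\<^bsup>1-1/\<gamma>\<^esup>\<close> the terms of the sum are at most a constant times
  \<open>\<tau>\<^bsup>2-\<alpha>\<^esup> \<tau>\<^sub>j t\<^sub>j\<^bsup>r-1\<^esup>\<close> with \<open>\<gamma> r = \<sigma>\<gamma> + \<alpha> - 2\<close>, and for \<open>r \<le> 1\<close> the sum is dominated by \<open>\<integral>x\<^bsup>r-1\<^esup> dx\<close> from \<open>t\<^sub>1\<close> to \<open>t\<^sub>n\<close>;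
  evaluating the integral yields the three cases of the factor \<open>\<varsigma>\<close> (\<open>sum_steps_powr_le\<close>); for \<open>r > 1\<close>
  the terms are at most a constant times \<open>\<tau>\<^bsup>2-\<alpha>\<^esup> \<tau>\<^sub>j\<close> and no factor arises. The graded mesh is the case \<open>\<tau> = 1/N\<close>, and the uniform mesh is the graded mesh with \<open>\<gamma> = 1\<close>. All constants are uniform in
  \<open>\<gamma> \<le> G\<close>; this is what allows the \<open>\<alpha>\<close>-dependent choice \<open>\<gamma> = \<gamma>\<^bsub>opt\<^esub> \<le> max 1 (2/\<sigma>)\<close>.
\<close>

section \<open>Integrals over open intervals\<close>

text \<open>
  Antiderivatives give gauge integrals, whereas the kernels are Lebesgue integrals with endpoint
  singularities; for nonnegative integrands the two notions agree.
\<close>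

lemma set_integral_of_nonneg_has_integral:
  fixes f :: "real \<Rightarrow> real"
  assumes hi: "(f has_integral I) {a..b}"
    and nonneg: "\<And>s. s \<in> {a<..<b} \<Longrightarrow> 0 \<le> f s"
    and meas: "set_borel_measurable lborel {a<..<b} f"
  shows "set_integrable lborel {a<..<b} f" "(LINT s:{a<..<b}|lborel. f s) = I"
proof -
  define g where "g = (\<lambda>s. indicator {a<..<b} s *\<^sub>R f s)"
  have meas_g: "g \<in> borel_measurable lborel"
    using meas unfolding g_def set_borel_measurable_def .
  have g_nonneg: "0 \<le> g s" for s
    using nonneg by (auto simp: g_def indicator_def)
  have "(f has_integral I) {a<..<b}"
    using hi has_integral_Icc_iff_Ioo by blast
  moreover have "g = (\<lambda>s. if s \<in> {a<..<b} then f s else 0)"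
    by (auto simp: g_def indicator_def)
  ultimately have "(g has_integral I) UNIV"
    using has_integral_restrict_UNIV[of "{a<..<b}" f I] by simp
  moreover from this have "0 \<le> I"
    using g_nonneg has_integral_nonneg by blast
  ultimately have "(\<integral>\<^sup>+ s. ennreal (g s) \<partial>lborel) = ennreal I"
    using nn_integral_has_integral_lborel[of g I] meas_g g_nonneg by simp
  with \<open>0 \<le> I\<close> have "has_bochner_integral lborel g I"
    using meas_g g_nonneg by (intro has_bochner_integral_nn_integral) auto
  then show "set_integrable lborel {a<..<b} f" "(LINT s:{a<..<b}|lborel. f s) = I"
    unfolding set_integrable_def set_lebesgue_integral_def g_def
    by (simp_all add: has_bochner_integral_iff)
qed

lemma set_integral_Ioo_add:
  fixes f :: "real \<Rightarrow> real"
  assumes "set_integrable lborel {a<..<c} f" "a \<le> b" "b \<le> c"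
  shows "(LINT s:{a<..<c}|lborel. f s) =
    (LINT s:{a<..<b}|lborel. f s) + (LINT s:{b<..<c}|lborel. f s)"
proof -
  have i: "interval_lebesgue_integrable lborel (ereal a) (ereal c) f"
    using assms by (simp add: interval_lebesgue_integrable_def einterval_eq)
  have "(LBINT x=a..b. f x) + (LBINT x=b..c. f x) = (LBINT x=a..c. f x)"
    using assms i by (intro interval_integral_sum) (simp add: min_def max_def)
  then show ?thesis
    using assms by (simp add: interval_lebesgue_integral_def einterval_eq)
qed

lemma set_integral_Ioo_partition:
  fixes f :: "real \<Rightarrow> real" and t :: "nat \<Rightarrow> real"
  assumes "set_integrable lborel {t 0<..<t n} f" "\<And>k. k \<in> {1..n} \<Longrightarrow> t (k - 1) \<le> t k"
  shows "(LINT s:{t 0<..<t n}|lborel. f s) = (\<Sum>k=1..n. LINT s:{t (k - 1)<..<t k}|lborel. f s)"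
  using assms
proof (induction n)
  case 0
  then show ?case by (simp add: set_lebesgue_integral_def)
next
  case (Suc n)
  note step = Suc.prems(2)
  have mono: "m \<le> n \<Longrightarrow> t 0 \<le> t m" for m
  proof (induction m)
    case (Suc m)
    then show ?case using step[of "Suc m"] by simp
  qed simp
  have le: "t 0 \<le> t n" "t n \<le> t (Suc n)"
    using mono[of n] Suc.prems(2)[of "Suc n"] by auto
  have "set_integrable lborel {t 0<..<t n} f"
    by (rule set_integrable_subset[OF Suc.prems(1)]) (use le in auto)
  then show ?case
    using Suc set_integral_Ioo_add[OF Suc.prems(1) le] by simp
qed

lemma set_borel_measurable_Ioo:
  fixes f :: "real \<Rightarrow> real"
  assumes "continuous_on {a<..<b} f"
  shows "set_borel_measurable lborel {a<..<b} f"
  using assms borel_measurable_continuous_on_indicator[of "{a<..<b}" f]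
  unfolding set_borel_measurable_def by auto

lemma set_integrable_const_Ioo:
  fixes a c :: real
  shows "set_integrable lborel {a<..<c} (\<lambda>_. d::real)"
  by (rule set_integrable_subset[OF borel_integrable_atLeastAtMost'[OF continuous_on_const, of a c]]) auto

lemma set_integral_const_Ioo:
  fixes a c :: real
  shows "a \<le> c \<Longrightarrow> (LINT s:{a<..<c}|lborel. d) = (c - a) * (d::real)"
  by (simp add: set_lebesgue_integral_def)

section \<open>The kernel of the Caputo derivative\<close>

lemma omega_nonneg: "0 < \<beta> \<Longrightarrow> 0 \<le> omega \<beta> x"
  by (simp add: omega_def Gamma_real_pos less_imp_le)

lemma omega_pos: "0 < \<beta> \<Longrightarrow> 0 < x \<Longrightarrow> 0 < omega \<beta> x"
  by (simp add: omega_def Gamma_real_pos)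

lemma omega_antimono: "0 < \<beta> \<Longrightarrow> \<beta> \<le> 1 \<Longrightarrow> 0 < x \<Longrightarrow> x \<le> y \<Longrightarrow> omega \<beta> y \<le> omega \<beta> x"
  by (simp add: omega_def Gamma_real_pos divide_right_mono less_imp_le powr_mono2')

lemma omega_mono: "1 \<le> \<beta> \<Longrightarrow> 0 < x \<Longrightarrow> x \<le> y \<Longrightarrow> omega \<beta> x \<le> omega \<beta> y"
  by (simp add: omega_def Gamma_real_pos divide_right_mono less_imp_le powr_mono2)

lemma omega_has_derivative:
  assumes "0 < \<beta>" "0 < x"
  shows "(omega (1 + \<beta>) has_real_derivative omega \<beta> x) (at x)"
proof -
  have "((\<lambda>x. x powr \<beta> / Gamma (1 + \<beta>)) has_real_derivative
      \<beta> * x powr (\<beta> - 1) / Gamma (1 + \<beta>)) (at x)"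
    using assms Gamma_real_pos[of "1 + \<beta>", THEN less_imp_neq] by (auto intro!: derivative_eq_intros)
  moreover have "Gamma (1 + \<beta>) = \<beta> * Gamma \<beta>"
    using assms Gamma_plus1[of \<beta>] by (force simp: add.commute elim!: nonpos_Ints_cases)
  ultimately show ?thesis
    using assms Gamma_real_pos[of \<beta>] unfolding omega_def[abs_def] by simp
qed

lemma omega_continuous_on: "0 < \<beta> \<Longrightarrow> continuous_on {0..} (omega (1 + \<beta>))"
  unfolding omega_def[abs_def]
  by (intro continuous_intros continuous_on_powr') (auto simp: Gamma_eq_zero_iff nonpos_Ints_def)

lemma omega_integral:
  assumes "0 < \<beta>" "a \<le> c" "c \<le> b"
  shows "set_integrable lborel {a<..<c} (\<lambda>s. omega \<beta> (b - s))"
    and "(LINT s:{a<..<c}|lborel. omega \<beta> (b - s)) = omega (1 + \<beta>) (b - a) - omega (1 + \<beta>) (b - c)"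
proof -
  have "((\<lambda>s. omega \<beta> (b - s)) has_integral
      (- omega (1 + \<beta>) (b - c) - (- omega (1 + \<beta>) (b - a)))) {a..c}"
  proof (rule fundamental_theorem_of_calculus_interior)
    show "continuous_on {a..c} (\<lambda>s. - omega (1 + \<beta>) (b - s))"
      by (intro continuous_intros continuous_on_compose2[OF omega_continuous_on[OF assms(1)]])
        (use assms in auto)
    show "((\<lambda>s. - omega (1 + \<beta>) (b - s)) has_vector_derivative omega \<beta> (b - s)) (at s)"
      if "s \<in> {a<..<c}" for s
      using that assms
      by (auto intro!: derivative_eq_intros DERIV_chain2[OF omega_has_derivative]
          simp flip: has_real_derivative_iff_has_vector_derivative)
  qed (use assms in auto)
  then have hi: "((\<lambda>s. omega \<beta> (b - s)) has_integral
      (omega (1 + \<beta>) (b - a) - omega (1 + \<beta>) (b - c))) {a..c}"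
    by simp
  have "set_borel_measurable lborel {a<..<c} (\<lambda>s. omega \<beta> (b - s))"
    unfolding omega_def by (simp add: set_borel_measurable_def)
  from set_integral_of_nonneg_has_integral[OF hi _ this] omega_nonneg[OF assms(1)]
  show "set_integrable lborel {a<..<c} (\<lambda>s. omega \<beta> (b - s))"
    and "(LINT s:{a<..<c}|lborel. omega \<beta> (b - s)) = omega (1 + \<beta>) (b - a) - omega (1 + \<beta>) (b - c)"
    by blast+
qed

lemma omega_integral_from_zero:
  assumes "0 < \<beta>" "0 \<le> a" "a \<le> c"
  shows "set_integrable lborel {a<..<c} (omega \<beta>)"
    and "(LINT s:{a<..<c}|lborel. omega \<beta> s) = omega (1 + \<beta>) c - omega (1 + \<beta>) a"
proof -
  have hi: "(omega \<beta> has_integral (omega (1 + \<beta>) c - omega (1 + \<beta>) a)) {a..c}"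
  proof (rule fundamental_theorem_of_calculus_interior)
    show "continuous_on {a..c} (omega (1 + \<beta>))"
      using assms by (intro continuous_on_subset[OF omega_continuous_on]) auto
    show "(omega (1 + \<beta>) has_vector_derivative omega \<beta> s) (at s)" if "s \<in> {a<..<c}" for s
      using that assms omega_has_derivative[of \<beta> s]
      by (simp flip: has_real_derivative_iff_has_vector_derivative)
  qed (use assms in auto)
  have "set_borel_measurable lborel {a<..<c} (omega \<beta>)"
    unfolding omega_def[abs_def] by (simp add: set_borel_measurable_def)
  from set_integral_of_nonneg_has_integral[OF hi _ this] omega_nonneg[OF assms(1)]
  show "set_integrable lborel {a<..<c} (omega \<beta>)"
    and "(LINT s:{a<..<c}|lborel. omega \<beta> s) = omega (1 + \<beta>) c - omega (1 + \<beta>) a"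
    by blast+
qed

text \<open>
  The semigroup property of fractional integration, which is Euler's Beta integral after rescaling
  \<open>{0..t}\<close> to the unit interval.
\<close>

lemma omega_convolution:
  assumes "0 < \<beta>" "0 < \<gamma>" "0 < t"
  shows "set_integrable lborel {0<..<t} (\<lambda>s. omega \<beta> (t - s) * omega \<gamma> s)"
    and "(LINT s:{0<..<t}|lborel. omega \<beta> (t - s) * omega \<gamma> s) = omega (\<beta> + \<gamma>) t"
proof -
  define F :: "real \<Rightarrow> real" where "F = (\<lambda>s. s powr (\<gamma> - 1) * (1 - s) powr (\<beta> - 1))"
  define c where "c = t powr (\<beta> + \<gamma> - 2) / (Gamma \<beta> * Gamma \<gamma>)"
  have "(F has_integral Beta \<gamma> \<beta>) (cbox 0 1)"
    using assms has_integral_Beta_real[of \<gamma> \<beta>] by (simp add: F_def)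
  from has_integral_affinity'[OF this, of "1 / t" 0]
  have "((\<lambda>s. F (1 / t * s)) has_integral (t * Beta \<gamma> \<beta>)) {0..t}"
    using assms by simp
  then have "((\<lambda>s. c * F (1 / t * s)) has_integral (c * (t * Beta \<gamma> \<beta>))) {0..t}"
    by (rule has_integral_mult_right)
  moreover have "c * (t * Beta \<gamma> \<beta>) = omega (\<beta> + \<gamma>) t"
  proof -
    have "t powr (\<beta> + \<gamma> - 2) * t = t powr (\<beta> + \<gamma> - 1)"
      using assms powr_add[of t "\<beta> + \<gamma> - 2" 1] by simp
    moreover have "Gamma \<beta> \<noteq> 0" "Gamma \<gamma> \<noteq> 0"
      using assms Gamma_real_pos by (metis less_irrefl)+
    ultimately show ?thesis
      unfolding omega_def Beta_def c_def by (simp add: divide_simps add.commute)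
  qed
  moreover have "c * F (1 / t * s) = omega \<beta> (t - s) * omega \<gamma> s" if "s \<in> {0..t}" for s
  proof -
    have "1 - 1 / t * s = (t - s) / t" using assms by (simp add: field_simps)
    then have "F (1 / t * s) = s powr (\<gamma> - 1) / t powr (\<gamma> - 1) * ((t - s) powr (\<beta> - 1) / t powr (\<beta> - 1))"
      using that assms unfolding F_def by (simp add: powr_divide)
    moreover have "t powr (\<beta> + \<gamma> - 2) = t powr (\<gamma> - 1) * t powr (\<beta> - 1)"
      by (simp add: add.commute flip: powr_add)
    ultimately show ?thesis
      using assms unfolding omega_def c_def by simp
  qed
  ultimately have hi: "((\<lambda>s. omega \<beta> (t - s) * omega \<gamma> s) has_integral omega (\<beta> + \<gamma>) t) {0..t}"
    using has_integral_cong[of "{0..t}" "\<lambda>s. c * F (1 / t * s)" "\<lambda>s. omega \<beta> (t - s) * omega \<gamma> s"] by simp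
  have "set_borel_measurable lborel {0<..<t} (\<lambda>s. omega \<beta> (t - s) * omega \<gamma> s)"
    unfolding omega_def by (simp add: set_borel_measurable_def)
  from set_integral_of_nonneg_has_integral[OF hi _ this] omega_nonneg assms
  show "set_integrable lborel {0<..<t} (\<lambda>s. omega \<beta> (t - s) * omega \<gamma> s)"
    and "(LINT s:{0<..<t}|lborel. omega \<beta> (t - s) * omega \<gamma> s) = omega (\<beta> + \<gamma>) t"
    by simp_all
qed

lemma omega_mean_value:
  assumes "0 < \<beta>" "a < c" "c \<le> b"
  obtains \<xi> where "a < \<xi>" "\<xi> < c"
    "(LINT s:{a<..<c}|lborel. omega \<beta> (b - s)) = (c - a) * omega \<beta> (b - \<xi>)"
proof -
  have der: "((\<lambda>s. - omega (1 + \<beta>) (b - s)) has_real_derivative omega \<beta> (b - s)) (at s)"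
    if "s < c" for s
    using that assms by (auto intro!: derivative_eq_intros DERIV_chain2[OF omega_has_derivative])
  have cont: "continuous_on {a..c} (\<lambda>s. - omega (1 + \<beta>) (b - s))"
    by (intro continuous_intros continuous_on_compose2[OF omega_continuous_on[OF assms(1)]])
      (use assms in auto)
  obtain l \<xi> where "a < \<xi>" "\<xi> < c" and l: "((\<lambda>s. - omega (1 + \<beta>) (b - s)) has_real_derivative l) (at \<xi>)"
    "- omega (1 + \<beta>) (b - c) - (- omega (1 + \<beta>) (b - a)) = (c - a) * l"
    using MVT[OF assms(2) cont] der real_differentiable_def by blast
  moreover have "l = omega \<beta> (b - \<xi>)"
    using DERIV_unique[OF l(1) der] \<open>\<xi> < c\<close> by blast
  ultimately show thesis
    using omega_integral(2)[of \<beta> a c b] assms that by auto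
qed

section \<open>Replacing a monotone weight by its mean\<close>

text \<open>
  Chebyshev's inequality: if the mean of \<open>w\<close> is attained at \<open>\<xi>\<close>, then \<open>w s - w \<xi>\<close> and \<open>\<phi> s - \<phi> \<xi>\<close> have
  opposite signs everywhere, and it suffices to integrate their product.
\<close>

lemma set_integral_increasing_times_decreasing_le:
  fixes w \<phi> :: "real \<Rightarrow> real"
  assumes w: "set_integrable lborel {a<..<c} w" and \<phi>: "set_integrable lborel {a<..<c} \<phi>"
    and w\<phi>: "set_integrable lborel {a<..<c} (\<lambda>s. w s * \<phi> s)"
    and mono: "\<And>r s. a < r \<Longrightarrow> r \<le> s \<Longrightarrow> s < c \<Longrightarrow> w r \<le> w s"
    and antimono: "\<And>r s. a < r \<Longrightarrow> r \<le> s \<Longrightarrow> s < c \<Longrightarrow> \<phi> s \<le> \<phi> r"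
    and \<xi>: "a < \<xi>" "\<xi> < c" and avg: "(LINT s:{a<..<c}|lborel. w s) = (c - a) * w \<xi>"
  shows "(LINT s:{a<..<c}|lborel. w s * \<phi> s) \<le> w \<xi> * (LINT s:{a<..<c}|lborel. \<phi> s)"
proof -
  note [simp] = set_integrable_const_Ioo
  have "(LINT s:{a<..<c}|lborel. w s * \<phi> s) \<le>
      (LINT s:{a<..<c}|lborel. w \<xi> * \<phi> s + \<phi> \<xi> * w s - w \<xi> * \<phi> \<xi>)"
  proof (rule set_integral_mono)
    show "set_integrable lborel {a<..<c} (\<lambda>s. w \<xi> * \<phi> s + \<phi> \<xi> * w s - w \<xi> * \<phi> \<xi>)"
      using w \<phi> by (intro set_integral_add set_integral_diff set_integrable_mult_right) auto
    show "w s * \<phi> s \<le> w \<xi> * \<phi> s + \<phi> \<xi> * w s - w \<xi> * \<phi> \<xi>" if "s \<in> {a<..<c}" for s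
    proof -
      have "(w s - w \<xi>) * (\<phi> s - \<phi> \<xi>) \<le> 0"
        using mono[of s \<xi>] mono[of \<xi> s] antimono[of s \<xi>] antimono[of \<xi> s] that \<xi>
        by (cases "s \<le> \<xi>") (auto intro: mult_nonpos_nonneg mult_nonneg_nonpos)
      then show ?thesis by (simp add: algebra_simps)
    qed
  qed (rule w\<phi>)
  also have "\<dots> = w \<xi> * (LINT s:{a<..<c}|lborel. \<phi> s) + \<phi> \<xi> * (LINT s:{a<..<c}|lborel. w s)
      - (c - a) * (w \<xi> * \<phi> \<xi>)"
    using w \<phi> \<xi> by (simp add: set_integral_add set_integral_diff set_integral_const_Ioo)
  also have "\<dots> = w \<xi> * (LINT s:{a<..<c}|lborel. \<phi> s)"
    by (simp add: avg)
  finally show ?thesis .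
qed

text \<open>
  One half of the Hermite-Hadamard inequality for the convex function \<open>s \<mapsto> omega (1 - \<alpha>) (b - s)\<close>. The
  right-hand side minus the left-hand side vanishes at \<open>c = a\<close> and is nondecreasing in \<open>c\<close>.
\<close>

lemma omega_avg_le_mean_endpoints:
  assumes \<alpha>: "0 < \<alpha>" "\<alpha> < 1" and ac: "a \<le> c" "c < b"
  shows "omega (2 - \<alpha>) (b - a) - omega (2 - \<alpha>) (b - c) \<le>
    (c - a) * ((omega (1 - \<alpha>) (b - a) + omega (1 - \<alpha>) (b - c)) / 2)"
proof -
  define w where "w x = omega (1 - \<alpha>) (b - x)" for x
  define w' where "w' x = \<alpha> * (b - x) powr (- \<alpha> - 1) / Gamma (1 - \<alpha>)" for x
  have G: "Gamma (1 - \<alpha>) > 0" using \<alpha> by (simp add: Gamma_real_pos)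
  have w: "(w has_real_derivative w' x) (at x)" if "x < b" for x
    unfolding w_def[abs_def] w'_def omega_def using that G
    by (auto intro!: derivative_eq_intros)
  have w'_mono: "w' x \<le> w' y" if "x \<le> y" "y < b" for x y
    unfolding w'_def using that \<alpha> G
    by (intro divide_right_mono mult_left_mono powr_mono2') auto
  define D where "D x = (x - a) * ((w a + w x) / 2) + omega (2 - \<alpha>) (b - x)" for x
  have "D a \<le> D c"
  proof (rule DERIV_nonneg_imp_nondecreasing[OF ac(1)])
    fix x assume x: "a \<le> x" "x \<le> c"
    have "((\<lambda>x. omega (2 - \<alpha>) (b - x)) has_real_derivative - w x) (at x)"
      using DERIV_chain2[of "omega (2 - \<alpha>)" "w x" "\<lambda>x. b - x" x "-1" UNIV] x ac \<alpha>
        omega_has_derivative[of "1 - \<alpha>" "b - x"]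
      by (simp add: w_def) (use DERIV_diff[OF DERIV_const DERIV_ident] in fastforce)
    then have "(D has_real_derivative ((w a + w x) / 2 + (x - a) * (w' x / 2) - w x)) (at x)"
      using x ac unfolding D_def[abs_def] by (auto intro!: derivative_eq_intros w)
    moreover have "w x - w a \<le> (x - a) * w' x"
    proof (cases "a < x")
      case True
      then obtain z where "a < z" "z < x" "w x - w a = (x - a) * w' z"
        using MVT2[of a x w w'] w x ac by auto
      then show ?thesis using w'_mono[of z x] x ac by (simp add: mult_left_mono)
    qed (use x in auto)
    ultimately show "\<exists>y. (D has_real_derivative y) (at x) \<and> 0 \<le> y"
      by (intro exI[of _ "(w a + w x) / 2 + (x - a) * (w' x / 2) - w x"]) (auto simp: field_simps)
  qed
  then show ?thesis by (simp add: D_def w_def)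
qed

text \<open>
  Since \<open>w - A\<close> has mean zero, any constant \<open>d\<close> may be subtracted from \<open>q\<close>.
\<close>

lemma mean_weight_defect:
  fixes w q :: "real \<Rightarrow> real"
  assumes ac: "a \<le> c" and w: "set_integrable lborel {a<..<c} w" and q: "set_integrable lborel {a<..<c} q"
    and wq: "set_integrable lborel {a<..<c} (\<lambda>s. w s * q s)"
    and A: "(LINT s:{a<..<c}|lborel. w s) = (c - a) * A"
  shows "set_integrable lborel {a<..<c} (\<lambda>s. (w s - A) * (q s - d))"
    and "\<bar>(LINT s:{a<..<c}|lborel. w s * q s) - A * (LINT s:{a<..<c}|lborel. q s)\<bar>
      \<le> (LINT s:{a<..<c}|lborel. \<bar>(w s - A) * (q s - d)\<bar>)"
proof -
  note [simp] = set_integrable_const_Ioo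
  show int: "set_integrable lborel {a<..<c} (\<lambda>s. (w s - A) * (q s - d))"
    using w q wq by (simp add: algebra_simps)
  have "(LINT s:{a<..<c}|lborel. (w s - A) * (q s - d)) =
      (LINT s:{a<..<c}|lborel. w s * q s - A * q s - d * w s + A * d)"
    by (simp add: algebra_simps)
  also have "\<dots> = (LINT s:{a<..<c}|lborel. w s * q s) - A * (LINT s:{a<..<c}|lborel. q s)"
    using w q wq ac A by (simp add: set_integral_add set_integral_diff set_integral_const_Ioo)
  finally show "\<bar>(LINT s:{a<..<c}|lborel. w s * q s) - A * (LINT s:{a<..<c}|lborel. q s)\<bar>
      \<le> (LINT s:{a<..<c}|lborel. \<bar>(w s - A) * (q s - d)\<bar>)"
    using set_integral_norm_bound[OF int] by simp
qed

text \<open>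
  On an interval that ends before the singularity, the mean \<open>A\<close> lies in the lower half of the range of
  the weight, so the supremum of \<open>\<bar>w - A\<bar>\<close> is attained at the right end point. This particular bound is
  chosen because it telescopes over the intervals.
\<close>

lemma quadrature_error_interior:
  fixes q \<phi> :: "real \<Rightarrow> real"
  assumes \<alpha>: "0 < \<alpha>" "\<alpha> < 1" and ac: "a < c" "c < b"
    and A: "(LINT s:{a<..<c}|lborel. omega (1 - \<alpha>) (b - s)) = (c - a) * A"
    and q: "set_integrable lborel {a<..<c} q" and \<phi>: "set_integrable lborel {a<..<c} \<phi>"
    and wq: "set_integrable lborel {a<..<c} (\<lambda>s. omega (1 - \<alpha>) (b - s) * q s)"
    and bound: "\<And>s. a < s \<Longrightarrow> s < c \<Longrightarrow> \<bar>q s - d\<bar> \<le> \<phi> s"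
  shows "\<bar>(LINT s:{a<..<c}|lborel. omega (1 - \<alpha>) (b - s) * q s) - A * (LINT s:{a<..<c}|lborel. q s)\<bar>
    \<le> (omega (1 - \<alpha>) (b - c) - A) * (LINT s:{a<..<c}|lborel. \<phi> s)"
proof -
  note [simp] = set_integrable_const_Ioo
  define w where "w s = omega (1 - \<alpha>) (b - s)" for s
  have w: "set_integrable lborel {a<..<c} w"
    unfolding w_def using omega_integral(1)[of "1 - \<alpha>" a c b] \<alpha> ac by simp
  have A_le: "A \<le> (w a + w c) / 2"
  proof -
    have "(c - a) * A \<le> (c - a) * ((w a + w c) / 2)"
      using omega_avg_le_mean_endpoints[OF \<alpha>, of a c b] omega_integral(2)[of "1 - \<alpha>" a c b] A \<alpha> ac
      by (simp add: w_def)
    then show ?thesis using ac by simp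
  qed
  have wA: "\<bar>w s - A\<bar> \<le> w c - A" if "a < s" "s < c" for s
  proof -
    have "w a \<le> w s" "w s \<le> w c"
      unfolding w_def using that \<alpha> ac by (auto intro!: omega_antimono)
    then show ?thesis using A_le by (auto simp: abs_le_iff)
  qed
  note defect = mean_weight_defect[OF less_imp_le[OF ac(1)] w q wq[folded w_def] A[folded w_def], of d]
  have "\<bar>(LINT s:{a<..<c}|lborel. w s * q s) - A * (LINT s:{a<..<c}|lborel. q s)\<bar>
      \<le> (LINT s:{a<..<c}|lborel. \<bar>(w s - A) * (q s - d)\<bar>)"
    by (rule defect(2))
  also have "\<dots> \<le> (LINT s:{a<..<c}|lborel. (w c - A) * \<phi> s)"
  proof (rule set_integral_mono)
    show "set_integrable lborel {a<..<c} (\<lambda>s. \<bar>(w s - A) * (q s - d)\<bar>)"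
      using defect(1) by (rule set_integrable_abs)
    show "\<bar>(w s - A) * (q s - d)\<bar> \<le> (w c - A) * \<phi> s" if "s \<in> {a<..<c}" for s
      using that wA[of s] bound[of s] by (auto simp: abs_mult intro!: mult_mono)
  qed (use \<phi> in \<open>auto intro: set_integrable_mult_right\<close>)
  finally show ?thesis by (simp add: w_def)
qed

text \<open>
  At the singularity the weight is unbounded and only its integral is available. If the majorant \<open>\<phi>\<close> of
  the oscillation is nonincreasing, Chebyshev's inequality bounds \<open>\<integral>w \<phi>\<close> by \<open>A \<integral>\<phi>\<close> even when \<open>\<phi>\<close> is
  itself singular at the left end point.
\<close>

lemma quadrature_error_last:
  fixes q \<phi> :: "real \<Rightarrow> real"
  assumes \<alpha>: "0 < \<alpha>" "\<alpha> < 1" and ab: "a < b"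
    and A: "(LINT s:{a<..<b}|lborel. omega (1 - \<alpha>) (b - s)) = (b - a) * A"
    and q: "set_integrable lborel {a<..<b} q" and \<phi>: "set_integrable lborel {a<..<b} \<phi>"
    and wq: "set_integrable lborel {a<..<b} (\<lambda>s. omega (1 - \<alpha>) (b - s) * q s)"
    and w\<phi>: "set_integrable lborel {a<..<b} (\<lambda>s. omega (1 - \<alpha>) (b - s) * \<phi> s)"
    and bound: "\<And>s. a < s \<Longrightarrow> s < b \<Longrightarrow> \<bar>q s - d\<bar> \<le> \<phi> s"
    and antimono: "\<And>r s. a < r \<Longrightarrow> r \<le> s \<Longrightarrow> s < b \<Longrightarrow> \<phi> s \<le> \<phi> r"
  shows "\<bar>(LINT s:{a<..<b}|lborel. omega (1 - \<alpha>) (b - s) * q s) - A * (LINT s:{a<..<b}|lborel. q s)\<bar>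
    \<le> 2 * A * (LINT s:{a<..<b}|lborel. \<phi> s)"
proof -
  note [simp] = set_integrable_const_Ioo
  define w where "w s = omega (1 - \<alpha>) (b - s)" for s
  have w: "set_integrable lborel {a<..<b} w"
    unfolding w_def using omega_integral(1)[of "1 - \<alpha>" a b b] \<alpha> ab by simp
  obtain \<xi> where \<xi>: "a < \<xi>" "\<xi> < b" "(LINT s:{a<..<b}|lborel. w s) = (b - a) * w \<xi>"
    using omega_mean_value[of "1 - \<alpha>" a b b] \<alpha> ab unfolding w_def by auto
  have A_eq: "A = w \<xi>"
    using A \<xi> ab by (simp add: w_def)
  have A_nonneg: "0 \<le> A" unfolding A_eq w_def using \<alpha> by (simp add: omega_nonneg)
  note defect = mean_weight_defect[OF less_imp_le[OF ab] w q wq[folded w_def] A[folded w_def], of d]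
  have "\<bar>(LINT s:{a<..<b}|lborel. w s * q s) - A * (LINT s:{a<..<b}|lborel. q s)\<bar>
      \<le> (LINT s:{a<..<b}|lborel. \<bar>(w s - A) * (q s - d)\<bar>)"
    by (rule defect(2))
  also have "\<dots> \<le> (LINT s:{a<..<b}|lborel. w s * \<phi> s + A * \<phi> s)"
  proof (rule set_integral_mono)
    show "set_integrable lborel {a<..<b} (\<lambda>s. \<bar>(w s - A) * (q s - d)\<bar>)"
      using defect(1) by (rule set_integrable_abs)
    show "set_integrable lborel {a<..<b} (\<lambda>s. w s * \<phi> s + A * \<phi> s)"
      using w\<phi> \<phi> by (auto simp: w_def intro!: set_integral_add)
    show "\<bar>(w s - A) * (q s - d)\<bar> \<le> w s * \<phi> s + A * \<phi> s" if "s \<in> {a<..<b}" for s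
    proof -
      have "0 \<le> w s" unfolding w_def using \<alpha> by (simp add: omega_nonneg)
      then have "\<bar>w s - A\<bar> \<le> w s + A" using A_nonneg by auto
      then have "\<bar>w s - A\<bar> * \<bar>q s - d\<bar> \<le> (w s + A) * \<phi> s"
        using that bound[of s] by (intro mult_mono) auto
      also have "\<dots> = w s * \<phi> s + A * \<phi> s" by (rule distrib_right)
      finally show ?thesis by (simp only: abs_mult)
    qed
  qed
  also have "\<dots> = (LINT s:{a<..<b}|lborel. w s * \<phi> s) + A * (LINT s:{a<..<b}|lborel. \<phi> s)"
    using w\<phi> \<phi> by (simp add: set_integral_add w_def)
  also have "(LINT s:{a<..<b}|lborel. w s * \<phi> s) \<le> w \<xi> * (LINT s:{a<..<b}|lborel. \<phi> s)"
    using w \<phi> w\<phi> \<xi> antimono \<alpha>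
    by (intro set_integral_increasing_times_decreasing_le) (auto simp: w_def[abs_def] intro!: omega_antimono)
  finally show ?thesis by (simp add: w_def A_eq mult_ac)
qed

section \<open>Complementary weights of a triangular array\<close>

text \<open>
  Built downwards from \<open>j = n\<close>: the equation for \<open>k\<close> determines \<open>p k\<close>, and \<open>p k \<ge> 0\<close> because by
  monotonicity the terms \<open>j > k\<close> contribute at most what they contribute to the equation for \<open>k + 1\<close>,
  namely one.
\<close>

lemma complementary_weights_exist:
  fixes a :: "nat \<Rightarrow> nat \<Rightarrow> real"
  assumes pos: "\<And>j k. 1 \<le> k \<Longrightarrow> k \<le> j \<Longrightarrow> j \<le> n \<Longrightarrow> 0 < a j k"
    and mono: "\<And>j k. 1 \<le> k \<Longrightarrow> k < j \<Longrightarrow> j \<le> n \<Longrightarrow> a j k \<le> a j (Suc k)"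
  obtains p where "\<And>j. 1 \<le> j \<Longrightarrow> j \<le> n \<Longrightarrow> 0 \<le> p j"
    and "\<And>k. 1 \<le> k \<Longrightarrow> k \<le> n \<Longrightarrow> (\<Sum>j=k..n. p j * a j k) = 1"
proof -
  have "\<exists>p. (\<forall>j. n - d < j \<and> j \<le> n \<longrightarrow> 0 \<le> p j) \<and>
      (\<forall>k. n - d < k \<and> k \<le> n \<longrightarrow> (\<Sum>j=k..n. p j * a j k) = 1)" if "d \<le> n" for d
    using that
  proof (induction d)
    case 0
    then show ?case by auto
  next
    case (Suc d)
    then obtain p where p: "\<And>j. n - d < j \<Longrightarrow> j \<le> n \<Longrightarrow> 0 \<le> p j"
      and p1: "\<And>k. n - d < k \<Longrightarrow> k \<le> n \<Longrightarrow> (\<Sum>j=k..n. p j * a j k) = 1" by auto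
    define m where "m = n - d"
    have m: "1 \<le> m" "m \<le> n" "n - Suc d = m - 1" using Suc.prems by (auto simp: m_def)
    define r where "r = (1 - (\<Sum>j=Suc m..n. p j * a j m)) / a m m"
    have "(\<Sum>j=Suc m..n. p j * a j m) \<le> 1"
    proof (cases "m = n")
      case False
      have "(\<Sum>j=Suc m..n. p j * a j m) \<le> (\<Sum>j=Suc m..n. p j * a j (Suc m))"
        using m p mono[of m] by (intro sum_mono mult_left_mono) (auto simp: m_def)
      also have "\<dots> = 1" using p1[of "Suc m"] m False by (auto simp: m_def)
      finally show ?thesis .
    qed simp
    then have r: "0 \<le> r" using pos[of m m] m by (simp add: r_def less_imp_le)
    have sum_upd: "(\<Sum>j=k..n. (p(m := r)) j * a j k) = (\<Sum>j=k..n. p j * a j k)" if "m < k" for k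
      using that by (intro sum.cong) auto
    have "(\<Sum>j=m..n. (p(m := r)) j * a j m) = r * a m m + (\<Sum>j=Suc m..n. p j * a j m)"
      using m sum_upd[of "Suc m"] by (simp add: sum.atLeast_Suc_atMost)
    also have "\<dots> = 1" using pos[of m m] m by (simp add: r_def)
    finally have at_m: "(\<Sum>j=m..n. (p(m := r)) j * a j m) = 1" .
    show ?case
    proof (intro exI[of _ "p(m := r)"] conjI allI impI)
      fix j assume "n - Suc d < j \<and> j \<le> n"
      then have "m \<le> j" "j \<le> n" unfolding m(3) by auto
      then show "0 \<le> (p(m := r)) j" using r p[of j] unfolding m_def[symmetric] by (cases "j = m") auto
    next
      fix k assume "n - Suc d < k \<and> k \<le> n"
      then have k: "m \<le> k" "k \<le> n" unfolding m(3) by auto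
      show "(\<Sum>j=k..n. (p(m := r)) j * a j k) = 1"
      proof (cases "k = m")
        case False
        then show ?thesis using k sum_upd[of k] p1[of k] unfolding m_def[symmetric] by simp
      qed (use at_m in simp)
    qed
  qed
  from this[of n] obtain p where "\<And>j. 0 < j \<Longrightarrow> j \<le> n \<Longrightarrow> 0 \<le> p j"
    "\<And>k. 0 < k \<Longrightarrow> k \<le> n \<Longrightarrow> (\<Sum>j=k..n. p j * a j k) = 1" by auto
  then show thesis by (intro that[of p]) simp_all
qed

lemma sum_triangle_swap:
  fixes f :: "nat \<Rightarrow> nat \<Rightarrow> real"
  shows "(\<Sum>j=1..n. \<Sum>k=1..j. f j k) = (\<Sum>k=1..n. \<Sum>j=k..n. f j k)"
  by (simp add: sum.Sigma) (rule sum.reindex_bij_witness[of _ "\<lambda>(k, j). (j, k)" "\<lambda>(j, k). (k, j)"]; auto)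

lemma sum_increments:
  fixes V :: "nat \<Rightarrow> real"
  shows "(\<Sum>k=1..n. V k - V (k - 1)) = V n - V 0"
  by (induction n) auto

text \<open>
  The complementary weights invert the triangular array: if \<open>d\<close> are increments of a sequence, the
  right-hand side is the sequence itself.
\<close>

lemma complementary_sum_increments:
  fixes a :: "nat \<Rightarrow> nat \<Rightarrow> real"
  assumes "\<And>k. 1 \<le> k \<Longrightarrow> k \<le> n \<Longrightarrow> (\<Sum>j=k..n. p j * a j k) = 1"
  shows "(\<Sum>j=1..n. p j * (\<Sum>k=1..j. a j k * d k)) = (\<Sum>k=1..n. d k)"
proof -
  have "(\<Sum>j=1..n. p j * (\<Sum>k=1..j. a j k * d k)) = (\<Sum>j=1..n. \<Sum>k=1..j. p j * a j k * d k)"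
    by (simp add: sum_distrib_left mult.assoc)
  also have "\<dots> = (\<Sum>k=1..n. \<Sum>j=k..n. p j * a j k * d k)"
    by (rule sum_triangle_swap)
  also have "\<dots> = (\<Sum>k=1..n. d k)"
    using assms by (intro sum.cong) (auto simp flip: sum_distrib_right)
  finally show ?thesis .
qed

section \<open>Energy inequality for grid functions\<close>

text \<open>
  Summation by parts: every \<open>z k\<close> with \<open>k < j\<close> carries the nonpositive coefficient \<open>b k - b (Suc k)\<close>.
\<close>

lemma sum_increasing_weights_increments_le:
  fixes b z :: "nat \<Rightarrow> real"
  assumes "\<And>k. 1 \<le> k \<Longrightarrow> k \<le> j \<Longrightarrow> 0 \<le> b k" "\<And>k. 1 \<le> k \<Longrightarrow> k < j \<Longrightarrow> b k \<le> b (Suc k)"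
    "\<And>k. k \<le> j \<Longrightarrow> 0 \<le> z k" "1 \<le> j"
  shows "(\<Sum>k=1..j. b k * (z k - z (k - 1))) \<le> b j * z j"
  using assms(4,1-3)
proof (induction j rule: nat_induct_at_least)
  case base
  then show ?case by (simp add: right_diff_distrib)
next
  case (Suc j)
  have "(\<Sum>k=1..j. b k * (z k - z (k - 1))) \<le> b j * z j"
    using Suc by auto
  also have "\<dots> \<le> b (Suc j) * z j"
    using Suc.prems Suc.hyps by (intro mult_right_mono) auto
  finally show ?case by (simp add: algebra_simps)
qed

lemma grid_norm_nonneg: "0 \<le> h \<Longrightarrow> 0 \<le> grid_norm h M v"
  unfolding grid_norm_def by (intro real_sqrt_ge_zero mult_nonneg_nonneg sum_nonneg) auto

lemma grid_norm_sq: "0 \<le> h \<Longrightarrow> (grid_norm h M v)\<^sup>2 = h * (\<Sum>i\<in>{1..<M}. v i * v i)"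
  unfolding grid_norm_def by (subst real_sqrt_pow2) (simp_all add: power2_eq_square sum_nonneg)

lemma grid_norm_eq_L2_set: "grid_norm h M v = sqrt h * L2_set v {1..<M}"
  unfolding grid_norm_def L2_set_def by (simp add: real_sqrt_mult)

lemma grid_inner_le:
  assumes "0 \<le> h"
  shows "h * (\<Sum>i\<in>{1..<M}. v i * w i) \<le> grid_norm h M v * grid_norm h M w"
proof -
  have "(\<Sum>i\<in>{1..<M}. v i * w i) \<le> (\<Sum>i\<in>{1..<M}. \<bar>v i\<bar> * \<bar>w i\<bar>)"
    by (intro sum_mono) (simp flip: abs_mult)
  also have "\<dots> \<le> L2_set v {1..<M} * L2_set w {1..<M}"
    by (rule L2_set_mult_ineq)
  finally have "h * (\<Sum>i\<in>{1..<M}. v i * w i) \<le> h * (L2_set v {1..<M} * L2_set w {1..<M})"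
    using assms by (rule mult_left_mono)
  also have "\<dots> = (sqrt h * sqrt h) * (L2_set v {1..<M} * L2_set w {1..<M})"
    using assms by simp
  finally show ?thesis by (simp only: grid_norm_eq_L2_set mult_ac)
qed

text \<open>
  The length \<open>l\<close> of the spatial interval replaces the number of grid points.
\<close>

lemma grid_norm_le_uniform:
  assumes h: "0 \<le> h" "h * real M \<le> l" and b: "\<And>i. i \<in> {1..<M} \<Longrightarrow> \<bar>v i\<bar> \<le> b" and b0: "0 \<le> b"
  shows "grid_norm h M v \<le> sqrt l * b"
proof -
  have "(\<Sum>i\<in>{1..<M}. (v i)\<^sup>2) \<le> (\<Sum>i\<in>{1..<M}. b\<^sup>2)"
    using b by (intro sum_mono) (metis abs_le_square_iff abs_of_nonneg b0)
  also have "\<dots> \<le> real M * b\<^sup>2"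
    by (simp add: mult_right_mono)
  finally have "h * (\<Sum>i\<in>{1..<M}. (v i)\<^sup>2) \<le> h * (real M * b\<^sup>2)"
    using h by (intro mult_left_mono)
  also have "\<dots> \<le> l * b\<^sup>2"
    using h by (simp add: mult_right_mono flip: mult.assoc)
  finally show ?thesis
    unfolding grid_norm_def using b0 by (metis real_sqrt_le_mono real_sqrt_mult real_sqrt_unique)
qed

text \<open>
  By \<open>2 v\<^sub>i v\<^bsub>i\<plusminus>1\<^esub> \<le> v\<^sub>i\<^sup>2 + v\<^bsub>i\<plusminus>1\<^esub>\<^sup>2\<close> the sum is at most half the sum of the second differences of \<open>v\<^sup>2\<close>,
  which telescopes to boundary terms.
\<close>

lemma discrete_laplacian_nonpos:
  assumes "v 0 = 0" "v M = 0" "1 \<le> M"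
  shows "(\<Sum>i\<in>{1..<M}. v i * discrete_laplacian h v i) \<le> 0"
proof -
  have tele: "(\<Sum>i\<in>{1..<m}. (v (i + 1))\<^sup>2 - 2 * (v i)\<^sup>2 + (v (i - 1))\<^sup>2) =
      (v m)\<^sup>2 - (v (m - 1))\<^sup>2 - ((v 1)\<^sup>2 - (v 0)\<^sup>2)" if "1 \<le> m" for m
    using that by (induction m rule: nat_induct_at_least) auto
  have "(\<Sum>i\<in>{1..<M}. v i * discrete_laplacian h v i) =
      (\<Sum>i\<in>{1..<M}. v i * (v (i + 1) - 2 * v i + v (i - 1))) / h\<^sup>2"
    by (simp add: discrete_laplacian_def sum_divide_distrib)
  also have "\<dots> \<le> (\<Sum>i\<in>{1..<M}. ((v (i + 1))\<^sup>2 - 2 * (v i)\<^sup>2 + (v (i - 1))\<^sup>2) / 2) / h\<^sup>2"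
  proof (intro divide_right_mono sum_mono)
    fix i
    show "v i * (v (i + 1) - 2 * v i + v (i - 1)) \<le> ((v (i + 1))\<^sup>2 - 2 * (v i)\<^sup>2 + (v (i - 1))\<^sup>2) / 2"
      using sum_squares_bound[of "v i" "v (i + 1)"] sum_squares_bound[of "v i" "v (i - 1)"]
      by (simp add: power2_eq_square algebra_simps)
  qed simp
  also have "\<dots> = ((v M)\<^sup>2 - (v (M - 1))\<^sup>2 - ((v 1)\<^sup>2 - (v 0)\<^sup>2)) / 2 / h\<^sup>2"
    using tele[OF assms(3)] by (simp flip: sum_divide_distrib)
  also have "\<dots> \<le> 0"
    using assms by (simp add: divide_le_0_iff)
  finally show ?thesis .
qed

text \<open>
  With \<open>y k\<close> the norm of \<open>e k\<close>, the numbers \<open>z k = y j * y k - \<langle>e j, e k\<rangle>\<close> are nonnegative by Cauchy-Schwarz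
  and \<open>z j = 0\<close>. So the weighted sum of their increments is nonpositive, that is, testing the discrete
  derivative of \<open>e\<close> with \<open>e j\<close> gives at least \<open>y j\<close> times the discrete derivative of \<open>y\<close>.
\<close>

lemma energy_inequality:
  fixes e :: "nat \<Rightarrow> nat \<Rightarrow> real"
  assumes h: "0 \<le> h" and M: "1 \<le> M" and j: "1 \<le> j"
    and b: "\<And>k. 1 \<le> k \<Longrightarrow> k \<le> j \<Longrightarrow> 0 \<le> b k" "\<And>k. 1 \<le> k \<Longrightarrow> k < j \<Longrightarrow> b k \<le> b (Suc k)"
    and bdry: "e j 0 = 0" "e j M = 0"
    and eq: "\<And>i. i \<in> {1..<M} \<Longrightarrow> (\<Sum>k=1..j. b k * (e k i - e (k - 1) i)) =
        discrete_laplacian h' (e j) i + \<kappa> * e j i + r i"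
  shows "(\<Sum>k=1..j. b k * (grid_norm h M (e k) - grid_norm h M (e (k - 1)))) \<le>
     max \<kappa> 0 * grid_norm h M (e j) + grid_norm h M r"
proof -
  define y where "y k = grid_norm h M (e k)" for k
  define I where "I v = h * (\<Sum>i\<in>{1..<M}. e j i * v i)" for v
  have y: "0 \<le> y k" for k using h by (simp add: y_def grid_norm_nonneg)
  have I_self: "I (e j) = y j * y j"
    using grid_norm_sq[OF h, of M "e j"] by (simp add: I_def y_def power2_eq_square)
  define z where "z k = y j * y k - I (e k)" for k
  have z: "0 \<le> z k" for k
    using grid_inner_le[OF h, of "e j" "e k" M] by (simp add: z_def I_def y_def)
  have "(\<Sum>k=1..j. b k * (z k - z (k - 1))) \<le> b j * z j"
    using b z j by (intro sum_increasing_weights_increments_le) auto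
  also have "z j = 0" by (simp add: z_def I_self)
  finally have "(\<Sum>k=1..j. b k * (z k - z (k - 1))) \<le> 0" by simp
  moreover have "(\<Sum>k=1..j. b k * (z k - z (k - 1))) =
      y j * (\<Sum>k=1..j. b k * (y k - y (k - 1))) - (\<Sum>k=1..j. b k * (I (e k) - I (e (k - 1))))"
    by (simp add: z_def sum_distrib_left algebra_simps sum.distrib sum_subtractf)
  moreover have "(\<Sum>k=1..j. b k * (I (e k) - I (e (k - 1)))) =
      I (\<lambda>i. \<Sum>k=1..j. b k * (e k i - e (k - 1) i))"
  proof -
    have "(\<Sum>k=1..j. b k * (I (e k) - I (e (k - 1)))) =
        (\<Sum>k=1..j. \<Sum>i\<in>{1..<M}. h * (e j i * (b k * (e k i - e (k - 1) i))))"
      by (simp add: I_def sum_distrib_left algebra_simps flip: sum_subtractf)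
    also have "\<dots> = (\<Sum>i\<in>{1..<M}. \<Sum>k=1..j. h * (e j i * (b k * (e k i - e (k - 1) i))))"
      by (rule sum.swap)
    finally show ?thesis by (simp add: I_def sum_distrib_left)
  qed
  moreover have "I (\<lambda>i. \<Sum>k=1..j. b k * (e k i - e (k - 1) i)) =
      h * (\<Sum>i\<in>{1..<M}. e j i * discrete_laplacian h' (e j) i) + \<kappa> * I (e j) + I r"
  proof -
    have "I (\<lambda>i. \<Sum>k=1..j. b k * (e k i - e (k - 1) i)) =
        h * (\<Sum>i\<in>{1..<M}. e j i * (discrete_laplacian h' (e j) i + \<kappa> * e j i + r i))"
      unfolding I_def using eq by simp
    then show ?thesis
      by (simp add: I_def sum_distrib_left algebra_simps sum.distrib)
  qed
  moreover have "h * (\<Sum>i\<in>{1..<M}. e j i * discrete_laplacian h' (e j) i) \<le> 0"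
    using discrete_laplacian_nonpos[of "e j" M h'] bdry M h by (simp add: mult_nonneg_nonpos)
  moreover have "I r \<le> y j * grid_norm h M r"
    using grid_inner_le[OF h, of "e j" r M] by (simp add: I_def y_def)
  moreover have "\<kappa> * I (e j) \<le> max \<kappa> 0 * (y j * y j)"
    unfolding I_self using y by (intro mult_right_mono) auto
  ultimately have *: "y j * (\<Sum>k=1..j. b k * (y k - y (k - 1))) \<le>
      y j * (max \<kappa> 0 * y j + grid_norm h M r)"
    by (simp add: algebra_simps)
  show ?thesis
  proof (cases "y j = 0")
    case True
    have "(\<Sum>k=1..j. b k * (y k - y (k - 1))) \<le> b j * y j"
      using b y j by (intro sum_increasing_weights_increments_le) auto
    then show ?thesis using True h grid_norm_nonneg[OF h, of M r] by (simp add: y_def)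
  next
    case False
    then have "0 < y j" using y[of j] by simp
    then show ?thesis using * by (simp add: y_def)
  qed
qed

section \<open>The L1 kernels on a time mesh\<close>

text \<open>
  In this locale \<open>a n k\<close> is the L1 kernel \<open>A\<^sup>(\<^sup>n\<^sup>)\<^bsub>n-k\<^esub>\<close>, indexed by the time interval it belongs to, and
  \<open>P n j\<close> is the complementary weight that multiplies the equation at level \<open>j\<close>.
\<close>

locale L1_mesh =
  fixes \<alpha> T :: real and N :: nat and t :: "nat \<Rightarrow> real"
  assumes \<alpha>: "0 < \<alpha>" "\<alpha> < 1" and mesh: "time_mesh T N t"
begin

definition a :: "nat \<Rightarrow> nat \<Rightarrow> real" where
  "a n k = L1_kernel \<alpha> t n (n - k)"

lemma t0: "t 0 = 0" and tN: "t N = T" and t_less: "k \<in> {1..N} \<Longrightarrow> t (k - 1) < t k"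
  using mesh by (auto simp: time_mesh_def)

lemma t_Suc: "k < N \<Longrightarrow> t k < t (Suc k)"
  using t_less[of "Suc k"] by simp

lemma step_pos: "1 \<le> k \<Longrightarrow> k \<le> N \<Longrightarrow> 0 < step t k"
  using t_less[of k] by (simp add: step_def)

lemma t_mono:
  assumes "j \<le> k" "k \<le> N"
  shows "t j \<le> t k"
  using assms
proof (induction k rule: dec_induct)
  case (step k)
  then show ?case using t_Suc[of k] by simp
qed simp

lemma t_strict_mono:
  assumes "j < k" "k \<le> N"
  shows "t j < t k"
  using t_mono[of "Suc j" k] t_Suc[of j] assms by simp

lemma t_nonneg: "k \<le> N \<Longrightarrow> 0 \<le> t k"
  using t_mono[of 0 k] t0 by simp

lemma t_pred_nonneg: "k \<le> N \<Longrightarrow> 0 \<le> t (k - 1)"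
  by (rule t_nonneg) simp

lemma t_pos: "1 \<le> k \<Longrightarrow> k \<le> N \<Longrightarrow> 0 < t k"
  using t_strict_mono[of 0 k] t0 by simp

lemma t_le_T: "k \<le> N \<Longrightarrow> t k \<le> T"
  using t_mono[of k N] tN by simp

lemma kernel_integral:
  assumes "1 \<le> k" "k \<le> n" "n \<le> N"
  shows "(LINT s:{t (k - 1)<..<t k}|lborel. omega (1 - \<alpha>) (t n - s)) = (t k - t (k - 1)) * a n k"
  using assms step_pos[of k] by (simp add: a_def L1_kernel_def Let_def step_def)

lemma kernel_eq_omega:
  assumes "1 \<le> k" "k \<le> n" "n \<le> N"
  obtains \<xi> where "t (k - 1) < \<xi>" "\<xi> < t k" "a n k = omega (1 - \<alpha>) (t n - \<xi>)"
proof -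
  have lt: "t (k - 1) < t k" using t_less assms by auto
  obtain \<xi> where \<xi>: "t (k - 1) < \<xi>" "\<xi> < t k"
    "(LINT s:{t (k - 1)<..<t k}|lborel. omega (1 - \<alpha>) (t n - s)) = (t k - t (k - 1)) * omega (1 - \<alpha>) (t n - \<xi>)"
    using omega_mean_value[of "1 - \<alpha>" "t (k - 1)" "t k" "t n"] \<alpha> lt t_mono[of k n] assms by auto
  then have "a n k = omega (1 - \<alpha>) (t n - \<xi>)" using kernel_integral[OF assms] lt by simp
  with \<xi> show thesis using that by blast
qed

lemma kernel_pos: "1 \<le> k \<Longrightarrow> k \<le> n \<Longrightarrow> n \<le> N \<Longrightarrow> 0 < a n k"
  using kernel_eq_omega[of k n] t_mono[of k n] \<alpha> by (metis diff_gt_0_iff_gt omega_pos order_less_le_trans)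

lemma omega_le_kernel_Suc:
  assumes "k < n" "n \<le> N"
  shows "omega (1 - \<alpha>) (t n - t k) \<le> a n (Suc k)"
proof -
  obtain \<xi> where "t k < \<xi>" "\<xi> < t (Suc k)" "a n (Suc k) = omega (1 - \<alpha>) (t n - \<xi>)"
    using kernel_eq_omega[of "Suc k" n] assms by auto
  then show ?thesis using t_mono[of "Suc k" n] assms \<alpha> by (auto intro!: omega_antimono)
qed

lemma kernel_le_omega:
  assumes "1 \<le> k" "k < n" "n \<le> N"
  shows "a n k \<le> omega (1 - \<alpha>) (t n - t k)"
proof -
  obtain \<xi> where "t (k - 1) < \<xi>" "\<xi> < t k" "a n k = omega (1 - \<alpha>) (t n - \<xi>)"
    using kernel_eq_omega[of k n] assms by auto
  then show ?thesis using t_strict_mono[of k n] assms \<alpha> by (auto intro!: omega_antimono)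
qed

lemma kernel_mono: "1 \<le> k \<Longrightarrow> k < n \<Longrightarrow> n \<le> N \<Longrightarrow> a n k \<le> a n (Suc k)"
  using kernel_le_omega omega_le_kernel_Suc by (meson order_trans)

lemma kernel_eq_omega_increment:
  assumes "1 \<le> k" "k \<le> n" "n \<le> N"
  shows "a n k * step t k = omega (2 - \<alpha>) (t n - t (k - 1)) - omega (2 - \<alpha>) (t n - t k)"
  using kernel_integral[OF assms] omega_integral(2)[of "1 - \<alpha>" "t (k - 1)" "t k" "t n"]
    \<alpha> t_mono[of "k - 1" k] t_mono[of k n] assms by (simp add: step_def mult.commute)

lemma kernel_diag:
  assumes "1 \<le> n" "n \<le> N"
  shows "a n n = step t n powr (- \<alpha>) / Gamma (2 - \<alpha>)"
proof -
  have "a n n * step t n = step t n powr (1 - \<alpha>) / Gamma (2 - \<alpha>)"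
    using kernel_eq_omega_increment[of n n] assms by (simp add: omega_def step_def)
  moreover have "step t n powr (1 - \<alpha>) = step t n powr (- \<alpha>) * step t n"
    using step_pos[of n] assms powr_add[of "step t n" "- \<alpha>" 1] by simp
  ultimately have "a n n * step t n = step t n powr (- \<alpha>) / Gamma (2 - \<alpha>) * step t n"
    by simp
  then show ?thesis using step_pos[of n] assms by (simp del: times_divide_eq_left)
qed

lemma sum_kernel_steps:
  assumes "1 \<le> n" "n \<le> N"
  shows "(\<Sum>k=1..n. a n k * step t k) = omega (2 - \<alpha>) (t n)"
proof -
  have "(\<Sum>k=1..n. a n k * step t k) =
      (\<Sum>k=1..n. (- omega (2 - \<alpha>) (t n - t k)) - (- omega (2 - \<alpha>) (t n - t (k - 1))))"
    using assms by (intro sum.cong) (auto simp: kernel_eq_omega_increment)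
  also have "\<dots> = omega (2 - \<alpha>) (t n)"
    unfolding sum_increments[of "\<lambda>k. - omega (2 - \<alpha>) (t n - t k)"] using t0 by (simp add: omega_def)
  finally show ?thesis .
qed

definition P :: "nat \<Rightarrow> nat \<Rightarrow> real" where
  "P n = (SOME p. (\<forall>j. 1 \<le> j \<and> j \<le> n \<longrightarrow> 0 \<le> p j) \<and>
     (\<forall>k. 1 \<le> k \<and> k \<le> n \<longrightarrow> (\<Sum>j=k..n. p j * a j k) = 1))"

lemma
  assumes "n \<le> N"
  shows P_nonneg: "\<And>j. 1 \<le> j \<Longrightarrow> j \<le> n \<Longrightarrow> 0 \<le> P n j"
    and P_complementary: "\<And>k. 1 \<le> k \<Longrightarrow> k \<le> n \<Longrightarrow> (\<Sum>j=k..n. P n j * a j k) = 1"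
proof -
  let ?Q = "\<lambda>p. (\<forall>j. 1 \<le> j \<and> j \<le> n \<longrightarrow> 0 \<le> p j) \<and>
     (\<forall>k. 1 \<le> k \<and> k \<le> n \<longrightarrow> (\<Sum>j=k..n. p j * a j k) = 1)"
  obtain p where "\<And>j. 1 \<le> j \<Longrightarrow> j \<le> n \<Longrightarrow> 0 \<le> p j"
    "\<And>k. 1 \<le> k \<Longrightarrow> k \<le> n \<Longrightarrow> (\<Sum>j=k..n. p j * a j k) = 1"
  proof (rule complementary_weights_exist[of n a])
    show "0 < a j k" if "1 \<le> k" "k \<le> j" "j \<le> n" for j k
      using kernel_pos[of k j] that assms by simp
    show "a j k \<le> a j (Suc k)" if "1 \<le> k" "k < j" "j \<le> n" for j k
      using kernel_mono[of k j] that assms by simp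
    fix p assume "\<And>j. 1 \<le> j \<Longrightarrow> j \<le> n \<Longrightarrow> 0 \<le> p j"
      "\<And>k. 1 \<le> k \<Longrightarrow> k \<le> n \<Longrightarrow> (\<Sum>j=k..n. p j * a j k) = 1"
    then show thesis by (rule that)
  qed
  then have "?Q p" by blast
  then have "?Q (P n)" unfolding P_def by (rule someI[of ?Q])
  then show "\<And>j. 1 \<le> j \<Longrightarrow> j \<le> n \<Longrightarrow> 0 \<le> P n j"
    and "\<And>k. 1 \<le> k \<Longrightarrow> k \<le> n \<Longrightarrow> (\<Sum>j=k..n. P n j * a j k) = 1"
    by blast+
qed

lemma P_sum_increments:
  assumes "n \<le> N"
  shows "(\<Sum>j=1..n. P n j * (\<Sum>k=1..j. a j k * d k)) = (\<Sum>k=1..n. d k)"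
  using P_complementary[OF assms] by (rule complementary_sum_increments)

lemma P_times_diag_le_one:
  assumes "1 \<le> k" "k \<le> n" "n \<le> N"
  shows "P n k * a k k \<le> 1"
proof -
  have "P n k * a k k \<le> (\<Sum>j=k..n. P n j * a j k)"
    using assms P_nonneg[OF assms(3)] kernel_pos
    by (intro member_le_sum) (auto intro!: mult_nonneg_nonneg less_imp_le[OF kernel_pos])
  then show ?thesis using P_complementary assms by simp
qed

lemma caputo_omega_partition:
  assumes j: "1 \<le> j" "j \<le> N" and \<beta>: "0 < \<beta>"
  shows "omega (1 - \<alpha> + \<beta>) (t j) =
    (\<Sum>k=1..j. LINT s:{t (k - 1)<..<t k}|lborel. omega (1 - \<alpha>) (t j - s) * omega \<beta> s)"
    and "\<And>k. 1 \<le> k \<Longrightarrow> k \<le> j \<Longrightarrow>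
      set_integrable lborel {t (k - 1)<..<t k} (\<lambda>s. omega (1 - \<alpha>) (t j - s) * omega \<beta> s)"
proof -
  have int: "set_integrable lborel {0<..<t j} (\<lambda>s. omega (1 - \<alpha>) (t j - s) * omega \<beta> s)"
    and val: "(LINT s:{0<..<t j}|lborel. omega (1 - \<alpha>) (t j - s) * omega \<beta> s) = omega (1 - \<alpha> + \<beta>) (t j)"
    using omega_convolution[of "1 - \<alpha>" \<beta> "t j"] \<alpha> \<beta> t_pos[of j] j by auto
  show "omega (1 - \<alpha> + \<beta>) (t j) =
    (\<Sum>k=1..j. LINT s:{t (k - 1)<..<t k}|lborel. omega (1 - \<alpha>) (t j - s) * omega \<beta> s)"
    using set_integral_Ioo_partition[of t j "\<lambda>s. omega (1 - \<alpha>) (t j - s) * omega \<beta> s"]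
      int val t0 t_mono j by simp
  show "set_integrable lborel {t (k - 1)<..<t k} (\<lambda>s. omega (1 - \<alpha>) (t j - s) * omega \<beta> s)"
    if "1 \<le> k" "k \<le> j" for k
  proof (rule set_integrable_subset[OF int])
    have "0 \<le> t (k - 1)" "t k \<le> t j" using t_mono[of k j] t_pred_nonneg[of k] that j by auto
    then show "{t (k - 1)<..<t k} \<subseteq> {0<..<t j}" by auto
  qed simp
qed

lemma kernel_weight_integrable:
  assumes "1 \<le> k" "k \<le> j" "j \<le> N"
  shows "set_integrable lborel {t (k - 1)<..<t k} (\<lambda>s. omega (1 - \<alpha>) (t j - s))"
  using omega_integral(1)[of "1 - \<alpha>" "t (k - 1)" "t k" "t j"] \<alpha> assms t_mono[of k j] t_mono[of "k - 1" k]
  by auto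

text \<open>
  The left-hand side applies the weights to the exact Caputo derivatives of \<open>omega (1 + \<beta>)\<close>. For \<open>\<beta> \<le> 1\<close> the derivative
  \<open>omega \<beta>\<close> is nonincreasing while the weight increases, so by Chebyshev's inequality the L1 formula
  overestimates them, and \<open>P\<close> inverts the L1 formula.
\<close>

lemma P_sum_omega_le:
  assumes n: "n \<le> N" and \<beta>: "0 < \<beta>" "\<beta> \<le> 1"
  shows "(\<Sum>j=1..n. P n j * omega (1 - \<alpha> + \<beta>) (t j)) \<le> omega (1 + \<beta>) (t n)"
proof -
  define V where "V k = omega (1 + \<beta>) (t k)" for k
  have piece: "(LINT s:{t (k - 1)<..<t k}|lborel. omega (1 - \<alpha>) (t j - s) * omega \<beta> s) \<le> a j k * (V k - V (k - 1))"
    if k: "1 \<le> k" "k \<le> j" and j: "j \<le> N" for j k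
  proof -
    obtain \<xi> where \<xi>: "t (k - 1) < \<xi>" "\<xi> < t k" "a j k = omega (1 - \<alpha>) (t j - \<xi>)"
      using kernel_eq_omega[of k j] k j by auto
    have "(LINT s:{t (k - 1)<..<t k}|lborel. omega (1 - \<alpha>) (t j - s) * omega \<beta> s) \<le>
        omega (1 - \<alpha>) (t j - \<xi>) * (LINT s:{t (k - 1)<..<t k}|lborel. omega \<beta> s)"
    proof (rule set_integral_increasing_times_decreasing_le)
      show "set_integrable lborel {t (k - 1)<..<t k} (omega \<beta>)"
        using omega_integral_from_zero(1)[of \<beta> "t (k - 1)" "t k"] \<beta> t_pred_nonneg[of k] t_mono[of "k - 1" k] k j by auto
      show "omega (1 - \<alpha>) (t j - r) \<le> omega (1 - \<alpha>) (t j - s)" if "t (k - 1) < r" "r \<le> s" "s < t k" for r s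
        using that t_mono[of k j] k j \<alpha> by (intro omega_antimono) auto
      show "omega \<beta> s \<le> omega \<beta> r" if "t (k - 1) < r" "r \<le> s" "s < t k" for r s
        using that t_pred_nonneg[of k] k j \<beta> by (intro omega_antimono) (auto dest: order.trans)
    qed (use \<xi> kernel_integral[of k j] kernel_weight_integrable[of k j] caputo_omega_partition(2)[of j \<beta> k] k j \<beta> in auto)
    then show ?thesis
      using \<xi> omega_integral_from_zero(2)[of \<beta> "t (k - 1)" "t k"] \<beta> t_pred_nonneg[of k] t_mono[of "k - 1" k] k j
      by (simp add: V_def)
  qed
  have "(\<Sum>j=1..n. P n j * omega (1 - \<alpha> + \<beta>) (t j)) \<le> (\<Sum>j=1..n. P n j * (\<Sum>k=1..j. a j k * (V k - V (k - 1))))"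
    using n P_nonneg[OF n] piece caputo_omega_partition(1)[of _ \<beta>] \<beta>
    by (intro sum_mono mult_left_mono) (auto intro!: sum_mono)
  also have "\<dots> = V n - V 0"
    using P_sum_increments[OF n] sum_increments by simp
  also have "\<dots> = omega (1 + \<beta>) (t n)" by (simp add: V_def t0 omega_def)
  finally show ?thesis .
qed

text \<open>
  For \<open>\<beta> \<ge> 1\<close> the integrand is at most its value at the right end point \<open>t k\<close>, which in turn is at most the
  difference quotient over the next interval. The step ratio compares the two interval lengths, and
  the shift by one interval is why the sum stops before \<open>n\<close>.
\<close>

lemma P_sum_increasing_omega_le:
  assumes n: "1 \<le> n" "n \<le> N" and \<beta>: "1 \<le> \<beta>" and ratio: "step_ratio_bound \<rho> N t" "0 \<le> \<rho>"
  shows "(\<Sum>j=1..<n. P n j * omega (1 - \<alpha> + \<beta>) (t j)) \<le> \<rho> * omega (1 + \<beta>) (t n)"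
proof -
  define V where "V k = omega (1 + \<beta>) (t k)" for k
  \<comment> \<open>Increments shifted by one interval, cut off at \<open>n\<close> so that their sum is at most \<open>V n\<close>.\<close>
  define d where "d k = (if k < n then V (Suc k) - V k else 0)" for k
  have step_le: "step t k \<le> \<rho> * step t (Suc k)" if "1 \<le> k" "k < N" for k
  proof -
    have "step t k / step t (Suc k) \<le> \<rho>"
      using bspec[OF ratio(1)[unfolded step_ratio_bound_def], of k] that by simp
    then show ?thesis using step_pos[of "Suc k"] that by (simp add: field_simps)
  qed
  have d_ge: "omega \<beta> (t k) * step t (Suc k) \<le> d k" if "1 \<le> k" "k < n" for k
  proof -
    have "omega \<beta> (t k) * step t (Suc k) = (LINT s:{t k<..<t (Suc k)}|lborel. omega \<beta> (t k))"
      using t_mono[of k "Suc k"] that n by (simp add: set_integral_const_Ioo step_def)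
    also have "\<dots> \<le> (LINT s:{t k<..<t (Suc k)}|lborel. omega \<beta> s)"
      using that n t_mono[of k "Suc k"] t_nonneg[of k] t_pos[of k] \<beta>
      by (intro set_integral_mono set_integrable_const_Ioo omega_integral_from_zero(1) omega_mono) auto
    also have "\<dots> = d k"
      using that n t_mono[of k "Suc k"] t_nonneg[of k] \<beta>
      by (simp add: d_def V_def omega_integral_from_zero(2))
    finally show ?thesis .
  qed
  have \<rho>_d: "step t k * omega \<beta> (t k) \<le> \<rho> * d k" if "1 \<le> k" "k < n" for k
  proof -
    have "step t k * omega \<beta> (t k) \<le> \<rho> * step t (Suc k) * omega \<beta> (t k)"
      using step_le[of k] that n \<beta> by (intro mult_right_mono omega_nonneg) auto
    also have "\<dots> \<le> \<rho> * d k" using d_ge[OF that] mult_left_mono[OF d_ge[OF that] ratio(2)] by (simp add: mult_ac)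
    finally show ?thesis .
  qed
  have d_nonneg: "0 \<le> \<rho> * d k" if "1 \<le> k" for k
    using \<rho>_d[of k] step_pos[of k] omega_nonneg[of \<beta> "t k"] that n \<beta>
    by (cases "k < n") (auto simp: d_def intro: order_trans[rotated])
  have piece: "(LINT s:{t (k - 1)<..<t k}|lborel. omega (1 - \<alpha>) (t j - s) * omega \<beta> s) \<le> a j k * (\<rho> * d k)"
    if k: "1 \<le> k" "k \<le> j" and j: "j < n" for j k
  proof -
    have "(LINT s:{t (k - 1)<..<t k}|lborel. omega (1 - \<alpha>) (t j - s) * omega \<beta> s) \<le>
        (LINT s:{t (k - 1)<..<t k}|lborel. omega (1 - \<alpha>) (t j - s) * omega \<beta> (t k))"
    proof (rule set_integral_mono)
      show "omega (1 - \<alpha>) (t j - s) * omega \<beta> s \<le> omega (1 - \<alpha>) (t j - s) * omega \<beta> (t k)"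
        if "s \<in> {t (k - 1)<..<t k}" for s
        using that \<alpha> \<beta> k j n t_pred_nonneg[of k] by (intro mult_left_mono omega_mono omega_nonneg) auto
    qed (use caputo_omega_partition(2)[of j \<beta> k] kernel_weight_integrable[of k j] k j n \<beta> in auto)
    also have "\<dots> = a j k * (step t k * omega \<beta> (t k))"
      using kernel_integral[of k j] k j n by (simp add: step_def)
    also have "\<dots> \<le> a j k * (\<rho> * d k)"
      using \<rho>_d[of k] kernel_pos[of k j] k j n by (intro mult_left_mono) auto
    finally show ?thesis .
  qed
  have "(\<Sum>j=1..<n. P n j * omega (1 - \<alpha> + \<beta>) (t j)) \<le> (\<Sum>j=1..<n. P n j * (\<Sum>k=1..j. a j k * (\<rho> * d k)))"
    using n P_nonneg[OF n(2)] piece caputo_omega_partition(1)[of _ \<beta>] \<beta>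
    by (intro sum_mono mult_left_mono) (auto intro!: sum_mono)
  also have "\<dots> \<le> (\<Sum>j=1..n. P n j * (\<Sum>k=1..j. a j k * (\<rho> * d k)))"
    using n
    by (intro sum_mono2 mult_nonneg_nonneg sum_nonneg d_nonneg P_nonneg less_imp_le[OF kernel_pos]) auto
  also have "\<dots> = \<rho> * (\<Sum>k=1..n. d k)"
    using P_sum_increments[OF n(2), of "\<lambda>k. \<rho> * d k"] by (simp add: sum_distrib_left)
  also have "(\<Sum>k=1..n. d k) = (\<Sum>k=1..<n. V (Suc k) - V k)"
    using n by (intro sum.mono_neutral_cong_right) (auto simp: d_def)
  also have "\<dots> = V n - V 1"
    using n by (simp add: sum_Suc_diff')
  also have "\<rho> * (V n - V 1) \<le> \<rho> * V n"
    using ratio(2) \<beta> by (simp add: V_def mult_left_mono omega_nonneg)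
  finally show ?thesis by (simp add: V_def)
qed

end

section \<open>The Mittag-Leffler function and a discrete fractional Gronwall inequality\<close>

text \<open>
  Logarithmic convexity of Gamma, applied to \<open>x + 1 = \<alpha> (x + \<alpha>) + (1 - \<alpha>) (x + \<alpha> + 1)\<close>.
\<close>

lemma Gamma_add_ge:
  fixes x \<alpha> :: real
  assumes x: "0 < x" and \<alpha>: "0 < \<alpha>" "\<alpha> < 1"
  shows "x * Gamma x \<le> (x + \<alpha>) powr (1 - \<alpha>) * Gamma (x + \<alpha>)"
proof -
  have pos: "0 < Gamma (x + \<alpha>)" "0 < Gamma (x + \<alpha> + 1)" "0 < Gamma (x + 1)"
    using x \<alpha> by (auto intro: Gamma_real_pos)
  have ne: "Gamma (x + \<alpha>) \<noteq> 0" using pos(1) by (metis less_irrefl)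
  have "(ln \<circ> Gamma) ((1 - (1 - \<alpha>)) *\<^sub>R (x + \<alpha>) + (1 - \<alpha>) *\<^sub>R (x + \<alpha> + 1)) \<le>
      (1 - (1 - \<alpha>)) * (ln \<circ> Gamma) (x + \<alpha>) + (1 - \<alpha>) * (ln \<circ> Gamma) (x + \<alpha> + 1)"
    using x \<alpha> by (intro convex_onD[OF log_convex_Gamma_real]) auto
  moreover have "(1 - (1 - \<alpha>)) *\<^sub>R (x + \<alpha>) + (1 - \<alpha>) *\<^sub>R (x + \<alpha> + 1) = x + 1"
    by (simp add: algebra_simps)
  moreover have "Gamma (x + \<alpha> + 1) = (x + \<alpha>) * Gamma (x + \<alpha>)"
    using x \<alpha> by (intro Gamma_plus1) (auto elim!: nonpos_Ints_cases)
  then have "ln (Gamma (x + \<alpha> + 1)) = ln (x + \<alpha>) + ln (Gamma (x + \<alpha>))"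
    using ne x \<alpha> ln_mult[of "x + \<alpha>" "Gamma (x + \<alpha>)"] by simp
  ultimately have "ln (Gamma (x + 1)) \<le> ln (Gamma (x + \<alpha>)) + (1 - \<alpha>) * ln (x + \<alpha>)"
    by (simp add: algebra_simps)
  also have "\<dots> = ln ((x + \<alpha>) powr (1 - \<alpha>) * Gamma (x + \<alpha>))"
    using ne x \<alpha> by (simp add: ln_mult)
  finally have "Gamma (x + 1) \<le> (x + \<alpha>) powr (1 - \<alpha>) * Gamma (x + \<alpha>)"
    using pos x \<alpha> by (simp add: ln_le_cancel_iff)
  moreover have "Gamma (x + 1) = x * Gamma x"
    using x by (intro Gamma_plus1) (auto elim!: nonpos_Ints_cases)
  ultimately show ?thesis by simp
qed

lemma half_le_Gamma_one_plus:
  fixes \<alpha> :: real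
  assumes \<alpha>: "0 < \<alpha>" "\<alpha> < 1"
  shows "1 / 2 \<le> Gamma (1 + \<alpha>)"
proof -
  have "1 \<le> (1 + \<alpha>) powr (1 - \<alpha>) * Gamma (1 + \<alpha>)"
    using Gamma_add_ge[of 1 \<alpha>] \<alpha> by simp
  also have "(1 + \<alpha>) powr (1 - \<alpha>) \<le> (1 + \<alpha>) powr 1"
    using \<alpha> by (intro powr_mono) auto
  then have "(1 + \<alpha>) powr (1 - \<alpha>) * Gamma (1 + \<alpha>) \<le> 2 * Gamma (1 + \<alpha>)"
    using \<alpha> Gamma_real_pos[of "1 + \<alpha>"] by (intro mult_right_mono) auto
  finally show ?thesis by simp
qed

lemma mittag_leffler_summable:
  assumes \<alpha>: "0 < \<alpha>" "\<alpha> < 1"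
  shows "summable (\<lambda>j. z ^ j / Gamma (real j * \<alpha> + 1))"
proof -
  have "filterlim (\<lambda>j. 1 + real j * \<alpha>) at_top sequentially"
    using \<alpha> by (intro filterlim_tendsto_add_at_top[OF tendsto_const]
        filterlim_at_top_mult_tendsto_pos[OF tendsto_const _ filterlim_real_sequentially])
  then have lim: "filterlim (\<lambda>j. real j * \<alpha> + 1) at_top sequentially"
    by (simp add: add.commute)
  have "((\<lambda>j. 2 * (real j * \<alpha> + 1) powr (- \<alpha>)) \<longlongrightarrow> 2 * 0) sequentially"
    using \<alpha> lim by (intro tendsto_mult tendsto_const tendsto_neg_powr) auto
  then have "((\<lambda>j. \<bar>z\<bar> * (2 * (real j * \<alpha> + 1) powr (- \<alpha>))) \<longlongrightarrow> \<bar>z\<bar> * (2 * 0)) sequentially"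
    by (rule tendsto_mult_left)
  then have "\<forall>\<^sub>F j in sequentially. \<bar>z\<bar> * (2 * (real j * \<alpha> + 1) powr (- \<alpha>)) < 1 / 2"
    by (rule order_tendstoD) simp
  then obtain n where n: "\<And>j. n \<le> j \<Longrightarrow> \<bar>z\<bar> * (2 * (real j * \<alpha> + 1) powr (- \<alpha>)) < 1 / 2"
    by (auto simp: eventually_sequentially)
  show ?thesis
  proof (rule summable_ratio_test)
    fix j assume "n \<le> j"
    define x where "x = real j * \<alpha> + 1"
    have x: "1 \<le> x" using \<alpha> by (simp add: x_def)
    have G: "0 < Gamma x" "0 < Gamma (x + \<alpha>)" using x \<alpha> by (auto intro: Gamma_real_pos)
    have "x * Gamma x \<le> (x + \<alpha>) powr (1 - \<alpha>) * Gamma (x + \<alpha>)"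
      using Gamma_add_ge x \<alpha> by simp
    also have "\<dots> \<le> (2 * x powr (1 - \<alpha>)) * Gamma (x + \<alpha>)"
    proof (intro mult_right_mono)
      have "(x + \<alpha>) powr (1 - \<alpha>) \<le> (2 * x) powr (1 - \<alpha>)"
        using x \<alpha> by (intro powr_mono2) auto
      also have "\<dots> = 2 powr (1 - \<alpha>) * x powr (1 - \<alpha>)" using x by (simp add: powr_mult)
      also have "2 powr (1 - \<alpha>) \<le> (2::real) powr 1" using \<alpha> by (intro powr_mono) auto
      then have "2 powr (1 - \<alpha>) * x powr (1 - \<alpha>) \<le> 2 * x powr (1 - \<alpha>)" by (intro mult_right_mono) auto
      finally show "(x + \<alpha>) powr (1 - \<alpha>) \<le> 2 * x powr (1 - \<alpha>)" .
    qed (use G in simp)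
    also have "x powr (1 - \<alpha>) = x * x powr (- \<alpha>)"
      using x powr_add[of x 1 "- \<alpha>"] by simp
    finally have "x * Gamma x \<le> x * (2 * x powr (- \<alpha>) * Gamma (x + \<alpha>))" by (simp add: mult_ac)
    then have Gx: "Gamma x \<le> 2 * x powr (- \<alpha>) * Gamma (x + \<alpha>)" using x by simp
    have "\<bar>z\<bar> * Gamma x \<le> \<bar>z\<bar> * (2 * x powr (- \<alpha>) * Gamma (x + \<alpha>))"
      using Gx by (intro mult_left_mono) auto
    also have "\<dots> \<le> 1 / 2 * Gamma (x + \<alpha>)"
      using n[OF \<open>n \<le> j\<close>] G unfolding x_def[symmetric] mult.assoc[symmetric]
      by (intro mult_right_mono) auto
    finally have le: "\<bar>z\<bar> * Gamma x \<le> 1 / 2 * Gamma (x + \<alpha>)" .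
    have "norm (z ^ Suc j / Gamma (real (Suc j) * \<alpha> + 1)) = \<bar>z\<bar> ^ j * (\<bar>z\<bar> / Gamma (x + \<alpha>))"
      using G by (simp add: x_def abs_mult power_abs algebra_simps)
    also have "\<dots> \<le> \<bar>z\<bar> ^ j * (1 / 2 / Gamma x)"
      using le G by (intro mult_left_mono) (auto simp: field_simps)
    also have "\<dots> = 1 / 2 * norm (z ^ j / Gamma (real j * \<alpha> + 1))"
      using G by (simp add: x_def power_abs)
    finally show "norm (z ^ Suc j / Gamma (real (Suc j) * \<alpha> + 1)) \<le> 1 / 2 * norm (z ^ j / Gamma (real j * \<alpha> + 1))" .
  qed simp
qed

lemma mittag_leffler_eq_omega_series:
  assumes "0 < \<alpha>" "\<alpha> < 1" "0 < x"
  shows "(\<lambda>m. \<mu> ^ m * omega (1 + real m * \<alpha>) x) sums mittag_leffler \<alpha> (\<mu> * x powr \<alpha>)"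
proof -
  have "(\<mu> * x powr \<alpha>) ^ m / Gamma (real m * \<alpha> + 1) = \<mu> ^ m * omega (1 + real m * \<alpha>) x" for m
    using assms by (simp add: omega_def power_mult_distrib powr_power add.commute mult.commute)
  then show ?thesis
    using summable_sums[OF mittag_leffler_summable[OF assms(1,2), of "\<mu> * x powr \<alpha>"]]
    unfolding mittag_leffler_def by simp
qed

lemma mittag_leffler_mono:
  assumes "0 < \<alpha>" "\<alpha> < 1" "0 \<le> x" "x \<le> y"
  shows "mittag_leffler \<alpha> x \<le> mittag_leffler \<alpha> y"
  unfolding mittag_leffler_def using assms
  by (intro suminf_le mittag_leffler_summable divide_right_mono power_mono less_imp_le[OF Gamma_real_pos])
    (auto intro: add_nonneg_pos)

lemma mittag_leffler_ge_one:
  assumes "0 < \<alpha>" "\<alpha> < 1" "0 \<le> x"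
  shows "1 \<le> mittag_leffler \<alpha> x"
proof -
  have "(\<Sum>j<1. x ^ j / Gamma (real j * \<alpha> + 1)) \<le> mittag_leffler \<alpha> x"
    unfolding mittag_leffler_def using assms
    by (intro sum_le_suminf mittag_leffler_summable)
      (auto intro!: divide_nonneg_nonneg less_imp_le[OF Gamma_real_pos] add_nonneg_pos)
  then show ?thesis by simp
qed

context L1_mesh
begin

lemma P_sum_omega_series_le:
  assumes n: "1 \<le> n" "n \<le> N" and ratio: "step_ratio_bound \<rho> N t" "0 \<le> \<rho>"
  shows "(\<Sum>j=1..<n. P n j * omega (1 + real m * \<alpha>) (t j)) \<le> max 1 \<rho> * omega (1 + real (Suc m) * \<alpha>) (t n)"
proof -
  define \<beta> where "\<beta> = real (Suc m) * \<alpha>"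
  have \<beta>: "0 < \<beta>" "1 + real m * \<alpha> = 1 - \<alpha> + \<beta>" "1 + real (Suc m) * \<alpha> = 1 + \<beta>"
  proof -
    have "0 \<le> real m * \<alpha>" using \<alpha> by simp
    then show "0 < \<beta>" using \<alpha>(1) unfolding \<beta>_def of_nat_Suc distrib_right mult_1 by (intro add_pos_nonneg)
  qed (simp_all add: \<beta>_def distrib_right)
  have om: "0 \<le> omega (1 + \<beta>) (t n)" using \<beta>(1) by (intro omega_nonneg) auto
  have "(\<Sum>j=1..<n. P n j * omega (1 - \<alpha> + \<beta>) (t j)) \<le> max 1 \<rho> * omega (1 + \<beta>) (t n)"
  proof (cases "\<beta> \<le> 1")
    case True
    have "(\<Sum>j=1..<n. P n j * omega (1 - \<alpha> + \<beta>) (t j)) \<le> (\<Sum>j=1..n. P n j * omega (1 - \<alpha> + \<beta>) (t j))"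
      using n \<alpha> \<beta>(1) by (intro sum_mono2 mult_nonneg_nonneg P_nonneg omega_nonneg) auto
    also have "\<dots> \<le> 1 * omega (1 + \<beta>) (t n)"
      using P_sum_omega_le[OF n(2) \<beta>(1) True] by simp
    also have "\<dots> \<le> max 1 \<rho> * omega (1 + \<beta>) (t n)"
      using om by (intro mult_right_mono) auto
    finally show ?thesis .
  next
    case False
    then have "(\<Sum>j=1..<n. P n j * omega (1 - \<alpha> + \<beta>) (t j)) \<le> \<rho> * omega (1 + \<beta>) (t n)"
      using P_sum_increasing_omega_le[OF n _ ratio] by simp
    also have "\<dots> \<le> max 1 \<rho> * omega (1 + \<beta>) (t n)"
      using om by (intro mult_right_mono) auto
    finally show ?thesis .
  qed
  then show ?thesis unfolding \<beta>(2,3) .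
qed

text \<open>
  Term by term in the series: the weighted sum of the \<open>m\<close>-th terms is bounded by the \<open>(m + 1)\<close>-st
  term at \<open>t n\<close>, up to the factor absorbed by \<open>\<mu>\<close>. The missing zeroth term is the \<open>1\<close> on the right.
\<close>

lemma P_sum_mittag_leffler_le:
  assumes n: "1 \<le> n" "n \<le> N" and ratio: "step_ratio_bound \<rho> N t" "0 \<le> \<rho>" and \<nu>: "0 \<le> \<nu>"
  defines "\<mu> \<equiv> 2 * max 1 \<rho> * \<nu>"
  shows "2 * \<nu> * (\<Sum>j=1..<n. P n j * mittag_leffler \<alpha> (\<mu> * t j powr \<alpha>)) \<le> mittag_leffler \<alpha> (\<mu> * t n powr \<alpha>) - 1"
proof -
  have \<mu>: "0 \<le> \<mu>" using \<nu> by (simp add: \<mu>_def)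
  have "(\<lambda>m. 2 * \<nu> * (\<Sum>j=1..<n. P n j * (\<mu> ^ m * omega (1 + real m * \<alpha>) (t j))))
      sums (2 * \<nu> * (\<Sum>j=1..<n. P n j * mittag_leffler \<alpha> (\<mu> * t j powr \<alpha>)))"
    using n \<alpha> t_pos by (intro sums_mult sums_sum mittag_leffler_eq_omega_series) auto
  moreover have "(\<lambda>m. \<mu> ^ Suc m * omega (1 + real (Suc m) * \<alpha>) (t n)) sums
      (mittag_leffler \<alpha> (\<mu> * t n powr \<alpha>) - \<mu> ^ 0 * omega (1 + real 0 * \<alpha>) (t n))"
    using mittag_leffler_eq_omega_series[OF \<alpha> t_pos[OF n]] by (subst sums_Suc_iff) simp
  moreover have "\<mu> ^ 0 * omega (1 + real 0 * \<alpha>) (t n) = 1"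
    using t_pos[OF n] by (simp add: omega_def)
  ultimately show ?thesis
  proof (simp only:, elim sums_le[rotated])
    fix m
    have "2 * \<nu> * (\<Sum>j=1..<n. P n j * (\<mu> ^ m * omega (1 + real m * \<alpha>) (t j))) =
        2 * \<nu> * \<mu> ^ m * (\<Sum>j=1..<n. P n j * omega (1 + real m * \<alpha>) (t j))"
      by (simp add: sum_distrib_left mult_ac)
    also have "\<dots> \<le> 2 * \<nu> * \<mu> ^ m * (max 1 \<rho> * omega (1 + real (Suc m) * \<alpha>) (t n))"
      using P_sum_omega_series_le[OF n ratio] \<nu> \<mu> by (intro mult_left_mono) auto
    also have "\<dots> = \<mu> ^ Suc m * omega (1 + real (Suc m) * \<alpha>) (t n)"
      by (simp add: \<mu>_def)
    finally show "2 * \<nu> * (\<Sum>j=1..<n. P n j * (\<mu> ^ m * omega (1 + real m * \<alpha>) (t j))) \<le>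
        \<mu> ^ Suc m * omega (1 + real (Suc m) * \<alpha>) (t n)" .
  qed
qed

text \<open>
  The smallness condition allows absorbing the term \<open>\<nu> * P n n * y n\<close> into the left-hand side at the cost
  of a factor \<open>2\<close>; strong induction then reproduces the supersolution property of the Mittag-Leffler
  function.
\<close>

lemma discrete_fractional_gronwall:
  fixes y g F :: "nat \<Rightarrow> real"
  assumes ratio: "step_ratio_bound \<rho> N t" "0 \<le> \<rho>" and \<nu>: "0 \<le> \<nu>"
    and small: "\<And>n. 1 \<le> n \<Longrightarrow> n \<le> N \<Longrightarrow> 2 * \<nu> \<le> a n n"
    and y: "\<And>n. 1 \<le> n \<Longrightarrow> n \<le> N \<Longrightarrow> 0 \<le> y n"
    and F: "\<And>m n. 1 \<le> m \<Longrightarrow> m \<le> n \<Longrightarrow> n \<le> N \<Longrightarrow> F m \<le> F n" "\<And>n. 1 \<le> n \<Longrightarrow> n \<le> N \<Longrightarrow> 0 \<le> F n"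
    and ineq: "\<And>n. 1 \<le> n \<Longrightarrow> n \<le> N \<Longrightarrow> (\<Sum>k=1..n. a n k * (y k - y (k - 1))) \<le> \<nu> * y n + g n"
    and g: "\<And>n. 1 \<le> n \<Longrightarrow> n \<le> N \<Longrightarrow> y 0 + (\<Sum>j=1..n. P n j * g j) \<le> F n"
    and n: "1 \<le> n" "n \<le> N"
  shows "y n \<le> 2 * F n * mittag_leffler \<alpha> (2 * max 1 \<rho> * \<nu> * t n powr \<alpha>)"
  using n
proof (induction n rule: less_induct)
  case (less n)
  define E where "E j = mittag_leffler \<alpha> (2 * max 1 \<rho> * \<nu> * t j powr \<alpha>)" for j
  have P_nn: "\<nu> * P n n \<le> 1 / 2"
  proof -
    have "2 * \<nu> * P n n \<le> a n n * P n n"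
      using small[of n] P_nonneg[of n n] less.prems by (intro mult_right_mono) auto
    also have "\<dots> \<le> 1" using P_times_diag_le_one[of n n] less.prems by (simp add: mult.commute)
    finally show ?thesis by simp
  qed
  have E: "0 \<le> E j" for j
    using mittag_leffler_ge_one[OF \<alpha>, of "2 * max 1 \<rho> * \<nu> * t j powr \<alpha>"] \<nu> by (simp add: E_def)
  have "y n - y 0 = (\<Sum>j=1..n. P n j * (\<Sum>k=1..j. a j k * (y k - y (k - 1))))"
    using P_sum_increments[of n "\<lambda>k. y k - y (k - 1)"] sum_increments[of y n] less.prems by simp
  also have "\<dots> \<le> (\<Sum>j=1..n. P n j * (\<nu> * y j + g j))"
    using ineq P_nonneg less.prems by (intro sum_mono mult_left_mono) auto
  also have "\<dots> = \<nu> * (\<Sum>j=1..n. P n j * y j) + (\<Sum>j=1..n. P n j * g j)"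
    by (simp add: sum_distrib_left distrib_left sum.distrib mult_ac)
  also have "(\<Sum>j=1..n. P n j * y j) = (\<Sum>j=1..<n. P n j * y j) + P n n * y n"
    using less.prems by (simp add: sum.last_plus add.commute)
  finally have "y n \<le> F n + \<nu> * (\<Sum>j=1..<n. P n j * y j) + \<nu> * P n n * y n"
    using g[of n] less.prems by (simp add: algebra_simps)
  also have "\<nu> * P n n * y n \<le> 1 / 2 * y n"
    using P_nn y less.prems by (intro mult_right_mono) auto
  finally have "y n \<le> 2 * (F n + \<nu> * (\<Sum>j=1..<n. P n j * y j))" by simp
  also have "(\<Sum>j=1..<n. P n j * y j) \<le> (\<Sum>j=1..<n. P n j * (2 * F n * E j))"
  proof (intro sum_mono mult_left_mono)
    fix j assume j: "j \<in> {1..<n}"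
    have "y j \<le> 2 * F j * E j" using less.IH[of j] less.prems j by (simp add: E_def)
    also have "\<dots> \<le> 2 * F n * E j" using F(1)[of j n] E j less.prems by (intro mult_right_mono) auto
    finally show "y j \<le> 2 * F n * E j" .
  qed (use P_nonneg less.prems in auto)
  then have "2 * (F n + \<nu> * (\<Sum>j=1..<n. P n j * y j)) \<le> 2 * (F n + \<nu> * (\<Sum>j=1..<n. P n j * (2 * F n * E j)))"
    using \<nu> by (intro mult_left_mono add_left_mono) auto
  also have "\<dots> = 2 * F n * (1 + 2 * \<nu> * (\<Sum>j=1..<n. P n j * E j))"
    by (simp add: algebra_simps sum_distrib_left)
  also have "\<dots> \<le> 2 * F n * E n"
    using P_sum_mittag_leffler_le[OF less.prems ratio \<nu>] F(2)[OF less.prems]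
    by (intro mult_left_mono) (auto simp: E_def)
  finally show ?case by (simp add: E_def)
qed

end

section \<open>Consistency in time\<close>

text \<open>
  The regularity in time at one spatial point. The first derivative is a parameter because it is
  integrated against the kernels below; the second one only bounds its oscillation.
\<close>

definition time_regular :: "real \<Rightarrow> real \<Rightarrow> real \<Rightarrow> (real \<Rightarrow> real) \<Rightarrow> (real \<Rightarrow> real) \<Rightarrow> bool" where
  "time_regular T \<sigma> K v v1 \<longleftrightarrow> continuous_on {0..T} v \<and> (\<exists>v2. \<forall>t\<in>{0<..T}.
      (v has_real_derivative v1 t) (at t within {0<..T}) \<and>
      (v1 has_real_derivative v2 t) (at t within {0<..T}) \<and>
      \<bar>v1 t\<bar> \<le> K * (1 + t powr (\<sigma> - 1)) \<and>
      \<bar>v2 t\<bar> \<le> K * (1 + t powr (\<sigma> - 2)))"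

text \<open>
  One constant for all oscillation bounds: the powers of \<open>T\<close> absorb the constant part of the regularity
  bounds into the singular part, and \<open>1 / \<bar>\<sigma> - 1\<bar>\<close> comes from integrating \<open>s\<^bsup>\<sigma>-2\<^esup>\<close>.
\<close>

definition variation_const :: "real \<Rightarrow> real \<Rightarrow> real \<Rightarrow> real" where
  "variation_const T \<sigma> K = 2 * K * (1 + T powr (2 - \<sigma>) + T powr \<bar>1 - \<sigma>\<bar> + 1 / \<bar>\<sigma> - 1\<bar>)"

lemma one_le_powr_times_powr_neg:
  fixes s T p :: real
  assumes "0 < s" "s \<le> T" "0 \<le> p"
  shows "1 \<le> T powr p * s powr (- p)"
proof -
  have "s powr p * s powr (- p) \<le> T powr p * s powr (- p)"
    using assms by (intro mult_right_mono powr_mono2) auto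
  then show ?thesis using assms by (simp flip: powr_add)
qed

lemma at_within_Ioc:
  fixes x T :: real
  assumes "0 < x" "x < T"
  shows "at x within {0<..T} = at x"
  using assms by (intro at_within_open_subset[of x "{0<..<T}"]) auto

lemma time_regular_oscillation_away_from_zero:
  assumes reg: "time_regular T \<sigma> K v v1" and K: "0 \<le> K" and \<sigma>: "\<sigma> < 2"
    and ac: "0 < a" "a < c" "c \<le> T" and s: "a < s" "s < c"
  shows "\<bar>v1 s - v1 c\<bar> \<le> variation_const T \<sigma> K * a powr (\<sigma> - 2) * (c - a)"
proof -
  obtain v2 where v2: "\<And>x. x \<in> {0<..T} \<Longrightarrow> (v1 has_real_derivative v2 x) (at x within {0<..T})"
    "\<And>x. x \<in> {0<..T} \<Longrightarrow> \<bar>v2 x\<bar> \<le> K * (1 + x powr (\<sigma> - 2))"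
    using reg unfolding time_regular_def by blast
  define B where "B = variation_const T \<sigma> K * a powr (\<sigma> - 2)"
  have "0 \<le> B" using K by (simp add: B_def variation_const_def)
  have bound: "\<bar>v2 x\<bar> \<le> B" if "x \<in> {a..c}" for x
  proof -
    have "\<bar>v2 x\<bar> \<le> K * (1 + x powr (\<sigma> - 2))" using v2(2)[of x] that ac by auto
    also have "\<dots> \<le> K * (T powr (2 - \<sigma>) * a powr (\<sigma> - 2) + a powr (\<sigma> - 2))"
      using one_le_powr_times_powr_neg[of a T "2 - \<sigma>"] that ac \<sigma> K powr_mono2'[of "\<sigma> - 2" a x]
      by (intro mult_left_mono add_mono) auto
    also have "\<dots> = K * (1 + T powr (2 - \<sigma>)) * a powr (\<sigma> - 2)"
      by (simp add: algebra_simps)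
    also have "\<dots> \<le> B"
      unfolding B_def variation_const_def using K by (intro mult_right_mono) (auto simp: algebra_simps)
    finally show ?thesis .
  qed
  have "norm (v1 s - v1 c) \<le> B * norm (s - c)"
  proof (rule field_differentiable_bound[of "{a..c}" v1 v2])
    show "(v1 has_field_derivative v2 x) (at x within {a..c})" if "x \<in> {a..c}" for x
      using v2(1)[of x] that ac by (auto intro: DERIV_subset)
  qed (use bound s in auto)
  also have "\<dots> \<le> B * (c - a)" using s \<open>0 \<le> B\<close> by (intro mult_left_mono) auto
  finally show ?thesis by (simp add: B_def)
qed

text \<open>
  On the first interval the second derivative may fail to be integrable. For \<open>\<sigma> < 1\<close> the first derivative
  is bounded by a multiple of \<open>omega \<sigma>\<close> and no constant is subtracted. For \<open>\<sigma> > 1\<close> the derivative is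
  bounded but not small, so its value at \<open>c\<close> is subtracted and the remainder is of order \<open>c\<^bsup>\<sigma>-1\<^esup>\<close>. Both
  majorants are nonincreasing multiples of \<open>omega \<beta>\<close>, with \<open>\<beta> = \<sigma>\<close> and \<open>\<beta> = 1\<close>.
\<close>

lemma time_regular_oscillation_near_zero:
  assumes reg: "time_regular T \<sigma> K v v1" and K: "0 \<le> K" and \<sigma>: "\<sigma> \<in> {0<..<1} \<union> {1<..<2}"
    and c: "0 < c" "c \<le> T"
  obtains d D \<beta> where "0 < \<beta>" "\<beta> \<le> 1" "0 \<le> D"
    "\<forall>s. 0 < s \<and> s < c \<longrightarrow> \<bar>v1 s - d\<bar> \<le> D * omega \<beta> s"
    "D * omega (1 + \<beta>) c \<le> variation_const T \<sigma> K * c powr \<sigma> / \<sigma>"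
proof -
  obtain v2 where v2: "\<And>x. x \<in> {0<..T} \<Longrightarrow> (v1 has_real_derivative v2 x) (at x within {0<..T})"
    "\<And>x. x \<in> {0<..T} \<Longrightarrow> \<bar>v2 x\<bar> \<le> K * (1 + x powr (\<sigma> - 2))"
    and v1: "\<And>x. x \<in> {0<..T} \<Longrightarrow> \<bar>v1 x\<bar> \<le> K * (1 + x powr (\<sigma> - 1))"
    using reg unfolding time_regular_def by blast
  show thesis
  proof (cases "\<sigma> < 1")
    case True
    \<comment> \<open>The factor \<open>Gamma \<sigma>\<close> cancels the normalisation of \<open>omega \<sigma>\<close>.\<close>
    define D where "D = K * (1 + T powr (1 - \<sigma>)) * Gamma \<sigma>"
    have G: "0 < Gamma \<sigma>" using \<sigma> by (auto intro: Gamma_real_pos)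
    show thesis
    proof (rule that[where \<beta> = \<sigma> and D = D and d = 0])
      show "0 \<le> D" using K G by (simp add: D_def)
      show "\<forall>s. 0 < s \<and> s < c \<longrightarrow> \<bar>v1 s - 0\<bar> \<le> D * omega \<sigma> s"
      proof (intro allI impI, elim conjE)
        fix s assume that: "0 < s" "s < c"
        have "\<bar>v1 s\<bar> \<le> K * (1 + s powr (\<sigma> - 1))" using v1[of s] that c by auto
        also have "\<dots> \<le> K * (T powr (1 - \<sigma>) * s powr (\<sigma> - 1) + s powr (\<sigma> - 1))"
          using one_le_powr_times_powr_neg[of s T "1 - \<sigma>"] that c True K
          by (intro mult_left_mono add_mono) auto
        also have "\<dots> = D * omega \<sigma> s"
          using G by (simp add: D_def omega_def algebra_simps)
        finally show "\<bar>v1 s - 0\<bar> \<le> D * omega \<sigma> s" by simp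
      qed
      have "Gamma (1 + \<sigma>) = \<sigma> * Gamma \<sigma>"
        using \<sigma> Gamma_plus1[of \<sigma>] by (force simp: add.commute elim!: nonpos_Ints_cases)
      then have "D * omega (1 + \<sigma>) c = K * (1 + T powr (1 - \<sigma>)) * c powr \<sigma> / \<sigma>"
        using G by (simp add: D_def omega_def)
      also have "\<dots> \<le> variation_const T \<sigma> K * c powr \<sigma> / \<sigma>"
        using \<sigma> K True unfolding variation_const_def
        by (intro divide_right_mono mult_right_mono) (auto simp: algebra_simps)
      finally show "D * omega (1 + \<sigma>) c \<le> variation_const T \<sigma> K * c powr \<sigma> / \<sigma>" .
    qed (use \<sigma> True in auto)
  next
    case False
    then have \<sigma>1: "1 < \<sigma>" "\<sigma> < 2" using \<sigma> by auto
    \<comment> \<open>An antiderivative of the bound on the second derivative.\<close>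
    define Q where "Q x = K * (x + x powr (\<sigma> - 1) / (\<sigma> - 1))" for x
    define D where "D = K * (T powr (2 - \<sigma>) + 1 / (\<sigma> - 1)) * c powr (\<sigma> - 1)"
    have Q: "(Q has_real_derivative K * (1 + x powr (\<sigma> - 2))) (at x)" if "0 < x" for x
      unfolding Q_def[abs_def] using that \<sigma>1 by (auto intro!: derivative_eq_intros)
    have osc: "\<bar>v1 s - v1 c\<bar> \<le> D" if "0 < s" "s < c" for s
    proof -
      have "Q s - r * v1 s \<le> Q c - r * v1 c" if r: "\<bar>r\<bar> = 1" for r
      proof (rule DERIV_nonneg_imp_increasing_open[where f = "\<lambda>x. Q x - r * v1 x"])
        show "s \<le> c" using \<open>s < c\<close> by simp
        show "\<exists>y. ((\<lambda>x. Q x - r * v1 x) has_real_derivative y) (at x) \<and> 0 \<le> y"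
          if x: "s < x" "x < c" for x
        proof (intro exI conjI)
          have "(v1 has_real_derivative v2 x) (at x)"
            using v2(1)[of x] x \<open>0 < s\<close> c at_within_Ioc[of x T] by simp
          then show "((\<lambda>x. Q x - r * v1 x) has_real_derivative
              (K * (1 + x powr (\<sigma> - 2)) - r * v2 x)) (at x)"
            using x \<open>0 < s\<close> by (auto intro!: derivative_eq_intros Q)
          have "r * v2 x \<le> \<bar>v2 x\<bar>" using r by (metis abs_ge_self abs_mult mult_1)
          then show "0 \<le> K * (1 + x powr (\<sigma> - 2)) - r * v2 x"
            using v2(2)[of x] x \<open>0 < s\<close> c by auto
        qed
        have "continuous_on {s..c} v1"
          using \<open>0 < s\<close> c by (intro continuous_on_subset[OF DERIV_continuous_on[OF v2(1)]]) auto
        moreover have "continuous_on {s..c} Q"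
          using \<open>0 < s\<close> by (intro DERIV_continuous_on[OF has_field_derivative_at_within[OF Q]]) auto
        ultimately show "continuous_on {s..c} (\<lambda>x. Q x - r * v1 x)"
          by (intro continuous_intros)
      qed
      from this[of 1] this[of "-1"] have "\<bar>v1 s - v1 c\<bar> \<le> Q c - Q s" by auto
      also have "\<dots> \<le> Q c" using \<sigma>1 K \<open>0 < s\<close> by (auto simp: Q_def)
      also have "\<dots> \<le> D"
      proof -
        have "c * 1 \<le> c * (T powr (2 - \<sigma>) * c powr (\<sigma> - 2))"
          using one_le_powr_times_powr_neg[of c T "2 - \<sigma>"] c \<sigma>1 by (intro mult_left_mono) auto
        also have "\<dots> = T powr (2 - \<sigma>) * c powr (\<sigma> - 1)"
          using c powr_add[of c 1 "\<sigma> - 2"] by simp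
        finally have "c + c powr (\<sigma> - 1) / (\<sigma> - 1) \<le> (T powr (2 - \<sigma>) + 1 / (\<sigma> - 1)) * c powr (\<sigma> - 1)"
          by (simp add: algebra_simps)
        then show ?thesis unfolding Q_def D_def mult.assoc using K by (intro mult_left_mono)
      qed
      finally show ?thesis .
    qed
    show thesis
    proof (rule that[where \<beta> = 1 and D = D and d = "v1 c"])
      show "0 \<le> D" using K \<sigma>1 by (simp add: D_def)
      show "\<forall>s. 0 < s \<and> s < c \<longrightarrow> \<bar>v1 s - v1 c\<bar> \<le> D * omega 1 s"
        using osc by (simp add: omega_def)
      have "D * omega (1 + 1) c = K * (T powr (2 - \<sigma>) + 1 / (\<sigma> - 1)) * c powr \<sigma>"
        using c powr_add[of c "\<sigma> - 1" 1] by (simp add: D_def omega_def Gamma_numeral)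
      also have "\<dots> = K * (T powr (2 - \<sigma>) + 1 / (\<sigma> - 1)) * \<sigma> * c powr \<sigma> / \<sigma>"
        using \<sigma>1 by simp
      also have "\<dots> \<le> variation_const T \<sigma> K * c powr \<sigma> / \<sigma>"
      proof (intro divide_right_mono mult_right_mono)
        have "K * (T powr (2 - \<sigma>) + 1 / (\<sigma> - 1)) * \<sigma> \<le> K * (T powr (2 - \<sigma>) + 1 / (\<sigma> - 1)) * 2"
          using \<sigma>1 K by (intro mult_left_mono) auto
        also have "\<dots> \<le> variation_const T \<sigma> K"
          using \<sigma>1 K unfolding variation_const_def by (auto simp: algebra_simps)
        finally show "K * (T powr (2 - \<sigma>) + 1 / (\<sigma> - 1)) * \<sigma> \<le> variation_const T \<sigma> K" .
      qed (use \<sigma>1 in auto)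
      finally show "D * omega (1 + 1) c \<le> variation_const T \<sigma> K * c powr \<sigma> / \<sigma>" .
    qed auto
  qed
qed

lemma time_regular_integrable:
  assumes reg: "time_regular T \<sigma> K v v1" and \<sigma>: "0 < \<sigma>" and b: "0 < b" "b \<le> T"
    and \<beta>: "0 < \<beta>"
  shows "set_integrable lborel {0<..<b} (\<lambda>s. omega \<beta> (b - s) * v1 s)"
proof (rule set_integrable_bound)
  have cont: "continuous_on {0<..<b} v1"
  proof -
    obtain v2 where "\<And>x. x \<in> {0<..T} \<Longrightarrow> (v1 has_real_derivative v2 x) (at x within {0<..T})"
      using reg unfolding time_regular_def by blast
    then have "continuous_on {0<..T} v1" by (rule DERIV_continuous_on)
    then show ?thesis using b by (rule_tac continuous_on_subset) auto
  qed
  have "set_borel_measurable lborel {0<..<b} v1"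
    by (rule set_borel_measurable_Ioo[OF cont])
  then have "(\<lambda>s. omega \<beta> (b - s) * (indicator {0<..<b} s *\<^sub>R v1 s)) \<in> borel_measurable lborel"
    unfolding set_borel_measurable_def omega_def by measurable
  then show "set_borel_measurable lborel {0<..<b} (\<lambda>s. omega \<beta> (b - s) * v1 s)"
    unfolding set_borel_measurable_def by (simp add: mult_ac)
  show "set_integrable lborel {0<..<b} (\<lambda>s. K * (omega \<beta> (b - s) * omega 1 s) +
      K * Gamma \<sigma> * (omega \<beta> (b - s) * omega \<sigma> s))"
    using omega_convolution(1)[of \<beta> _ b] \<sigma> \<beta> b
    by (intro set_integral_add(1) set_integrable_mult_right) auto
  have "\<bar>omega \<beta> (b - s) * v1 s\<bar> \<le> \<bar>K * (omega \<beta> (b - s) * omega 1 s) +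
      K * Gamma \<sigma> * (omega \<beta> (b - s) * omega \<sigma> s)\<bar>" if s: "s \<in> {0<..<b}" for s
  proof -
    have G: "Gamma \<sigma> \<noteq> 0" using Gamma_real_pos[OF \<sigma>] by simp
    have "\<bar>v1 s\<bar> \<le> K * (1 + s powr (\<sigma> - 1))"
      using reg s b unfolding time_regular_def by force
    also have "\<dots> = K * omega 1 s + K * Gamma \<sigma> * omega \<sigma> s"
      using G s by (simp add: omega_def distrib_left)
    finally have "omega \<beta> (b - s) * \<bar>v1 s\<bar> \<le> omega \<beta> (b - s) * (K * omega 1 s + K * Gamma \<sigma> * omega \<sigma> s)"
      using omega_nonneg[OF \<beta>] by (intro mult_left_mono)
    then show ?thesis
      using omega_nonneg[OF \<beta>, of "b - s"] by (simp add: abs_mult algebra_simps)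
  qed
  then show "AE s in lborel. s \<in> {0<..<b} \<longrightarrow> norm (omega \<beta> (b - s) * v1 s) \<le>
      norm (K * (omega \<beta> (b - s) * omega 1 s) + K * Gamma \<sigma> * (omega \<beta> (b - s) * omega \<sigma> s))"
    by simp
qed

lemma time_regular_derivative_integral:
  assumes reg: "time_regular T \<sigma> K v v1" and \<sigma>: "0 < \<sigma>" and ac: "0 \<le> a" "a \<le> c" "c \<le> T"
  shows "set_integrable lborel {a<..<c} v1" "(LINT s:{a<..<c}|lborel. v1 s) = v c - v a"
proof -
  show int: "set_integrable lborel {a<..<c} v1"
  proof (cases "0 < c")
    case True
    have "set_integrable lborel {0<..<c} (\<lambda>s. omega 1 (c - s) * v1 s)"
      using time_regular_integrable[OF reg \<sigma> True ac(3)] by simp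
    then have "set_integrable lborel {0<..<c} v1"
      by (rule set_integrable_cong[THEN iffD1, rotated -1]) (auto simp: omega_def)
    then show ?thesis using ac by (rule_tac set_integrable_subset) auto
  qed (use ac in \<open>simp add: set_integrable_def\<close>)
  have "(v1 has_integral (v c - v a)) {a..c}"
  proof (rule fundamental_theorem_of_calculus_interior)
    show "continuous_on {a..c} v"
      using reg ac unfolding time_regular_def by (auto intro: continuous_on_subset)
    show "(v has_vector_derivative v1 x) (at x)" if "x \<in> {a<..<c}" for x
    proof -
      have "(v has_real_derivative v1 x) (at x within {0<..T})"
        using reg that ac unfolding time_regular_def by force
      then show ?thesis using that ac at_within_Ioc[of x T]
        by (simp add: has_real_derivative_iff_has_vector_derivative)
    qed
  qed (rule ac)
  then have "(v1 has_integral (v c - v a)) {a<..<c}"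
    using has_integral_Icc_iff_Ioo by blast
  then show "(LINT s:{a<..<c}|lborel. v1 s) = v c - v a"
    using set_borel_integral_eq_integral(2)[OF int] by (simp add: integral_unique)
qed

lemma time_regular_caputo:
  assumes reg: "time_regular T \<sigma> K v v1" and b: "0 < b" "b \<le> T"
  shows "caputo \<alpha> v b = (LINT s:{0<..<b}|lborel. omega (1 - \<alpha>) (b - s) * v1 s)"
  unfolding caputo_def
proof (rule set_lebesgue_integral_cong)
  show "\<forall>s. s \<in> {0<..<b} \<longrightarrow> omega (1 - \<alpha>) (b - s) * deriv v s = omega (1 - \<alpha>) (b - s) * v1 s"
  proof (intro allI impI)
    fix s assume s: "s \<in> {0<..<b}"
    then have "(v has_real_derivative v1 s) (at s within {0<..T})"
      using reg b unfolding time_regular_def by force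
    then have "deriv v s = v1 s"
      using s b at_within_Ioc[of s T] by (simp add: DERIV_imp_deriv)
    then show "omega (1 - \<alpha>) (b - s) * deriv v s = omega (1 - \<alpha>) (b - s) * v1 s" by simp
  qed
qed simp

context L1_mesh
begin

text \<open>
  Up to the factor \<open>variation_const\<close>, a bound for the integral of the oscillation of the time derivative
  over the \<open>k\<close>-th interval.
\<close>

definition local_error :: "real \<Rightarrow> nat \<Rightarrow> real" where
  "local_error \<sigma> k = (if k = 1 then step t 1 powr \<sigma> / \<sigma> else t (k - 1) powr (\<sigma> - 2) * (step t k)\<^sup>2)"

text \<open>
  The bound for the quadrature errors at level \<open>n\<close> if the oscillation on the \<open>k\<close>-th interval is \<open>g k\<close>: the
  past intervals by \<open>quadrature_error_interior\<close>, the current one by \<open>quadrature_error_last\<close>.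
\<close>

definition quadrature_bound :: "(nat \<Rightarrow> real) \<Rightarrow> nat \<Rightarrow> real" where
  "quadrature_bound g n = (\<Sum>k=1..<n. (a n (Suc k) - a n k) * g k) + 2 * a n n * g n"

lemma truncation_error_le:
  assumes reg: "time_regular T \<sigma> K v v1" and K: "0 \<le> K" and \<sigma>: "\<sigma> \<in> {0<..<1} \<union> {1<..<2}"
    and n: "1 \<le> n" "n \<le> N"
  shows "\<bar>(\<Sum>k=1..n. a n k * (v (t k) - v (t (k - 1)))) - caputo \<alpha> v (t n)\<bar> \<le>
    variation_const T \<sigma> K * quadrature_bound (local_error \<sigma>) n"
proof -
  define L where "L = variation_const T \<sigma> K"
  define w where "w s = omega (1 - \<alpha>) (t n - s)" for s
  define I where "I k = (LINT s:{t (k - 1)<..<t k}|lborel. w s * v1 s)" for k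
  have \<sigma>0: "0 < \<sigma>" "\<sigma> < 2" using \<sigma> by auto
  have L: "0 \<le> L" using K by (simp add: L_def variation_const_def)
  have int: "set_integrable lborel {0<..<t n} (\<lambda>s. w s * v1 s)"
    unfolding w_def using time_regular_integrable[OF reg \<sigma>0(1) t_pos[OF n] t_le_T[OF n(2)]] \<alpha> by simp
  have "caputo \<alpha> v (t n) = (\<Sum>k=1..n. I k)"
    using set_integral_Ioo_partition[of t n "\<lambda>s. w s * v1 s"] int t0 t_mono n
      time_regular_caputo[OF reg t_pos[OF n] t_le_T[OF n(2)]] by (simp add: I_def w_def)
  then have "(\<Sum>k=1..n. a n k * (v (t k) - v (t (k - 1)))) - caputo \<alpha> v (t n) =
      - (\<Sum>k=1..n. I k - a n k * (v (t k) - v (t (k - 1))))"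
    by (simp add: sum_subtractf)
  then have "\<bar>(\<Sum>k=1..n. a n k * (v (t k) - v (t (k - 1)))) - caputo \<alpha> v (t n)\<bar> \<le>
      (\<Sum>k=1..n. \<bar>I k - a n k * (v (t k) - v (t (k - 1)))\<bar>)"
    by simp
  also have "\<dots> = (\<Sum>k=1..<n. \<bar>I k - a n k * (v (t k) - v (t (k - 1)))\<bar>) + \<bar>I n - a n n * (v (t n) - v (t (n - 1)))\<bar>"
    using n by (simp add: sum.last_plus add.commute)
  also have "\<dots> \<le> (\<Sum>k=1..<n. (a n (Suc k) - a n k) * (L * local_error \<sigma> k)) + 2 * a n n * (L * local_error \<sigma> n)"
  proof -
    have majorant: "\<exists>d \<phi>. set_integrable lborel {t (k - 1)<..<t k} \<phi> \<and>
        (\<forall>s. t (k - 1) < s \<and> s < t k \<longrightarrow> \<bar>v1 s - d\<bar> \<le> \<phi> s) \<and>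
        (\<forall>r s. t (k - 1) < r \<and> r \<le> s \<and> s < t k \<longrightarrow> \<phi> s \<le> \<phi> r) \<and>
        (LINT s:{t (k - 1)<..<t k}|lborel. \<phi> s) \<le> L * local_error \<sigma> k \<and>
        (k = n \<longrightarrow> set_integrable lborel {t (k - 1)<..<t k} (\<lambda>s. w s * \<phi> s))" if k: "1 \<le> k" "k \<le> n" for k
    proof (cases "k = 1")
      case True
      have t1: "0 < t 1" "t 1 \<le> T" using t_pos[of 1] t_le_T[of 1] n by auto
      obtain d D \<beta> where \<beta>: "0 < \<beta>" "\<beta> \<le> 1" "0 \<le> D"
        and bd: "\<forall>s. 0 < s \<and> s < t 1 \<longrightarrow> \<bar>v1 s - d\<bar> \<le> D * omega \<beta> s"
        and le: "D * omega (1 + \<beta>) (t 1) \<le> L * t 1 powr \<sigma> / \<sigma>"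
        unfolding L_def using time_regular_oscillation_near_zero[OF reg K \<sigma> t1] by metis
      show ?thesis
      proof (intro exI[of _ d] exI[of _ "\<lambda>s. D * omega \<beta> s"] conjI allI impI)
        show "set_integrable lborel {t (k - 1)<..<t k} (\<lambda>s. D * omega \<beta> s)"
          using omega_integral_from_zero(1)[of \<beta> 0 "t 1"] \<beta> t1 True t0 by simp
        show "(LINT s:{t (k - 1)<..<t k}|lborel. D * omega \<beta> s) \<le> L * local_error \<sigma> k"
        proof -
          have "omega (1 + \<beta>) 0 = 0" by (simp add: omega_def)
          then have "(LINT s:{0<..<t 1}|lborel. D * omega \<beta> s) = D * omega (1 + \<beta>) (t 1)"
            using omega_integral_from_zero(2)[of \<beta> 0 "t 1"] \<beta> t1 by simp
          then show ?thesis using le True t0 by (auto simp add: local_error_def step_def)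
        qed
        show "set_integrable lborel {t (k - 1)<..<t k} (\<lambda>s. w s * (D * omega \<beta> s))" if "k = n"
          using omega_convolution(1)[of "1 - \<alpha>" \<beta> "t 1"] \<alpha> \<beta> t1 True t0 that
          by (simp add: w_def mult.left_commute)
        show "D * omega \<beta> s \<le> D * omega \<beta> r" if "t (k - 1) < r \<and> r \<le> s \<and> s < t k" for r s
          using that True t0 \<beta> by (intro mult_left_mono omega_antimono) auto
      qed (use bd True t0 in auto)
    next
      case False
      define D where "D = L * t (k - 1) powr (\<sigma> - 2) * (t k - t (k - 1))"
      have tk: "0 < t (k - 1)" "t (k - 1) < t k" "t k \<le> T"
        using t_pos[of "k - 1"] t_less[of k] t_le_T[of k] False k n by auto
      show ?thesis
      proof (intro exI[of _ "v1 (t k)"] exI[of _ "\<lambda>_. D"] conjI allI impI)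
        show "(LINT s:{t (k - 1)<..<t k}|lborel. D) \<le> L * local_error \<sigma> k"
          using tk False by (simp add: set_integral_const_Ioo D_def local_error_def step_def power2_eq_square)
        show "set_integrable lborel {t (k - 1)<..<t k} (\<lambda>s. w s * D)"
          using kernel_weight_integrable[of k n] k n unfolding w_def by simp
      qed (use time_regular_oscillation_away_from_zero[OF reg K \<sigma>0(2) tk] set_integrable_const_Ioo in \<open>auto simp: D_def L_def\<close>)
    qed
    have tk: "0 \<le> t (k - 1)" "t (k - 1) < t k" "t k \<le> t n" "t k \<le> T" if "1 \<le> k" "k \<le> n" for k
      using t_pred_nonneg[of k] t_less[of k] t_mono[of k n] t_le_T[of k] that n by auto
    have wv: "set_integrable lborel {t (k - 1)<..<t k} (\<lambda>s. w s * v1 s)" if "1 \<le> k" "k \<le> n" for k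
    proof (rule set_integrable_subset[OF int])
      show "{t (k - 1)<..<t k} \<subseteq> {0<..<t n}" using tk[OF that] by auto
    qed simp
    have interior: "\<bar>I k - a n k * (v (t k) - v (t (k - 1)))\<bar> \<le> (a n (Suc k) - a n k) * (L * local_error \<sigma> k)"
      if k: "1 \<le> k" "k < n" for k
    proof -
      obtain d \<phi> where \<phi>: "set_integrable lborel {t (k - 1)<..<t k} \<phi>"
        "\<And>s. t (k - 1) < s \<Longrightarrow> s < t k \<Longrightarrow> \<bar>v1 s - d\<bar> \<le> \<phi> s"
        "(LINT s:{t (k - 1)<..<t k}|lborel. \<phi> s) \<le> L * local_error \<sigma> k"
        using majorant[of k] k by auto
      have le0: "0 \<le> L * local_error \<sigma> k"
        using L \<sigma>0 by (auto simp: local_error_def)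
      have "\<bar>I k - a n k * (LINT s:{t (k - 1)<..<t k}|lborel. v1 s)\<bar> \<le>
          (omega (1 - \<alpha>) (t n - t k) - a n k) * (LINT s:{t (k - 1)<..<t k}|lborel. \<phi> s)"
        unfolding I_def w_def
        using k n \<phi> tk[of k] wv[of k] kernel_integral[of k n] t_strict_mono[of k n]
          time_regular_derivative_integral(1)[OF reg \<sigma>0(1), of "t (k - 1)" "t k"]
        by (intro quadrature_error_interior[OF \<alpha>]) (auto simp: w_def)
      also have "\<dots> \<le> (omega (1 - \<alpha>) (t n - t k) - a n k) * (L * local_error \<sigma> k)"
        using \<phi>(3) kernel_le_omega[of k n] k n by (intro mult_left_mono) auto
      also have "\<dots> \<le> (a n (Suc k) - a n k) * (L * local_error \<sigma> k)"
        using omega_le_kernel_Suc[of k n] k n le0 by (intro mult_right_mono) auto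
      finally show ?thesis
        using time_regular_derivative_integral(2)[OF reg \<sigma>0(1), of "t (k - 1)" "t k"] tk[of k] k by simp
    qed
    have last: "\<bar>I n - a n n * (v (t n) - v (t (n - 1)))\<bar> \<le> 2 * a n n * (L * local_error \<sigma> n)"
    proof -
      obtain d \<phi> where \<phi>: "set_integrable lborel {t (n - 1)<..<t n} \<phi>"
        "\<forall>s. t (n - 1) < s \<and> s < t n \<longrightarrow> \<bar>v1 s - d\<bar> \<le> \<phi> s"
        "\<forall>r s. t (n - 1) < r \<and> r \<le> s \<and> s < t n \<longrightarrow> \<phi> s \<le> \<phi> r"
        "(LINT s:{t (n - 1)<..<t n}|lborel. \<phi> s) \<le> L * local_error \<sigma> n"
        "set_integrable lborel {t (n - 1)<..<t n} (\<lambda>s. w s * \<phi> s)"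
        using majorant[of n] n by auto
      have "\<bar>I n - a n n * (LINT s:{t (n - 1)<..<t n}|lborel. v1 s)\<bar> \<le>
          2 * a n n * (LINT s:{t (n - 1)<..<t n}|lborel. \<phi> s)"
        unfolding I_def w_def
        using n \<phi> tk[of n] wv[of n] kernel_integral[of n n]
          time_regular_derivative_integral(1)[OF reg \<sigma>0(1), of "t (n - 1)" "t n"]
        by (intro quadrature_error_last[OF \<alpha>]) (auto simp: w_def)
      also have "\<dots> \<le> 2 * a n n * (L * local_error \<sigma> n)"
        using \<phi>(4) kernel_pos[of n n] n by (intro mult_left_mono) auto
      finally show ?thesis
        using time_regular_derivative_integral(2)[OF reg \<sigma>0(1), of "t (n - 1)" "t n"] tk[of n] n by simp
    qed
    show ?thesis
      using interior last by (intro add_mono sum_mono) auto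
  qed
  also have "\<dots> = L * quadrature_bound (local_error \<sigma>) n"
    by (simp add: quadrature_bound_def sum_distrib_left algebra_simps)
  finally show ?thesis by (simp add: L_def)
qed

text \<open>
  After exchanging the sums, the increments \<open>a j (Suc k) - a j k\<close> are summed against \<open>P n j\<close> over \<open>j > k\<close>. The
  complementary identities for \<open>k + 1\<close> and \<open>k\<close> evaluate this to \<open>1 - (1 - P n k * a k k)\<close>, the same
  quantity that multiplies the error of the current interval.
\<close>

lemma P_sum_quadrature_le:
  assumes n: "n \<le> N" and g: "\<And>k. 0 \<le> g k"
  shows "(\<Sum>j=1..n. P n j * quadrature_bound g j) \<le> 3 * (\<Sum>k=1..n. P n k * a k k * g k)"
proof -
  define f where "f j k = (if k < j then P n j * (a j (Suc k) - a j k) * g k else 0)" for j k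
  have "(\<Sum>j=1..n. P n j * (\<Sum>k=1..<j. (a j (Suc k) - a j k) * g k)) = (\<Sum>j=1..n. \<Sum>k=1..j. f j k)"
  proof (intro sum.cong refl)
    fix j assume "j \<in> {1..n}"
    have "P n j * (\<Sum>k=1..<j. (a j (Suc k) - a j k) * g k) = (\<Sum>k=1..<j. f j k)"
      by (simp add: f_def sum_distrib_left mult.assoc)
    also have "\<dots> = (\<Sum>k=1..j. f j k)"
      by (intro sum.mono_neutral_left) (auto simp: f_def)
    finally show "P n j * (\<Sum>k=1..<j. (a j (Suc k) - a j k) * g k) = (\<Sum>k=1..j. f j k)" .
  qed
  also have "\<dots> = (\<Sum>k=1..n. \<Sum>j=k..n. f j k)" by (rule sum_triangle_swap)
  also have "\<dots> \<le> (\<Sum>k=1..n. P n k * a k k * g k)"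
  proof (intro sum_mono)
    fix k assume k: "k \<in> {1..n}"
    have "(\<Sum>j=k..n. f j k) = (\<Sum>j=Suc k..n. f j k)"
      using k by (simp add: sum.atLeast_Suc_atMost f_def)
    also have "\<dots> = ((\<Sum>j=Suc k..n. P n j * a j (Suc k)) - (\<Sum>j=Suc k..n. P n j * a j k)) * g k"
      by (simp add: f_def right_diff_distrib flip: sum_distrib_right sum_subtractf)
    also have "\<dots> \<le> P n k * a k k * g k"
    proof (cases "k < n")
      case True
      have "(\<Sum>j=Suc k..n. P n j * a j (Suc k)) = 1" using P_complementary[OF n, of "Suc k"] True by simp
      moreover have "P n k * a k k + (\<Sum>j=Suc k..n. P n j * a j k) = 1"
        using P_complementary[OF n, of k] k by (simp add: sum.atLeast_Suc_atMost)
      then have "(\<Sum>j=Suc k..n. P n j * a j k) = 1 - P n k * a k k" by linarith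
      ultimately show ?thesis by simp
    next
      case False
      then show ?thesis using k g P_nonneg[OF n, of k] less_imp_le[OF kernel_pos[of k k]] n by auto
    qed
    finally show "(\<Sum>j=k..n. f j k) \<le> P n k * a k k * g k" .
  qed
  finally have "(\<Sum>j=1..n. P n j * (\<Sum>k=1..<j. (a j (Suc k) - a j k) * g k)) \<le> (\<Sum>k=1..n. P n k * a k k * g k)" .
  moreover have "(\<Sum>j=1..n. P n j * quadrature_bound g j) =
      (\<Sum>j=1..n. P n j * (\<Sum>k=1..<j. (a j (Suc k) - a j k) * g k)) + 2 * (\<Sum>k=1..n. P n k * a k k * g k)"
    by (simp add: quadrature_bound_def distrib_left sum.distrib sum_distrib_left mult_ac)
  ultimately show ?thesis by simp
qed

definition mesh_weight :: "real \<Rightarrow> nat \<Rightarrow> real" where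
  "mesh_weight \<sigma> k = t (k - 1) powr (\<sigma> - 2) * t k powr (\<alpha> - 1) * step t k powr (2 - \<alpha>)"

definition temporal_error :: "real \<Rightarrow> nat \<Rightarrow> real" where
  "temporal_error \<sigma> n = step t 1 powr \<sigma> / \<sigma> + (\<Sum>j=2..n. step t j * (MAX k\<in>{j..n}. mesh_weight \<sigma> k))"

text \<open>
  For \<open>k \<ge> 2\<close> the product \<open>a k k * local_error \<sigma> k\<close> is \<open>omega (2 - \<alpha>) (t k) * mesh_weight \<sigma> k\<close>, and
  \<open>omega (2 - \<alpha>) (t k)\<close> is the L1 derivative of \<open>s \<mapsto> s\<close>. Replacing the weight at \<open>k\<close> by the maximum over
  later indices, which may be moved inside the sum over \<open>j \<le> k\<close>, makes the complementary weights applicable.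
\<close>

lemma P_sum_local_error_le:
  assumes n: "1 \<le> n" "n \<le> N" and \<sigma>: "0 < \<sigma>" and ratio: "step_ratio_bound \<rho> N t" "0 \<le> \<rho>"
  shows "(\<Sum>k=1..n. P n k * a k k * local_error \<sigma> k) \<le> (\<rho> + 1) * temporal_error \<sigma> n"
proof -
  \<comment> \<open>The weight at \<open>k = 1\<close> is meaningless (\<open>t 0 = 0\<close>), so \<open>X 1\<close> is set to \<open>X 2\<close>; \<open>X\<close> stays nonincreasing.\<close>
  define X where "X j = (MAX k\<in>{max 2 j..n}. mesh_weight \<sigma> k)" for j
  have w: "0 \<le> mesh_weight \<sigma> k" for k by (simp add: mesh_weight_def)
  have X_ge: "mesh_weight \<sigma> k \<le> X j" if "2 \<le> k" "j \<le> k" "k \<le> n" for j k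
    unfolding X_def using that by (intro Max_ge) auto
  have X_nonneg: "0 \<le> X j" if "2 \<le> n" "j \<le> n" for j
    using X_ge[of n j] w[of n] that by simp
  have loc: "a k k * local_error \<sigma> k = omega (2 - \<alpha>) (t k) * mesh_weight \<sigma> k" if "2 \<le> k" "k \<le> N" for k
  proof -
    have s: "0 < step t k" "0 < t k" using step_pos[of k] t_pos[of k] that by auto
    have "step t k powr (- \<alpha>) * (step t k)\<^sup>2 = step t k powr (2 - \<alpha>)"
      using s powr_add[of "step t k" "- \<alpha>" 2] by simp
    moreover have "t k powr (1 - \<alpha>) * t k powr (\<alpha> - 1) = 1"
      using s by (simp flip: powr_add)
    ultimately show ?thesis
      using that kernel_diag[of k] unfolding local_error_def mesh_weight_def omega_def
      by (simp add: mult_ac)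
  qed
  have first: "P n 1 * a 1 1 * local_error \<sigma> 1 \<le> step t 1 powr \<sigma> / \<sigma>"
    using P_times_diag_le_one[of 1 n] n \<sigma> mult_right_mono[of "P n 1 * a 1 1" 1 "local_error \<sigma> 1"]
    by (simp add: local_error_def)
  have rest: "(\<Sum>k=2..n. P n k * a k k * local_error \<sigma> k) \<le> (\<rho> + 1) * (\<Sum>j=2..n. step t j * X j)"
  proof (cases "2 \<le> n")
    case True
    have summand: "P n k * a k k * local_error \<sigma> k \<le> P n k * (\<Sum>j=1..k. a k j * (step t j * X j))" if k: "k \<in> {2..n}" for k
    proof -
      have "a k k * local_error \<sigma> k = (\<Sum>j=1..k. a k j * step t j) * mesh_weight \<sigma> k"
        using loc[of k] sum_kernel_steps[of k] k n by simp
      also have "\<dots> = (\<Sum>j=1..k. a k j * step t j * mesh_weight \<sigma> k)"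
        by (rule sum_distrib_right)
      also have "\<dots> \<le> (\<Sum>j=1..k. a k j * step t j * X j)"
        using k n X_ge kernel_pos step_pos
        by (intro sum_mono mult_left_mono mult_nonneg_nonneg less_imp_le[OF kernel_pos] less_imp_le[OF step_pos]) auto
      finally show ?thesis
        using P_nonneg[OF n(2), of k] k by (simp add: mult.assoc mult_left_mono)
    qed
    have "(\<Sum>k=2..n. P n k * a k k * local_error \<sigma> k) \<le> (\<Sum>k=2..n. P n k * (\<Sum>j=1..k. a k j * (step t j * X j)))"
      by (intro sum_mono summand)
    also have "\<dots> \<le> (\<Sum>k=1..n. P n k * (\<Sum>j=1..k. a k j * (step t j * X j)))"
      using n True X_nonneg
      by (intro sum_mono2 mult_nonneg_nonneg sum_nonneg P_nonneg less_imp_le[OF kernel_pos] less_imp_le[OF step_pos]) auto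
    also have "\<dots> = (\<Sum>j=1..n. step t j * X j)" by (rule P_sum_increments[OF n(2)])
    also have "\<dots> = step t 1 * X 1 + (\<Sum>j=2..n. step t j * X j)"
      using n by (simp add: sum.atLeast_Suc_atMost numeral_2_eq_2)
    also have "X 1 = X 2" by (simp add: X_def numeral_2_eq_2)
    also have "step t 1 \<le> \<rho> * step t 2"
    proof -
      have "step t 1 / step t 2 \<le> \<rho>"
        using bspec[OF ratio(1)[unfolded step_ratio_bound_def], of 1] True n by (simp add: numeral_2_eq_2)
      then show ?thesis using step_pos[of 2] True n by (simp add: field_simps)
    qed
    then have "step t 1 * X 2 + (\<Sum>j=2..n. step t j * X j) \<le> \<rho> * step t 2 * X 2 + (\<Sum>j=2..n. step t j * X j)"
      using X_nonneg[of 2] True by (intro add_mono mult_right_mono) auto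
    also have "step t 2 * X 2 \<le> (\<Sum>j=2..n. step t j * X j)"
      using True n X_nonneg by (intro member_le_sum[of 2] mult_nonneg_nonneg less_imp_le[OF step_pos]) auto
    then have "\<rho> * step t 2 * X 2 + (\<Sum>j=2..n. step t j * X j) \<le> (\<rho> + 1) * (\<Sum>j=2..n. step t j * X j)"
      using ratio(2) by (simp add: distrib_right mult.assoc mult_left_mono)
    finally show ?thesis by simp
  qed simp
  have eq: "(\<Sum>j=2..n. step t j * X j) = (\<Sum>j=2..n. step t j * (MAX k\<in>{j..n}. mesh_weight \<sigma> k))"
    by (intro sum.cong refl) (simp add: X_def max_def)
  have "(\<Sum>k=1..n. P n k * a k k * local_error \<sigma> k) =
      P n 1 * a 1 1 * local_error \<sigma> 1 + (\<Sum>k=2..n. P n k * a k k * local_error \<sigma> k)"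
    using n by (simp add: sum.atLeast_Suc_atMost numeral_2_eq_2)
  also have "\<dots> \<le> step t 1 powr \<sigma> / \<sigma> + (\<rho> + 1) * (\<Sum>j=2..n. step t j * X j)"
    using first rest by (rule add_mono)
  also have "\<dots> \<le> (\<rho> + 1) * (step t 1 powr \<sigma> / \<sigma>) + (\<rho> + 1) * (\<Sum>j=2..n. step t j * X j)"
    using mult_right_mono[of 1 "\<rho> + 1" "step t 1 powr \<sigma> / \<sigma>"] ratio(2) \<sigma> by simp
  finally show ?thesis unfolding eq temporal_error_def distrib_left .
qed

lemma mesh_weight_max_nonneg: "j \<le> n \<Longrightarrow> 0 \<le> (MAX k\<in>{j..n}. mesh_weight \<sigma> k)"
  by (rule order_trans[OF _ Max_ge[of _ "mesh_weight \<sigma> n"]]) (auto simp: mesh_weight_def)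

lemma temporal_error_mono:
  assumes "m \<le> n" "n \<le> N"
  shows "temporal_error \<sigma> m \<le> temporal_error \<sigma> n"
proof -
  have "(\<Sum>j=2..m. step t j * (MAX k\<in>{j..m}. mesh_weight \<sigma> k)) \<le> (\<Sum>j=2..m. step t j * (MAX k\<in>{j..n}. mesh_weight \<sigma> k))"
    using assms by (intro sum_mono mult_left_mono Max_mono less_imp_le[OF step_pos]) auto
  also have "\<dots> \<le> (\<Sum>j=2..n. step t j * (MAX k\<in>{j..n}. mesh_weight \<sigma> k))"
    using assms by (intro sum_mono2 mult_nonneg_nonneg mesh_weight_max_nonneg less_imp_le[OF step_pos]) auto
  finally show ?thesis by (simp add: temporal_error_def)
qed

lemma temporal_error_nonneg:
  assumes "0 < \<sigma>" "n \<le> N"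
  shows "0 \<le> temporal_error \<sigma> n"
  unfolding temporal_error_def using assms
  by (intro add_nonneg_nonneg sum_nonneg mult_nonneg_nonneg mesh_weight_max_nonneg less_imp_le[OF step_pos]) auto

end

section \<open>Consistency in space\<close>

text \<open>
  Taylor's formula by repeated integration: the symmetric remainder and its first two derivatives
  vanish at zero, and its third derivative \<open>w 3 (x + s) - w 3 (x - s)\<close> is at most \<open>2 K s\<close> in absolute
  value. Differentiability is required in the open interval only, so the estimate covers the grid
  points next to the boundary.
\<close>

lemma central_difference_error:
  fixes g :: "real \<Rightarrow> real" and w :: "nat \<Rightarrow> real \<Rightarrow> real"
  assumes cont: "continuous_on {xl..xr} g"
    and w0: "w 0 = g"
    and w: "\<And>j x. j < 3 \<Longrightarrow> xl < x \<Longrightarrow> x < xr \<Longrightarrow> (w j has_real_derivative w (Suc j) x) (at x)"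
    and lip: "\<And>x y. xl < x \<Longrightarrow> x \<le> y \<Longrightarrow> y < xr \<Longrightarrow> \<bar>w 3 y - w 3 x\<bar> \<le> K * (y - x)"
    and x: "0 < h" "xl \<le> x - h" "x + h \<le> xr"
  shows "\<bar>w 2 x - (g (x + h) - 2 * g x + g (x - h)) / h\<^sup>2\<bar> \<le> K * h\<^sup>2 / 12"
proof -
  have shift: "((\<lambda>s. w j (x + s)) has_real_derivative w (Suc j) (x + s)) (at s)"
    "((\<lambda>s. w j (x - s)) has_real_derivative - w (Suc j) (x - s)) (at s)" if "j < 3" "0 \<le> s" "s < h" for j s
    using that x DERIV_chain2[of "w j" "w (Suc j) (x + s)" "\<lambda>s. x + s" s 1 UNIV]
      DERIV_chain2[of "w j" "w (Suc j) (x - s)" "\<lambda>s. x - s" s "-1" UNIV] w[of j "x + s"] w[of j "x - s"]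
      DERIV_add[OF DERIV_const DERIV_ident, of x s] DERIV_diff[OF DERIV_const DERIV_ident, of x s]
    by auto
  have *: "r * (g (x + h) + g (x - h) - 2 * g x - h\<^sup>2 * w 2 x) \<le> K * h ^ 4 / 12" if r: "r = 1 \<or> r = -1" for r
  proof -
    define f2 where "f2 s = K * s\<^sup>2 - r * (w 2 (x + s) + w 2 (x - s) - 2 * w 2 x)" for s
    define f1 where "f1 s = K * s ^ 3 / 3 - r * (w 1 (x + s) - w 1 (x - s) - 2 * s * w 2 x)" for s
    have f2: "0 \<le> f2 s" if s: "0 \<le> s" "s < h" for s
    proof -
      have "f2 0 \<le> f2 s"
      proof (rule DERIV_nonneg_imp_nondecreasing[where f = f2, OF s(1)])
        fix y assume y: "0 \<le> y" "y \<le> s"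
        have "(f2 has_real_derivative (2 * K * y - r * (w 3 (x + y) - w 3 (x - y)))) (at y)"
          unfolding f2_def[abs_def] using y s shift[of 2 y]
          by (auto intro!: derivative_eq_intros simp: numeral_3_eq_3 numeral_2_eq_2)
        moreover have "\<bar>w 3 (x + y) - w 3 (x - y)\<bar> \<le> 2 * K * y"
          using lip[of "x - y" "x + y"] x y s by (simp add: algebra_simps)
        ultimately show "\<exists>d. (f2 has_real_derivative d) (at y) \<and> 0 \<le> d"
          using r by (intro exI[of _ "2 * K * y - r * (w 3 (x + y) - w 3 (x - y))"]) auto
      qed
      then show ?thesis by (simp add: f2_def)
    qed
    have f1: "0 \<le> f1 s" if s: "0 \<le> s" "s < h" for s
    proof -
      have "f1 0 \<le> f1 s"
      proof (rule DERIV_nonneg_imp_nondecreasing[where f = f1, OF s(1)])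
        fix y assume y: "0 \<le> y" "y \<le> s"
        have "(f1 has_real_derivative f2 y) (at y)"
          unfolding f1_def[abs_def] f2_def using y s shift[of 1 y]
          by (auto intro!: derivative_eq_intros simp: numeral_2_eq_2)
        then show "\<exists>d. (f1 has_real_derivative d) (at y) \<and> 0 \<le> d"
          using f2[of y] y s by (intro exI[of _ "f2 y"]) auto
      qed
      then show ?thesis by (simp add: f1_def)
    qed
    \<comment> \<open>The last integration goes up to \<open>h\<close>, where continuity suffices.\<close>
    define f where "f s = K * s ^ 4 / 12 - r * (w 0 (x + s) + w 0 (x - s) - 2 * w 0 x - s\<^sup>2 * w 2 x)" for s
    have "f 0 \<le> f h"
    proof (rule DERIV_nonneg_imp_increasing_open[where f = f])
      fix y assume y: "0 < y" "y < h"
      have "(f has_real_derivative f1 y) (at y)"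
        unfolding f_def[abs_def] f1_def using y shift[of 0 y]
        by (auto intro!: derivative_eq_intros simp: power3_eq_cube)
      then show "\<exists>d. (f has_real_derivative d) (at y) \<and> 0 \<le> d"
        using f1[of y] y by (intro exI[of _ "f1 y"]) auto
    next
      show "continuous_on {0..h} f"
        unfolding f_def w0 using x
        by (intro continuous_intros continuous_on_compose2[OF cont]) auto
    qed (use x in simp)
    then show ?thesis by (simp add: f_def w0)
  qed
  have "\<bar>g (x + h) + g (x - h) - 2 * g x - h\<^sup>2 * w 2 x\<bar> \<le> K * h ^ 4 / 12"
    using *[of 1] *[of "-1"] by (intro abs_leI) simp_all
  then have "\<bar>g (x + h) + g (x - h) - 2 * g x - h\<^sup>2 * w 2 x\<bar> / h\<^sup>2 \<le> K * h ^ 4 / 12 / h\<^sup>2"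
    by (intro divide_right_mono) auto
  moreover have "\<bar>w 2 x - (g (x + h) - 2 * g x + g (x - h)) / h\<^sup>2\<bar> = \<bar>g (x + h) + g (x - h) - 2 * g x - h\<^sup>2 * w 2 x\<bar> / h\<^sup>2"
  proof -
    have "w 2 x - (g (x + h) - 2 * g x + g (x - h)) / h\<^sup>2 = - ((g (x + h) + g (x - h) - 2 * g x - h\<^sup>2 * w 2 x) / h\<^sup>2)"
      using x by (simp add: field_simps)
    then show ?thesis by (simp add: abs_divide)
  qed
  moreover have "K * h ^ 4 / 12 / h\<^sup>2 = K * h\<^sup>2 / 12"
    using x by (simp add: power_numeral_reduce)
  ultimately show ?thesis by (simp only:)
qed

lemma indefinite_integral_lipschitz:
  fixes f g :: "real \<Rightarrow> real"
  assumes "set_integrable lborel {a..b} f" "g b - g a = (LINT y:{a..b}|lborel. f y)" "a \<le> b"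
    and "AE y in lborel. y \<in> {a..b} \<longrightarrow> \<bar>f y\<bar> \<le> K"
  shows "\<bar>g b - g a\<bar> \<le> K * (b - a)"
proof -
  have "\<bar>g b - g a\<bar> \<le> (LINT y:{a..b}|lborel. \<bar>f y\<bar>)"
    using set_integral_norm_bound[OF assms(1)] assms(2) by simp
  also have "\<dots> \<le> (LINT y:{a..b}|lborel. K)"
    using assms(4) by (intro set_integral_mono_AE set_integrable_abs[OF assms(1)])
      (auto intro: borel_integrable_atLeastAtMost')
  also have "\<dots> = K * (b - a)"
    using assms(3) by (simp add: set_lebesgue_integral_def)
  finally show ?thesis .
qed

section \<open>The error estimate on a general mesh\<close>

text \<open>
  The contributions of the initial error, of the consistency error in time and of that in space.
\<close>

definition error_bound_const :: "real \<Rightarrow> real \<Rightarrow> real \<Rightarrow> real \<Rightarrow> real" where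
  "error_bound_const l T \<sigma> K = 2 + 6 * sqrt l * variation_const T \<sigma> K + sqrt l * K"

lemma variation_const_nonneg: "0 \<le> K \<Longrightarrow> 0 \<le> variation_const T \<sigma> K"
  by (simp add: variation_const_def)

context
  fixes xl xr T \<kappa> \<sigma> K \<rho> \<alpha> :: real and f u :: "real \<Rightarrow> real \<Rightarrow> real" and u0 :: "real \<Rightarrow> real"
    and M N :: nat and t :: "nat \<Rightarrow> real" and U :: "nat \<Rightarrow> nat \<Rightarrow> real"
  assumes setting: "l1_setting xl xr T \<kappa> \<sigma> K \<rho> \<alpha> f u0 u M N t U"
    and dom: "xl < xr" and T: "0 < T" and K: "0 < K" and \<sigma>: "\<sigma> \<in> {0<..<1} \<union> {1<..<2}"
begin

interpretation L1_mesh \<alpha> T N t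
  using setting by unfold_locales (auto simp: l1_setting_def)

lemma setting_simps: "0 < \<rho>" "1 \<le> M" "step_ratio_bound \<rho> N t"
  "subdiffusion_solution xl xr T \<kappa> \<alpha> f u0 u" "sol_regularity xl xr T \<sigma> K u"
  "step_restriction \<alpha> \<kappa> \<rho> N t" "L1_scheme xl xr \<kappa> \<alpha> f u0 M N t U"
  using setting by (auto simp: l1_setting_def)

private abbreviation "h \<equiv> mesh_width xl xr M"
private abbreviation "gx \<equiv> grid_pt xl xr M"
private abbreviation "err \<equiv> scheme_error xl xr u M t U"

lemma h_pos: "0 < h" and h_times_M: "h * real M = xr - xl"
  using setting_simps(2) dom by (auto simp: mesh_width_def)

lemma grid_pt_bounds:
  assumes "i \<in> {1..<M}"
  shows "xl \<le> gx i - h" "gx i + h \<le> xr"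
    "gx (i + 1) = gx i + h" "gx (i - 1) = gx i - h"
    "xl < gx i" "gx i < xr"
proof -
  have "1 * h \<le> real i * h" "(real i + 1) * h \<le> real M * h"
    using assms h_pos by (auto intro!: mult_right_mono)
  then show "xl \<le> gx i - h" "gx i + h \<le> xr"
    using h_times_M by (auto simp: grid_pt_def algebra_simps)
  then show "xl < gx i" "gx i < xr" using h_pos by auto
  show "gx (i + 1) = gx i + h" "gx (i - 1) = gx i - h"
    using assms by (auto simp: grid_pt_def algebra_simps of_nat_diff)
qed

lemma continuous_on_cylinder: "continuous_on ({xl..xr} \<times> {0..T}) (\<lambda>(x, t). u x t)"
  using setting_simps(4) by (simp add: subdiffusion_solution_def)

lemma continuous_in_space:
  assumes "s \<in> {0..T}"
  shows "continuous_on {xl..xr} (\<lambda>x. u x s)"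
proof -
  have "continuous_on {xl..xr} (\<lambda>x. (\<lambda>(x, t). u x t) (x, s))"
    by (rule continuous_on_compose2[OF continuous_on_cylinder]) (use assms in \<open>auto intro!: continuous_intros\<close>)
  then show ?thesis by simp
qed

lemma continuous_in_time:
  assumes "x \<in> {xl..xr}"
  shows "continuous_on {0..T} (u x)"
proof -
  have "continuous_on {0..T} (\<lambda>s. (\<lambda>(x, t). u x t) (x, s))"
    by (rule continuous_on_compose2[OF continuous_on_cylinder]) (use assms in \<open>auto intro!: continuous_intros\<close>)
  then show ?thesis by simp
qed

text \<open>
  The boundary condition holds for \<open>0 < t < T\<close>; at \<open>t = T\<close> it follows by continuity.
\<close>

lemma boundary_value:
  assumes s: "0 < s" "s \<le> T" and x: "x = xl \<or> x = xr"
  shows "u x s = 0"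
proof -
  have "continuous_on {0..T} (u x)" using continuous_in_time[of x] dom x by auto
  then have "closed {y \<in> {0..T}. u x y = 0}"
    by (intro continuous_closed_preimage_constant) auto
  moreover have "{0<..<T} \<subseteq> {y \<in> {0..T}. u x y = 0}"
    using setting_simps(4) x by (auto simp: subdiffusion_solution_def)
  ultimately have "closure {0<..<T} \<subseteq> {y \<in> {0..T}. u x y = 0}"
    by (rule closure_minimal[rotated])
  moreover have "s \<in> closure {0<..<T}" using s T by simp
  ultimately show ?thesis by blast
qed

lemma time_regular_at:
  assumes "x \<in> {xl<..<xr}"
  shows "\<exists>v1. time_regular T \<sigma> K (u x) v1"
proof -
  have "continuous_on {0..T} (u x)" using continuous_in_time assms by auto
  then show ?thesis
    using setting_simps(5) assms unfolding sol_regularity_def time_regular_def by blast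
qed

lemma space_truncation_le:
  assumes s: "0 < s" "s \<le> T" and i: "i \<in> {1..<M}"
  shows "\<bar>(deriv ^^ 2) (\<lambda>y. u y s) (gx i) -
     discrete_laplacian h (\<lambda>i. u (gx i) s) i\<bar> \<le> K * h\<^sup>2 / 12"
proof -
  from setting_simps(5) s obtain w :: "nat \<Rightarrow> real \<Rightarrow> real" where W: "w 0 = (\<lambda>x. u x s) \<and>
        (\<forall>j<3. \<forall>x\<in>{xl<..<xr}. (w j has_real_derivative w (Suc j) x) (at x)) \<and>
        (\<forall>a b. xl < a \<and> a \<le> b \<and> b < xr \<longrightarrow>
           set_integrable lborel {a..b} (w 4) \<and>
           w 3 b - w 3 a = (LINT y:{a..b}|lborel. w 4 y)) \<and>
        (AE y in lborel. y \<in> {xl<..<xr} \<longrightarrow> \<bar>w 4 y\<bar> \<le> K)"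
    unfolding sol_regularity_def by (elim conjE ballE[of _ _ s] exE) auto
  have w0: "w 0 = (\<lambda>x. u x s)" using W by blast
  have w: "(w j has_real_derivative w (Suc j) x) (at x)" if "j < 3" "x \<in> {xl<..<xr}" for j x
    using W that by blast
  have w4: "set_integrable lborel {a..b} (w 4)" "w 3 b - w 3 a = (LINT y:{a..b}|lborel. w 4 y)"
    if "xl < a" "a \<le> b" "b < xr" for a b
    using W that by blast+
  have AE: "AE y in lborel. y \<in> {xl<..<xr} \<longrightarrow> \<bar>w 4 y\<bar> \<le> K" using W by blast
  define x where "x = gx i"
  note xb = grid_pt_bounds[OF i, folded x_def]
  have lip: "\<bar>w 3 b - w 3 a\<bar> \<le> K * (b - a)" if "xl < a" "a \<le> b" "b < xr" for a b
  proof (rule indefinite_integral_lipschitz[OF w4(1) w4(2)])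
    show "AE y in lborel. y \<in> {a..b} \<longrightarrow> \<bar>w 4 y\<bar> \<le> K"
      using AE by eventually_elim (use that in auto)
  qed (use that in auto)
  have "\<bar>w 2 x - (u (x + h) s - 2 * u x s + u (x - h) s) / h\<^sup>2\<bar> \<le> K * h\<^sup>2 / 12"
    using xb h_pos lip w w0 continuous_in_space[of s] s by (intro central_difference_error[of xl xr "\<lambda>x. u x s"]) auto
  moreover have "(deriv ^^ 2) (\<lambda>y. u y s) x = w 2 x"
  proof -
    have d1: "deriv (\<lambda>y. u y s) y = w 1 y" if "y \<in> {xl<..<xr}" for y
      using DERIV_imp_deriv[OF w[of 0 y]] that w0 by simp
    have "(w 1 has_real_derivative w 2 x) (at x)"
      using w[of 1 x] xb by (simp add: numeral_2_eq_2)
    then have "(deriv (\<lambda>y. u y s) has_real_derivative w 2 x) (at x)"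
      by (rule DERIV_cong_ev[OF refl _ refl, THEN iffD1, rotated])
        (use eventually_nhds_in_open[of "{xl<..<xr}" x] xb d1 in \<open>auto elim!: eventually_mono\<close>)
    then show ?thesis by (simp add: numeral_2_eq_2 DERIV_imp_deriv)
  qed
  moreover have "discrete_laplacian h (\<lambda>i. u (gx i) s) i = (u (x + h) s - 2 * u x s + u (x - h) s) / h\<^sup>2"
    by (simp only: discrete_laplacian_def xb x_def[symmetric])
  ultimately show ?thesis by (simp add: x_def)
qed

text \<open>
  The step size restriction says exactly that \<open>4 max 1 \<rho> \<kappa>\<^sub>+ \<le> a n n\<close> for the largest step.
\<close>

lemma kernel_dominates_reaction:
  assumes n: "1 \<le> n" "n \<le> N"
  shows "2 * max \<kappa> 0 \<le> a n n"
proof (cases "0 < \<kappa>")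
  case True
  define X where "X = 4 * max 1 \<rho> * Gamma (2 - \<alpha>) * max \<kappa> 0"
  have G: "0 < Gamma (2 - \<alpha>)" using \<alpha> by (auto intro: Gamma_real_pos)
  have X: "0 < X" using True G by (simp add: X_def)
  have tau: "0 < step t n" using step_pos n by simp
  have "step t n \<le> max_step N t" unfolding max_step_def using n by (intro Max_ge) auto
  also have "\<dots> \<le> 1 / X powr (1 / \<alpha>)"
    using setting_simps(6) True unfolding step_restriction_def X_def by auto
  finally have "step t n powr \<alpha> \<le> (1 / X powr (1 / \<alpha>)) powr \<alpha>"
    using tau \<alpha> by (intro powr_mono2) auto
  also have "\<dots> = 1 / X" using X \<alpha> by (simp add: powr_divide powr_powr)
  finally have "X \<le> step t n powr (- \<alpha>)"
    using X tau by (simp add: powr_minus field_simps)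
  then have "X / Gamma (2 - \<alpha>) \<le> a n n" using G kernel_diag[OF n] by (simp add: divide_right_mono)
  moreover have "X / Gamma (2 - \<alpha>) = 4 * max 1 \<rho> * max \<kappa> 0" using G by (simp add: X_def)
  moreover have "2 * max \<kappa> 0 \<le> 4 * max 1 \<rho> * max \<kappa> 0" using True by simp
  ultimately show ?thesis by linarith
qed (use kernel_pos[of n n] n in simp)

lemma scheme_error_equation:
  assumes n: "1 \<le> n" "n \<le> N" and i: "i \<in> {1..<M}"
  shows "(\<Sum>k=1..n. a n k * (err k i - err (k - 1) i)) =
    discrete_laplacian h (err n) i + \<kappa> * err n i +
    (((\<Sum>k=1..n. a n k * (u (gx i) (t k) - u (gx i) (t (k - 1)))) -
       caputo \<alpha> (u (gx i)) (t n)) +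
     ((deriv ^^ 2) (\<lambda>y. u y (t n)) (gx i) -
       discrete_laplacian h (\<lambda>i. u (gx i) (t n)) i))"
proof -
  have "discrete_caputo (L1_kernel \<alpha> t) (\<lambda>k. U k i) n =
      discrete_laplacian h (U n) i + \<kappa> * U n i + f (gx i) (t n)"
    using setting_simps(7) n i unfolding L1_scheme_def by auto
  then have "(\<Sum>k=1..n. a n k * (U k i - U (k - 1) i)) = discrete_laplacian h (U n) i + \<kappa> * U n i + f (gx i) (t n)"
    by (simp add: discrete_caputo_def a_def)
  moreover have "caputo \<alpha> (u (gx i)) (t n) - (deriv ^^ 2) (\<lambda>y. u y (t n)) (gx i) =
      \<kappa> * u (gx i) (t n) + f (gx i) (t n)"
    using setting_simps(4) grid_pt_bounds[OF i] t_pos[OF n] t_le_T[OF n(2)] unfolding subdiffusion_solution_def by auto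
  moreover have "(\<Sum>k=1..n. a n k * (err k i - err (k - 1) i)) =
      (\<Sum>k=1..n. a n k * (u (gx i) (t k) - u (gx i) (t (k - 1)))) - (\<Sum>k=1..n. a n k * (U k i - U (k - 1) i))"
    by (simp add: scheme_error_def algebra_simps flip: sum_subtractf)
  moreover have "discrete_laplacian h (err n) i = discrete_laplacian h (\<lambda>i. u (gx i) (t n)) i - discrete_laplacian h (U n) i"
    by (simp add: discrete_laplacian_def scheme_error_def diff_divide_distrib add_divide_distrib)
  ultimately show ?thesis by (simp add: scheme_error_def algebra_simps)
qed

lemma error_energy_inequality:
  assumes n: "1 \<le> n" "n \<le> N"
  shows "(\<Sum>k=1..n. a n k * (grid_norm h M (err k) - grid_norm h M (err (k - 1)))) \<le>
    max \<kappa> 0 * grid_norm h M (err n) +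
    sqrt (xr - xl) * (variation_const T \<sigma> K * quadrature_bound (local_error \<sigma>) n + K * h\<^sup>2 / 12)"
proof -
  define B where "B = quadrature_bound (local_error \<sigma>) n"
  define r where "r i = ((\<Sum>k=1..n. a n k * (u (gx i) (t k) - u (gx i) (t (k - 1)))) -
       caputo \<alpha> (u (gx i)) (t n)) +
     ((deriv ^^ 2) (\<lambda>y. u y (t n)) (gx i) -
       discrete_laplacian h (\<lambda>i. u (gx i) (t n)) i)" for i
  have loc: "0 \<le> local_error \<sigma> k" for k using \<sigma> by (auto simp: local_error_def)
  have B: "0 \<le> B"
    unfolding B_def quadrature_bound_def using n loc kernel_mono
    by (intro add_nonneg_nonneg sum_nonneg mult_nonneg_nonneg less_imp_le[OF kernel_pos]) auto
  have "(\<Sum>k=1..n. a n k * (grid_norm h M (err k) - grid_norm h M (err (k - 1)))) \<le>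
      max \<kappa> 0 * grid_norm h M (err n) + grid_norm h M r"
  proof (rule energy_inequality)
    show "(\<Sum>k=1..n. a n k * (err k i - err (k - 1) i)) = discrete_laplacian h (err n) i + \<kappa> * err n i + r i"
      if "i \<in> {1..<M}" for i using scheme_error_equation[OF n that] by (simp add: r_def)
    have "gx 0 = xl" "gx M = xr"
      using h_times_M by (auto simp: grid_pt_def mult.commute)
    then show "err n 0 = 0" "err n M = 0"
      using setting_simps(7) boundary_value[OF t_pos[OF n] t_le_T[OF n(2)]] n
      by (auto simp: scheme_error_def L1_scheme_def)
  qed (use h_pos setting_simps(2) n kernel_pos[of _ n] kernel_mono[of _ n] in \<open>auto intro: less_imp_le\<close>)
  also have "grid_norm h M r \<le> sqrt (xr - xl) * (variation_const T \<sigma> K * B + K * h\<^sup>2 / 12)"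
  proof (rule grid_norm_le_uniform)
    show "\<bar>r i\<bar> \<le> variation_const T \<sigma> K * B + K * h\<^sup>2 / 12" if i: "i \<in> {1..<M}" for i
    proof -
      obtain v1 where reg: "time_regular T \<sigma> K (u (gx i)) v1"
        using time_regular_at[of "gx i"] grid_pt_bounds[OF i] by auto
      show ?thesis
        using truncation_error_le[OF reg less_imp_le[OF K] \<sigma> n] space_truncation_le[OF t_pos[OF n] t_le_T[OF n(2)] i]
        unfolding r_def B_def[symmetric] by linarith
    qed
    show "0 \<le> variation_const T \<sigma> K * B + K * h\<^sup>2 / 12"
      using B K variation_const_nonneg[of K] by simp
  qed (use h_pos h_times_M in auto)
  finally show ?thesis by (simp add: B_def)
qed

lemma error_norm_le:
  assumes n: "1 \<le> n" "n \<le> N"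
  shows "grid_norm h M (err n) \<le> error_bound_const (xr - xl) T \<sigma> K * stab_factor \<alpha> \<kappa> \<rho> (t n) *
    (grid_norm h M (err 0) + temporal_error \<sigma> n + t n powr \<alpha> * h\<^sup>2)"
proof -
  define c where "c = sqrt (xr - xl)"
  define L where "L = variation_const T \<sigma> K"
  define y where "y k = grid_norm h M (err k)" for k
  define B where "B = quadrature_bound (local_error \<sigma>)"
  \<comment> \<open>The data accumulated up to level \<open>n\<close>: temporal errors by \<open>P_sum_local_error_le\<close>, and the spatial
    error, constant in time, by \<open>P_sum_omega_le\<close> with \<open>\<beta> = \<alpha>\<close>.\<close>
  define F where "F n = y 0 + 3 * c * L * ((\<rho> + 1) * temporal_error \<sigma> n) + c * K / 6 * (t n powr \<alpha> * h\<^sup>2)" for n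
  have \<sigma>0: "0 < \<sigma>" using \<sigma> by auto
  have nonneg: "0 \<le> c" "0 \<le> L" "0 \<le> y k" for k
    using dom K h_pos by (auto simp: c_def L_def y_def variation_const_nonneg grid_norm_nonneg)
  have loc: "0 \<le> local_error \<sigma> k" for k using \<sigma>0 by (auto simp: local_error_def)
  have "y n \<le> 2 * F n * mittag_leffler \<alpha> (2 * max 1 \<rho> * max \<kappa> 0 * t n powr \<alpha>)"
  proof (rule discrete_fractional_gronwall[where g = "\<lambda>n. c * (L * B n + K * h\<^sup>2 / 12)"])
    fix m assume m: "1 \<le> m" "m \<le> N"
    show "(\<Sum>k=1..m. a m k * (y k - y (k - 1))) \<le> max \<kappa> 0 * y m + c * (L * B m + K * h\<^sup>2 / 12)"
      using error_energy_inequality[OF m] by (simp add: y_def c_def L_def B_def)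
    have "(\<Sum>j=1..m. P m j * omega (1 - \<alpha> + \<alpha>) (t j)) \<le> omega (1 + \<alpha>) (t m)"
      using P_sum_omega_le[OF m(2) \<alpha>(1)] \<alpha> by simp
    also have "(\<Sum>j=1..m. P m j * omega (1 - \<alpha> + \<alpha>) (t j)) = (\<Sum>j=1..m. P m j)"
      using m less_imp_neq[OF t_pos] by (intro sum.cong) (force simp: omega_def)+
    also have "omega (1 + \<alpha>) (t m) \<le> 2 * t m powr \<alpha>"
    proof -
      have "t m powr \<alpha> * (1 / 2) \<le> t m powr \<alpha> * Gamma (1 + \<alpha>)"
        using half_le_Gamma_one_plus[OF \<alpha>] by (intro mult_left_mono) auto
      then show ?thesis using Gamma_real_pos[of "1 + \<alpha>"] \<alpha> by (simp add: omega_def field_simps)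
    qed
    finally have P1: "(\<Sum>j=1..m. P m j) \<le> 2 * t m powr \<alpha>" .
    have "(\<Sum>j=1..m. P m j * B j) \<le> 3 * (\<Sum>k=1..m. P m k * a k k * local_error \<sigma> k)"
      unfolding B_def by (rule P_sum_quadrature_le[OF m(2) loc])
    also have "\<dots> \<le> 3 * ((\<rho> + 1) * temporal_error \<sigma> m)"
      using P_sum_local_error_le[OF m \<sigma>0 setting_simps(3)] setting_simps(1) by simp
    finally have PB: "(\<Sum>j=1..m. P m j * B j) \<le> 3 * ((\<rho> + 1) * temporal_error \<sigma> m)" .
    have "(\<Sum>j=1..m. P m j * (c * (L * B j + K * h\<^sup>2 / 12))) =
        c * L * (\<Sum>j=1..m. P m j * B j) + c * (K * h\<^sup>2 / 12) * (\<Sum>j=1..m. P m j)"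
      by (simp add: sum_distrib_left distrib_left sum.distrib mult_ac)
    also have "\<dots> \<le> c * L * (3 * ((\<rho> + 1) * temporal_error \<sigma> m)) + c * (K * h\<^sup>2 / 12) * (2 * t m powr \<alpha>)"
      using PB P1 nonneg K by (intro add_mono mult_left_mono) auto
    finally show "y 0 + (\<Sum>j=1..m. P m j * (c * (L * B j + K * h\<^sup>2 / 12))) \<le> F m"
      by (simp add: F_def algebra_simps)
    show "0 \<le> F m"
      unfolding F_def using nonneg temporal_error_nonneg[OF \<sigma>0 m(2)] setting_simps(1) K by simp
  next
    fix m n assume "1 \<le> m" "m \<le> n" "n \<le> N"
    then show "F m \<le> F n"
      unfolding F_def using nonneg setting_simps(1) K \<alpha> temporal_error_mono[of m n] t_mono[of m n] t_nonneg[of m]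
      by (intro add_mono mult_left_mono mult_right_mono powr_mono2) auto
  qed (use setting_simps kernel_dominates_reaction nonneg n in auto)
  also have "\<dots> \<le> (2 * F n) * mittag_leffler \<alpha> (4 * max 1 \<rho> * max \<kappa> 0 * t n powr \<alpha>)"
  proof (rule mult_left_mono)
    show "0 \<le> 2 * F n"
      unfolding F_def using nonneg temporal_error_nonneg[OF \<sigma>0 n(2)] setting_simps(1) K by simp
  qed (intro mittag_leffler_mono[OF \<alpha>] mult_right_mono; simp)
  also have "2 * F n \<le> error_bound_const (xr - xl) T \<sigma> K * (\<rho> + 1) * (y 0 + temporal_error \<sigma> n + t n powr \<alpha> * h\<^sup>2)"
  proof -
    define C where "C = error_bound_const (xr - xl) T \<sigma> K"
    have C: "2 \<le> C" "6 * c * L \<le> C" "c * K / 3 \<le> C"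
      using nonneg K by (auto simp: C_def error_bound_const_def c_def L_def)
    have \<rho>: "C \<le> C * (\<rho> + 1)" using C(1) setting_simps(1) by simp
    then have C': "2 \<le> C * (\<rho> + 1)" "c * K / 3 \<le> C * (\<rho> + 1)" using C by linarith+
    have "2 * F n = 2 * y 0 + 6 * c * L * (\<rho> + 1) * temporal_error \<sigma> n + c * K / 3 * (t n powr \<alpha> * h\<^sup>2)"
      by (simp add: F_def algebra_simps)
    also have "\<dots> \<le> C * (\<rho> + 1) * y 0 + C * (\<rho> + 1) * temporal_error \<sigma> n + C * (\<rho> + 1) * (t n powr \<alpha> * h\<^sup>2)"
      using C(2) C' nonneg(3) temporal_error_nonneg[OF \<sigma>0 n(2)] setting_simps(1)
      by (intro add_mono mult_right_mono) auto
    finally show ?thesis by (simp add: C_def algebra_simps)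
  qed
  then have "2 * F n * mittag_leffler \<alpha> (4 * max 1 \<rho> * max \<kappa> 0 * t n powr \<alpha>) \<le>
      error_bound_const (xr - xl) T \<sigma> K * (\<rho> + 1) * (y 0 + temporal_error \<sigma> n + t n powr \<alpha> * h\<^sup>2) *
      mittag_leffler \<alpha> (4 * max 1 \<rho> * max \<kappa> 0 * t n powr \<alpha>)"
    using mittag_leffler_ge_one[OF \<alpha>, of "4 * max 1 \<rho> * max \<kappa> 0 * t n powr \<alpha>"]
    by (intro mult_right_mono) auto
  finally show ?thesis by (simp add: y_def stab_factor_def mult_ac)
qed

end

lemma error_bound_const_ge_two: "0 \<le> l \<Longrightarrow> 0 \<le> K \<Longrightarrow> 2 \<le> error_bound_const l T \<sigma> K"
  by (simp add: error_bound_const_def variation_const_nonneg)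

lemma error_estimateI:
  assumes setting: "l1_setting xl xr T \<kappa> \<sigma> K \<rho> \<alpha> f u0 u M N t U"
    and data: "xl < xr" "0 < T" "0 < K" "\<sigma> \<in> {0<..<1} \<union> {1<..<2}"
    and B: "1 \<le> B"
    and E: "\<And>n. 1 \<le> n \<Longrightarrow> n \<le> N \<Longrightarrow> L1_mesh.temporal_error \<alpha> t \<sigma> n \<le> B * E n"
  shows "error_estimate (error_bound_const (xr - xl) T \<sigma> K * B) xl xr \<kappa> \<rho> \<alpha> u M N t U E"
  unfolding error_estimate_def Let_def
proof
  fix n assume "n \<in> {1..N}"
  then have n: "1 \<le> n" "n \<le> N" by auto
  define h where "h = mesh_width xl xr M"
  define C where "C = error_bound_const (xr - xl) T \<sigma> K"
  define S where "S = stab_factor \<alpha> \<kappa> \<rho> (t n)"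
  define y0 where "y0 = grid_norm h M (scheme_error xl xr u M t U 0)"
  have par: "0 < \<alpha>" "\<alpha> < 1" "0 < \<rho>" using setting by (auto simp: l1_setting_def)
  have S: "0 \<le> S"
    using mittag_leffler_ge_one[OF par(1,2), of "4 * max 1 \<rho> * max \<kappa> 0 * t n powr \<alpha>"] par(3)
    by (simp add: S_def stab_factor_def)
  have C: "0 \<le> C" using error_bound_const_ge_two[of "xr - xl" K T \<sigma>] data by (simp add: C_def)
  have "0 \<le> h" using data by (simp add: h_def mesh_width_def)
  then have y0: "0 \<le> y0" by (simp add: y0_def grid_norm_nonneg)
  have "grid_norm h M (scheme_error xl xr u M t U n) \<le>
      C * S * (y0 + L1_mesh.temporal_error \<alpha> t \<sigma> n + t n powr \<alpha> * h\<^sup>2)"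
    using error_norm_le[OF setting data n] by (simp add: C_def S_def y0_def h_def)
  also have "\<dots> \<le> C * S * (B * y0 + B * E n + B * (t n powr \<alpha> * h\<^sup>2))"
    using C S E[OF n] B y0 mult_right_mono[of 1 B y0] mult_right_mono[of 1 B "t n powr \<alpha> * h\<^sup>2"]
    by (intro mult_left_mono add_mono) auto
  also have "\<dots> = C * B * S * (y0 + E n + t n powr \<alpha> * h\<^sup>2)"
    by (simp add: algebra_simps)
  finally show "grid_norm (mesh_width xl xr M) M (scheme_error xl xr u M t U n) \<le>
      error_bound_const (xr - xl) T \<sigma> K * B * stab_factor \<alpha> \<kappa> \<rho> (t n) *
      (grid_norm (mesh_width xl xr M) M (scheme_error xl xr u M t U 0) + E n + t n powr \<alpha> * (mesh_width xl xr M)\<^sup>2)"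
    by (simp add: C_def S_def y0_def h_def)
qed

section \<open>Graded and quasi-graded meshes\<close>

lemma varsigma_nonneg:
  assumes "1 \<le> x"
  shows "0 \<le> varsigma_L \<alpha> \<sigma> \<gamma> x"
  unfolding varsigma_L_def using assms
  by (auto intro!: divide_nonneg_nonneg powr_le_one_le simp: powr_mono[of _ 0 x, simplified])

text \<open>
  The two factors differ for \<open>\<sigma>\<gamma> > 2 - \<alpha>\<close>, where \<open>1 - exp (- p ln x) \<le> p ln x\<close>.
\<close>

lemma varsigma_le_zeta:
  assumes "1 \<le> x"
  shows "varsigma_L \<alpha> \<sigma> \<gamma> x \<le> zeta_L \<alpha> \<sigma> \<gamma> x"
proof (cases "\<sigma> * \<gamma> > 2 - \<alpha>")
  case True
  define p where "p = \<sigma> * \<gamma> + \<alpha> - 2"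
  have p: "0 < p" using True by (simp add: p_def)
  have "1 - x powr (- p) \<le> p * ln x"
    using exp_ge_add_one_self[of "- p * ln x"] assms by (simp add: powr_def)
  then have "(1 - x powr (2 - \<alpha> - \<sigma> * \<gamma>)) / p \<le> ln x"
    using p by (simp add: field_simps p_def)
  then show ?thesis using True by (simp add: varsigma_L_def zeta_L_def p_def)
qed (simp add: varsigma_L_def zeta_L_def)

text \<open>
  The first summand controls the first step, the second one the remaining sum.
\<close>

definition mesh_const :: "real \<Rightarrow> real \<Rightarrow> real \<Rightarrow> real \<Rightarrow> real" where
  "mesh_const G R C1 D = (D * R) powr (2 * G) + 2 * D ^ 4 * R ^ 3 * (max 1 (1 / C1))\<^sup>2 * G"

lemma powr_le_powr_max:
  fixes x R e b :: real
  assumes "0 < x" "x \<le> R" "1 \<le> R" "0 \<le> e" "e \<le> b"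
  shows "x powr e \<le> R powr b"
proof -
  have "x powr e \<le> R powr e" using assms by (intro powr_mono2) auto
  also have "\<dots> \<le> R powr b" using assms by (intro powr_mono) auto
  finally show ?thesis .
qed

context L1_mesh
begin

text \<open>
  The sum is a lower Riemann sum for \<open>\<integral>x\<^bsup>r-1\<^esup> dx\<close> over \<open>{t 1..t n}\<close> with \<open>r = \<sigma> - (2 - \<alpha>)/\<gamma>\<close>. For \<open>r < 0\<close> the
  integral is governed by \<open>t 1\<close>, of order \<open>\<tau>\<^bsup>\<gamma>\<^esup>\<close> at least, and for \<open>r > 0\<close> by \<open>t n\<close>; taking out the power of
  the dominating end point leaves \<open>\<gamma>\<close> times the factor \<open>varsigma_L\<close> at \<open>(t n / t 1)\<^bsup>1/\<gamma>\<^esup>\<close>.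
\<close>

lemma sum_steps_powr_le:
  assumes n: "1 \<le> n" "n \<le> N" and \<gamma>: "1 \<le> \<gamma>" and s: "\<sigma> - 1 - (2 - \<alpha>) / \<gamma> \<le> 0"
    and \<sigma>: "0 < \<sigma>" "\<sigma> < 2"
    and R: "T \<le> R" "1 \<le> R" and C1: "0 < C1" and \<tau>: "0 < \<tau>" "C1 * \<tau> powr \<gamma> \<le> t 1"
  shows "\<tau> powr (2 - \<alpha>) * (\<Sum>j=2..n. step t j * t j powr (\<sigma> - 1 - (2 - \<alpha>) / \<gamma>)) \<le>
    R\<^sup>2 * (max 1 (1 / C1))\<^sup>2 * \<gamma> * varsigma_L \<alpha> \<sigma> \<gamma> ((t n / t 1) powr (1 / \<gamma>)) * \<tau> powr min (\<sigma> * \<gamma>) (2 - \<alpha>)"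
proof -
  define r where "r = \<sigma> - (2 - \<alpha>) / \<gamma>"
  \<comment> \<open>An antiderivative of \<open>x powr (r - 1)\<close>.\<close>
  define H where "H x = (if r = 0 then ln x else x powr r / r)" for x
  define ns where "ns = (t n / t 1) powr (1 / \<gamma>)"
  define c where "c = (max 1 (1 / C1))\<^sup>2"
  have c: "1 \<le> c" by (simp add: c_def one_le_power)
  have R2: "1 \<le> R\<^sup>2" using R by (simp add: one_le_power)
  have p: "\<gamma> * r = \<sigma> * \<gamma> + \<alpha> - 2" using \<gamma> by (simp add: r_def field_simps)
  have t1: "0 < t 1" "t 1 \<le> t n" "0 < t n" "t n \<le> R"
    using t_pos[of 1] t_mono[of 1 n] t_le_T[of n] n R by auto
  have ns: "1 \<le> ns" unfolding ns_def using t1 \<gamma> by (intro ge_one_powr_ge_zero) auto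
  have ns_p: "ns powr (\<sigma> * \<gamma> + \<alpha> - 2) = (t n / t 1) powr r"
    using \<gamma> unfolding ns_def p[symmetric] by (simp add: powr_powr)
  have H': "(H has_real_derivative x powr (r - 1)) (at x)" if "0 < x" for x
    using that by (cases "r = 0") (auto simp: H_def[abs_def] powr_minus_divide intro!: derivative_eq_intros)
  have piece: "step t j * t j powr (r - 1) \<le> H (t j) - H (t (j - 1))" if j: "j \<in> {2..n}" for j
  proof -
    have tj: "0 < t (j - 1)" "t (j - 1) < t j" using t_pos[of "j - 1"] t_less[of j] j n by auto
    obtain z where z: "t (j - 1) < z" "z < t j" "H (t j) - H (t (j - 1)) = (t j - t (j - 1)) * z powr (r - 1)"
      using MVT2[of "t (j - 1)" "t j" H "\<lambda>x. x powr (r - 1)"] H' tj by auto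
    have "t j powr (r - 1) \<le> z powr (r - 1)"
      using z tj s by (intro powr_mono2') (auto simp: r_def)
    then show ?thesis using z tj by (simp add: step_def mult_left_mono)
  qed
  have "(\<Sum>j=2..n. step t j * t j powr (r - 1)) \<le> (\<Sum>j=2..n. H (t j) - H (t (j - 1)))"
    by (intro sum_mono piece)
  also have "\<dots> = H (t n) - H (t 1)"
    using n(1) by (induction n rule: nat_induct_at_least) (auto simp: numeral_2_eq_2)
  finally have sum_le: "\<tau> powr (2 - \<alpha>) * (\<Sum>j=2..n. step t j * t j powr (r - 1)) \<le> \<tau> powr (2 - \<alpha>) * (H (t n) - H (t 1))"
    by (intro mult_left_mono) auto
  note sum_le
  also have "\<tau> powr (2 - \<alpha>) * (H (t n) - H (t 1)) \<le> R\<^sup>2 * c * (\<gamma> * varsigma_L \<alpha> \<sigma> \<gamma> ns * \<tau> powr min (\<sigma> * \<gamma>) (2 - \<alpha>))"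
  proof -
    have vs: "0 \<le> \<gamma> * varsigma_L \<alpha> \<sigma> \<gamma> ns" using varsigma_nonneg[OF ns] \<gamma> by simp
    have bump: "x * (\<gamma> * varsigma_L \<alpha> \<sigma> \<gamma> ns * \<tau> powr m) \<le> R\<^sup>2 * c * (\<gamma> * varsigma_L \<alpha> \<sigma> \<gamma> ns * \<tau> powr m)"
      if "x \<le> R\<^sup>2 * c" for x m using that vs by (intro mult_right_mono) auto
    have R2c: "R\<^sup>2 \<le> R\<^sup>2 * c" "c \<le> R\<^sup>2 * c" "1 \<le> R\<^sup>2 * c"
      using c R2 mult_mono[of 1 "R\<^sup>2" 1 c] mult_left_mono[of 1 c "R\<^sup>2"] mult_right_mono[of 1 "R\<^sup>2" c] by auto
    consider "r < 0" | "r = 0" | "0 < r" by linarith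
    then show ?thesis
    proof cases
      case 1
      then have lt: "\<sigma> * \<gamma> < 2 - \<alpha>" using p \<gamma> by (smt (verit) mult_pos_neg)
      have "t 1 powr r \<le> (C1 * \<tau> powr \<gamma>) powr r"
        using 1 \<tau> C1 by (intro powr_mono2') auto
      also have "\<dots> = C1 powr r * \<tau> powr (\<sigma> * \<gamma> + \<alpha> - 2)"
        using C1 \<tau> by (simp add: powr_mult powr_powr p)
      also have "C1 powr r \<le> c"
      proof -
        have "C1 powr r = (1 / C1) powr (- r)" using C1 by (simp add: powr_minus powr_divide)
        also have "\<dots> \<le> max 1 (1 / C1) powr 2"
        proof (rule powr_le_powr_max)
          have "(2 - \<alpha>) / \<gamma> \<le> 2 / 1" using \<alpha> \<gamma> by (intro frac_le) auto
          then show "- r \<le> 2" using \<sigma> by (simp add: r_def)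
        qed (use C1 1 in auto)
        finally show ?thesis by (simp add: c_def)
      qed
      finally have t1r: "t 1 powr r \<le> c * \<tau> powr (\<sigma> * \<gamma> + \<alpha> - 2)"
        by (simp add: mult_right_mono)
      have "H (t n) - H (t 1) = t 1 powr r * (\<gamma> * varsigma_L \<alpha> \<sigma> \<gamma> ns)"
      proof -
        have "t n powr r = t 1 powr r * ns powr (\<sigma> * \<gamma> + \<alpha> - 2)"
          unfolding ns_p using t1 by (simp add: powr_divide)
        moreover have "\<gamma> / (2 - \<alpha> - \<sigma> * \<gamma>) = - 1 / r"
        proof -
          have "2 - \<alpha> - \<sigma> * \<gamma> = - (\<gamma> * r)" using p by simp
          then show ?thesis using \<gamma> 1 by (simp add: divide_simps)
        qed
        moreover have "\<gamma> * varsigma_L \<alpha> \<sigma> \<gamma> ns = \<gamma> / (2 - \<alpha> - \<sigma> * \<gamma>) * (1 - ns powr (\<sigma> * \<gamma> + \<alpha> - 2))"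
          using lt by (simp add: varsigma_L_def)
        ultimately have "t n powr r = t 1 powr r * ns powr (\<sigma> * \<gamma> + \<alpha> - 2)"
          "\<gamma> * varsigma_L \<alpha> \<sigma> \<gamma> ns = - 1 / r * (1 - ns powr (\<sigma> * \<gamma> + \<alpha> - 2))"
          by (simp_all only:)
        then show ?thesis using 1 by (simp add: H_def right_diff_distrib diff_divide_distrib)
      qed
      then have "\<tau> powr (2 - \<alpha>) * (H (t n) - H (t 1)) \<le>
          \<tau> powr (2 - \<alpha>) * (c * \<tau> powr (\<sigma> * \<gamma> + \<alpha> - 2) * (\<gamma> * varsigma_L \<alpha> \<sigma> \<gamma> ns))"
        using t1r vs by (auto intro!: mult_left_mono mult_right_mono)
      also have "\<tau> powr (2 - \<alpha>) * (c * \<tau> powr (\<sigma> * \<gamma> + \<alpha> - 2) * (\<gamma> * varsigma_L \<alpha> \<sigma> \<gamma> ns)) =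
          c * (\<gamma> * varsigma_L \<alpha> \<sigma> \<gamma> ns * (\<tau> powr (2 - \<alpha>) * \<tau> powr (\<sigma> * \<gamma> + \<alpha> - 2)))"
        by (simp only: mult_ac)
      also have "\<tau> powr (2 - \<alpha>) * \<tau> powr (\<sigma> * \<gamma> + \<alpha> - 2) = \<tau> powr min (\<sigma> * \<gamma>) (2 - \<alpha>)"
        using lt by (simp flip: powr_add)
      finally show ?thesis using bump[OF R2c(2)] by (rule order_trans)
    next
      case 2
      then have eq: "\<sigma> * \<gamma> = 2 - \<alpha>" using p by simp
      have "H (t n) - H (t 1) = \<gamma> * varsigma_L \<alpha> \<sigma> \<gamma> ns"
        using 2 eq t1 \<gamma> by (simp add: H_def varsigma_L_def ns_def ln_powr ln_div)
      then show ?thesis using bump[OF R2c(3), of "2 - \<alpha>"] eq by (simp add: mult_ac)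
    next
      case 3
      then have gt: "2 - \<alpha> < \<sigma> * \<gamma>" using p \<gamma> by (smt (verit) mult_pos_pos)
      have "H (t n) - H (t 1) = t n powr r * (\<gamma> * varsigma_L \<alpha> \<sigma> \<gamma> ns)"
      proof -
        have "ns powr (2 - \<alpha> - \<sigma> * \<gamma>) = inverse (ns powr (\<sigma> * \<gamma> + \<alpha> - 2))"
          using powr_minus[of ns "\<sigma> * \<gamma> + \<alpha> - 2"] by (simp add: algebra_simps)
        also have "\<dots> = t 1 powr r / t n powr r"
          unfolding ns_p using t1 by (simp add: powr_divide)
        finally have "t 1 powr r = t n powr r * ns powr (2 - \<alpha> - \<sigma> * \<gamma>)" using t1 by simp
        moreover have "\<gamma> / (\<sigma> * \<gamma> + \<alpha> - 2) = 1 / r"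
          unfolding p[symmetric] using \<gamma> 3 by simp
        moreover have "\<gamma> * varsigma_L \<alpha> \<sigma> \<gamma> ns = \<gamma> / (\<sigma> * \<gamma> + \<alpha> - 2) * (1 - ns powr (2 - \<alpha> - \<sigma> * \<gamma>))"
          using gt by (simp add: varsigma_L_def)
        ultimately have "t 1 powr r = t n powr r * ns powr (2 - \<alpha> - \<sigma> * \<gamma>)"
          "\<gamma> * varsigma_L \<alpha> \<sigma> \<gamma> ns = 1 / r * (1 - ns powr (2 - \<alpha> - \<sigma> * \<gamma>))"
          by (simp_all only:)
        then show ?thesis using 3 by (simp add: H_def right_diff_distrib diff_divide_distrib)
      qed
      moreover have "t n powr r \<le> R powr 2"
        using t1 R 3 \<sigma> \<gamma> \<alpha> by (intro powr_le_powr_max) (auto simp: r_def intro: order_trans[of _ \<sigma>])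
      then have "t n powr r \<le> R\<^sup>2" using R by simp
      then have "t n powr r \<le> R\<^sup>2 * c" using R2c(1) by (rule order_trans)
      ultimately show ?thesis using bump[of "t n powr r" "2 - \<alpha>"] gt by (simp add: mult_ac)
    qed
  qed
  finally have "\<tau> powr (2 - \<alpha>) * (\<Sum>j=2..n. step t j * t j powr (r - 1)) \<le>
    R\<^sup>2 * c * (\<gamma> * varsigma_L \<alpha> \<sigma> \<gamma> ns * \<tau> powr min (\<sigma> * \<gamma>) (2 - \<alpha>))" .
  moreover have "r - 1 = \<sigma> - 1 - (2 - \<alpha>) / \<gamma>" by (simp add: r_def)
  ultimately show ?thesis
    unfolding c_def ns_def by (simp only: mult_ac)
qed

text \<open>
  The mesh conditions bound \<open>mesh_weight \<sigma> k\<close> by a multiple of \<open>\<tau>\<^bsup>2-\<alpha>\<^esup> t\<^sub>k\<^bsup>s\<^esup>\<close> with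
  \<open>s = \<sigma> - 1 - (2 - \<alpha>)/\<gamma>\<close>. For \<open>s \<le> 0\<close> this bound decreases in \<open>k\<close>, so the maximum over
  \<open>k \<ge> j\<close> is bounded by the value at \<open>j\<close> and \<open>sum_steps_powr_le\<close> applies. For \<open>s > 0\<close>, possible for \<open>\<sigma> > 1\<close> only, the weights are bounded by a
  multiple of \<open>\<tau>\<^bsup>2-\<alpha>\<^esup>\<close> and the order is \<open>2 - \<alpha>\<close> without a further factor.
\<close>

lemma temporal_error_le_mesh:
  assumes n: "1 \<le> n" "n \<le> N" and \<gamma>: "1 \<le> \<gamma>" "\<gamma> \<le> G" and \<sigma>: "0 < \<sigma>" "\<sigma> < 2"
    and R: "T \<le> R" "1 \<le> R" and C1: "0 < C1" and \<tau>: "0 < \<tau>" "\<tau> \<le> R" "C1 * \<tau> powr \<gamma> \<le> t 1"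
    and D: "1 \<le> D" and steps: "\<And>k. 1 \<le> k \<Longrightarrow> k \<le> N \<Longrightarrow> step t k \<le> D * \<tau> * t k powr (1 - 1 / \<gamma>)"
    and ratio: "\<And>k. 2 \<le> k \<Longrightarrow> k \<le> N \<Longrightarrow> t k \<le> D * t (k - 1)"
  shows "temporal_error \<sigma> n \<le> mesh_const G R C1 D *
    (1 / \<sigma> + (if \<gamma> * (\<sigma> - 1) \<le> 2 - \<alpha> then varsigma_L \<alpha> \<sigma> \<gamma> ((t n / t 1) powr (1 / \<gamma>)) else 0)) *
    \<tau> powr min (\<sigma> * \<gamma>) (2 - \<alpha>)"
proof -
  define m where "m = min (\<sigma> * \<gamma>) (2 - \<alpha>)"
  define s where "s = \<sigma> - 1 - (2 - \<alpha>) / \<gamma>"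
  define \<Psi> where "\<Psi> = (if \<gamma> * (\<sigma> - 1) \<le> 2 - \<alpha> then varsigma_L \<alpha> \<sigma> \<gamma> ((t n / t 1) powr (1 / \<gamma>)) else 0)"
  have t1: "0 < t 1" "step t 1 = t 1" "t 1 \<le> t n" "0 < t n" "t n \<le> R"
    using t_pos[of 1] t_mono[of 1 n] t_le_T[of n] n R t0 by (auto simp: step_def)
  have ns: "1 \<le> (t n / t 1) powr (1 / \<gamma>)" using t1 \<gamma> by (intro ge_one_powr_ge_zero) auto
  have \<Psi>: "0 \<le> \<Psi>" using varsigma_nonneg[OF ns] by (simp add: \<Psi>_def)
  have s_iff: "s \<le> 0 \<longleftrightarrow> \<gamma> * (\<sigma> - 1) \<le> 2 - \<alpha>" using \<gamma> by (simp add: s_def field_simps)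
  have first: "step t 1 powr \<sigma> / \<sigma> \<le> (D * R) powr (2 * G) * (1 / \<sigma>) * \<tau> powr m"
  proof -
    have "t 1 powr (1 / \<gamma>) * t 1 powr (1 - 1 / \<gamma>) \<le> D * \<tau> * t 1 powr (1 - 1 / \<gamma>)"
      using steps[of 1] t1 n by (simp flip: powr_add)
    then have "t 1 powr (1 / \<gamma>) \<le> D * \<tau>" using t1 by simp
    then have "(t 1 powr (1 / \<gamma>)) powr (\<sigma> * \<gamma>) \<le> (D * \<tau>) powr (\<sigma> * \<gamma>)"
      using \<sigma> \<gamma> by (intro powr_mono2) auto
    then have "t 1 powr \<sigma> \<le> D powr (\<sigma> * \<gamma>) * \<tau> powr (\<sigma> * \<gamma>)"
      using t1 \<gamma> D \<tau> by (simp add: powr_powr powr_mult)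
    also have "\<tau> powr (\<sigma> * \<gamma>) = \<tau> powr (\<sigma> * \<gamma> - m) * \<tau> powr m"
      by (simp flip: powr_add)
    also have "D powr (\<sigma> * \<gamma>) * (\<tau> powr (\<sigma> * \<gamma> - m) * \<tau> powr m) \<le> D powr (2 * G) * (R powr (2 * G) * \<tau> powr m)"
    proof -
      have le: "\<sigma> * \<gamma> \<le> 2 * G" using \<sigma> \<gamma> by (intro mult_mono) auto
      have "0 \<le> m" "m \<le> \<sigma> * \<gamma>" using \<sigma> \<gamma> \<alpha> by (auto simp: m_def)
      then have "\<tau> powr (\<sigma> * \<gamma> - m) \<le> R powr (2 * G)" "D powr (\<sigma> * \<gamma>) \<le> D powr (2 * G)"
        using le D R \<tau> by (auto intro: powr_le_powr_max powr_mono)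
      then show ?thesis by (intro mult_mono order_refl) auto
    qed
    finally have "t 1 powr \<sigma> \<le> (D * R) powr (2 * G) * \<tau> powr m"
      using D R by (simp add: powr_mult mult.assoc)
    then have "t 1 powr \<sigma> / \<sigma> \<le> (D * R) powr (2 * G) * \<tau> powr m / \<sigma>"
      using \<sigma> by (intro divide_right_mono) auto
    then show ?thesis using t1 by simp
  qed
  have weight: "mesh_weight \<sigma> k \<le> D ^ 4 * \<tau> powr (2 - \<alpha>) * t k powr s" if k: "2 \<le> k" "k \<le> N" for k
  proof -
    have tk: "0 < t (k - 1)" "0 < t k" "0 < step t k"
      using t_pos[of "k - 1"] t_pos[of k] step_pos[of k] k by auto
    have "t (k - 1) powr (\<sigma> - 2) \<le> (t k / D) powr (\<sigma> - 2)"
      using ratio[OF k] tk D \<sigma> by (intro powr_mono2') (auto simp: field_simps)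
    also have "\<dots> = D powr (2 - \<sigma>) * t k powr (\<sigma> - 2)"
      using tk D powr_minus_divide[of D "2 - \<sigma>"] by (simp add: powr_divide)
    also have "\<dots> \<le> D powr 2 * t k powr (\<sigma> - 2)"
      using D \<sigma> by (intro mult_right_mono powr_mono) auto
    finally have A: "t (k - 1) powr (\<sigma> - 2) \<le> D\<^sup>2 * t k powr (\<sigma> - 2)" using D by simp
    have "step t k powr (2 - \<alpha>) \<le> (D * \<tau> * t k powr (1 - 1 / \<gamma>)) powr (2 - \<alpha>)"
      using steps[of k] k tk \<alpha> by (intro powr_mono2) auto
    also have "\<dots> = D powr (2 - \<alpha>) * (\<tau> powr (2 - \<alpha>) * t k powr ((1 - 1 / \<gamma>) * (2 - \<alpha>)))"
      using D \<tau> tk by (simp add: powr_mult powr_powr)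
    also have "\<dots> \<le> D powr 2 * (\<tau> powr (2 - \<alpha>) * t k powr ((1 - 1 / \<gamma>) * (2 - \<alpha>)))"
      using D \<alpha> by (intro mult_right_mono powr_mono) auto
    finally have B: "step t k powr (2 - \<alpha>) \<le> D\<^sup>2 * (\<tau> powr (2 - \<alpha>) * t k powr ((1 - 1 / \<gamma>) * (2 - \<alpha>)))"
      using D by simp
    have "mesh_weight \<sigma> k \<le> (D\<^sup>2 * t k powr (\<sigma> - 2)) * t k powr (\<alpha> - 1) * (D\<^sup>2 * (\<tau> powr (2 - \<alpha>) * t k powr ((1 - 1 / \<gamma>) * (2 - \<alpha>))))"
      unfolding mesh_weight_def using A B by (intro mult_mono) auto
    also have "\<dots> = (D\<^sup>2 * D\<^sup>2) * \<tau> powr (2 - \<alpha>) * (t k powr (\<sigma> - 2) * t k powr (\<alpha> - 1) * t k powr ((1 - 1 / \<gamma>) * (2 - \<alpha>)))"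
      by (simp only: mult_ac)
    also have "D\<^sup>2 * D\<^sup>2 = D ^ 4" by (simp flip: power_add)
    also have "t k powr (\<sigma> - 2) * t k powr (\<alpha> - 1) * t k powr ((1 - 1 / \<gamma>) * (2 - \<alpha>)) = t k powr s"
      using \<gamma> by (simp add: s_def algebra_simps diff_divide_distrib flip: powr_add)
    finally show ?thesis .
  qed
  have D4: "0 \<le> D ^ 4 * \<tau> powr (2 - \<alpha>)" using D by simp
  have rest: "(\<Sum>j=2..n. step t j * (MAX k\<in>{j..n}. mesh_weight \<sigma> k)) \<le>
      2 * D ^ 4 * R ^ 3 * (max 1 (1 / C1))\<^sup>2 * G * (1 / \<sigma> + \<Psi>) * \<tau> powr m"
  proof (cases "s \<le> 0")
    case True
    have "(\<Sum>j=2..n. step t j * (MAX k\<in>{j..n}. mesh_weight \<sigma> k)) \<le> (\<Sum>j=2..n. step t j * (D ^ 4 * \<tau> powr (2 - \<alpha>) * t j powr s))"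
    proof (intro sum_mono mult_left_mono)
      fix j assume j: "j \<in> {2..n}"
      have "mesh_weight \<sigma> k \<le> D ^ 4 * \<tau> powr (2 - \<alpha>) * t j powr s" if "k \<in> {j..n}" for k
      proof -
        have "t k powr s \<le> t j powr s"
          using True t_pos[of j] t_mono[of j k] that j n by (intro powr_mono2') auto
        then show ?thesis using weight[of k] that j n mult_left_mono[OF _ D4] by (auto intro: order_trans)
      qed
      then show "(MAX k\<in>{j..n}. mesh_weight \<sigma> k) \<le> D ^ 4 * \<tau> powr (2 - \<alpha>) * t j powr s"
        using j by (intro Max.boundedI) auto
    qed (use step_pos n in \<open>auto intro: less_imp_le\<close>)
    also have "\<dots> = D ^ 4 * (\<tau> powr (2 - \<alpha>) * (\<Sum>j=2..n. step t j * t j powr s))"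
      by (simp add: sum_distrib_left mult_ac)
    also have "\<dots> \<le> D ^ 4 * (R\<^sup>2 * (max 1 (1 / C1))\<^sup>2 * \<gamma> * \<Psi> * \<tau> powr m)"
      using sum_steps_powr_le[OF n \<gamma>(1) _ \<sigma> R C1 \<tau>(1,3)] True s_iff D
      unfolding s_def[symmetric] m_def \<Psi>_def by (intro mult_left_mono) auto
    also have "\<dots> = (D ^ 4 * R\<^sup>2 * (max 1 (1 / C1))\<^sup>2 * \<gamma>) * (\<Psi> * \<tau> powr m)" by (simp only: mult_ac)
    also have "\<dots> \<le> (2 * D ^ 4 * R ^ 3 * (max 1 (1 / C1))\<^sup>2 * G) * ((1 / \<sigma> + \<Psi>) * \<tau> powr m)"
    proof (rule mult_mono)
      have "R\<^sup>2 \<le> R ^ 3" using R by (intro power_increasing) auto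
      then have "D ^ 4 * R\<^sup>2 * (max 1 (1 / C1))\<^sup>2 * \<gamma> \<le> (2 * D ^ 4) * R ^ 3 * (max 1 (1 / C1))\<^sup>2 * G"
        using D \<gamma> R by (intro mult_mono mult_nonneg_nonneg) auto
      then show "D ^ 4 * R\<^sup>2 * (max 1 (1 / C1))\<^sup>2 * \<gamma> \<le> 2 * D ^ 4 * R ^ 3 * (max 1 (1 / C1))\<^sup>2 * G" .
      show "\<Psi> * \<tau> powr m \<le> (1 / \<sigma> + \<Psi>) * \<tau> powr m" using \<sigma> by (intro mult_right_mono) auto
    qed (use D R \<gamma> \<Psi> in auto)
    finally show ?thesis by (simp only: mult.assoc)
  next
    case False
    then have m: "m = 2 - \<alpha>"
      using s_iff \<gamma> by (simp add: m_def algebra_simps)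
    have s1: "0 \<le> s" "s \<le> 2" using False \<sigma> \<alpha> \<gamma> by (auto simp: s_def intro: order_trans[of _ \<sigma>])
    have "(\<Sum>j=2..n. step t j * (MAX k\<in>{j..n}. mesh_weight \<sigma> k)) \<le> (\<Sum>j=2..n. step t j * (D ^ 4 * \<tau> powr (2 - \<alpha>) * R\<^sup>2))"
    proof (intro sum_mono mult_left_mono)
      fix j assume j: "j \<in> {2..n}"
      have "mesh_weight \<sigma> k \<le> D ^ 4 * \<tau> powr (2 - \<alpha>) * R\<^sup>2" if "k \<in> {j..n}" for k
      proof -
        have "t k powr s \<le> R powr 2"
          using s1 R t_pos[of k] t_le_T[of k] that j n by (intro powr_le_powr_max) auto
        then have "t k powr s \<le> R\<^sup>2" using R by simp
        then show ?thesis using weight[of k] that j n mult_left_mono[OF _ D4] by (auto intro: order_trans)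
      qed
      then show "(MAX k\<in>{j..n}. mesh_weight \<sigma> k) \<le> D ^ 4 * \<tau> powr (2 - \<alpha>) * R\<^sup>2"
        using j by (intro Max.boundedI) auto
    qed (use step_pos n in \<open>auto intro: less_imp_le\<close>)
    also have "\<dots> = (\<Sum>j=2..n. step t j) * (D ^ 4 * \<tau> powr (2 - \<alpha>) * R\<^sup>2)"
      by (rule sum_distrib_right[symmetric])
    also have "(\<Sum>j=2..n. step t j) \<le> R"
    proof -
      have "(\<Sum>j=2..n. step t j) \<le> (\<Sum>j=1..n. step t j)"
        using step_pos n by (intro sum_mono2) (auto intro: less_imp_le)
      also have "\<dots> = t n" using sum_increments[of t n] t0 by (simp add: step_def)
      finally show ?thesis using t1 by simp
    qed
    then have "(\<Sum>j=2..n. step t j) * (D ^ 4 * \<tau> powr (2 - \<alpha>) * R\<^sup>2) \<le> R * (D ^ 4 * \<tau> powr (2 - \<alpha>) * R\<^sup>2)"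
      using D4 by (intro mult_right_mono) auto
    also have "\<dots> = D ^ 4 * R ^ 3 * 1 * 1 * (1 * \<tau> powr m)"
      by (simp add: m power2_eq_square power3_eq_cube mult_ac)
    also have "\<dots> \<le> D ^ 4 * R ^ 3 * (max 1 (1 / C1))\<^sup>2 * G * (2 * (1 / \<sigma> + \<Psi>) * \<tau> powr m)"
    proof (intro mult_mono mult_nonneg_nonneg)
      have "1 \<le> 2 * (1 / \<sigma>)" using \<sigma> by simp
      also have "\<dots> \<le> 2 * (1 / \<sigma> + \<Psi>)" using \<Psi> by simp
      finally show "1 \<le> 2 * (1 / \<sigma> + \<Psi>)" .
    qed (use D R \<gamma> \<Psi> \<sigma> in \<open>auto intro: one_le_power\<close>)
    finally show ?thesis by (simp only: mult_ac)
  qed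
  have "temporal_error \<sigma> n \<le> (D * R) powr (2 * G) * (1 / \<sigma>) * \<tau> powr m +
      2 * D ^ 4 * R ^ 3 * (max 1 (1 / C1))\<^sup>2 * G * (1 / \<sigma> + \<Psi>) * \<tau> powr m"
    unfolding temporal_error_def using first rest by (rule add_mono)
  also have "\<dots> \<le> (D * R) powr (2 * G) * (1 / \<sigma> + \<Psi>) * \<tau> powr m +
      2 * D ^ 4 * R ^ 3 * (max 1 (1 / C1))\<^sup>2 * G * (1 / \<sigma> + \<Psi>) * \<tau> powr m"
    using \<Psi> by (intro add_mono order_refl mult_right_mono mult_left_mono) auto
  also have "\<dots> = mesh_const G R C1 D * (1 / \<sigma> + \<Psi>) * \<tau> powr m"
    by (simp only: mesh_const_def distrib_right)
  finally show ?thesis by (simp only: \<Psi>_def m_def)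
qed

end

text \<open>
  For \<open>\<sigma> < 1\<close> the condition holds because its left-hand side is nonpositive; for \<open>\<sigma> > 1\<close> both
  branches are at most the factor \<open>zeta_L\<close>.
\<close>

lemma mesh_factor_le_chi:
  assumes "0 < \<alpha>" "\<alpha> < 1" "\<sigma> \<in> {0<..<1} \<union> {1<..<2}" "1 \<le> \<gamma>" "1 \<le> x"
  shows "(if \<gamma> * (\<sigma> - 1) \<le> 2 - \<alpha> then varsigma_L \<alpha> \<sigma> \<gamma> x else 0) \<le> chi_L \<alpha> \<sigma> \<gamma> x"
proof (cases "\<sigma> < 1")
  case True
  have "\<gamma> * (\<sigma> - 1) \<le> 0" using True assms by (intro mult_nonneg_nonpos) auto
  then show ?thesis using True assms by (simp add: chi_L_def)
next
  case False
  then show ?thesis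
    using varsigma_nonneg[OF assms(5), of \<alpha> \<sigma> \<gamma>] varsigma_le_zeta[OF assms(5), of \<alpha> \<sigma> \<gamma>] by (auto simp: chi_L_def)
qed

lemma n_star_ge_one:
  assumes "L1_mesh \<alpha> T N t" "1 \<le> n" "n \<le> N" "1 \<le> \<gamma>"
  shows "1 \<le> n_star \<gamma> t n"
proof -
  interpret L1_mesh \<alpha> T N t by fact
  have "0 < t 1" "t 1 \<le> t n" "step t 1 = t 1"
    using t_pos[of 1] t_mono[of 1 n] t0 assms by (auto simp: step_def)
  then show ?thesis unfolding n_star_def using assms by (intro ge_one_powr_ge_zero) auto
qed

lemma setting_L1_mesh: "l1_setting xl xr T \<kappa> \<sigma> K \<rho> \<alpha> f u0 u M N t U \<Longrightarrow> L1_mesh \<alpha> T N t"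
  by (auto simp: l1_setting_def L1_mesh_def)

lemma error_estimate_M1:
  assumes setting: "l1_setting xl xr T \<kappa> \<sigma> K \<rho> \<alpha> f u0 u M N t U"
    and data: "xl < xr" "0 < T" "0 < K" "\<sigma> \<in> {0<..<1} \<union> {1<..<2}"
    and \<gamma>: "1 \<le> \<gamma>" "\<gamma> \<le> G" and C1: "0 < C1" and M1: "mesh_M1 \<gamma> C1 C\<gamma> N t"
  shows "error_estimate (error_bound_const (xr - xl) T \<sigma> K * max 1 (mesh_const G (max 1 T) C1 (max 1 C\<gamma>)))
    xl xr \<kappa> \<rho> \<alpha> u M N t U
    (\<lambda>n. (1 / \<sigma> + chi_L \<alpha> \<sigma> \<gamma> (n_star \<gamma> t n)) * max_step N t powr min (\<sigma> * \<gamma>) (2 - \<alpha>))"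
proof (rule error_estimateI[OF setting data])
  interpret L1_mesh \<alpha> T N t by (rule setting_L1_mesh[OF setting])
  define \<tau> where "\<tau> = max_step N t"
  define D where "D = max 1 C\<gamma>"
  fix n assume n: "1 \<le> n" "n \<le> N"
  have ns: "1 \<le> n_star \<gamma> t n" by (rule n_star_ge_one[OF L1_mesh_axioms n \<gamma>(1)])
  have step1: "step t 1 = t 1" using t0 by (simp add: step_def)
  have le_\<tau>: "step t k \<le> \<tau>" if "1 \<le> k" "k \<le> N" for k
    unfolding \<tau>_def max_step_def using that by (intro Max_ge) auto
  have \<tau>: "0 < \<tau>" using le_\<tau>[of n] step_pos[of n] n by simp
  have "\<tau> \<le> T"
    unfolding \<tau>_def max_step_def
  proof (intro Max.boundedI)
    show "b \<le> T" if "b \<in> step t ` {1..N}" for b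
      using that t_le_T t_pred_nonneg by (force simp: step_def)
  qed (use n in auto)
  have "temporal_error \<sigma> n \<le> mesh_const G (max 1 T) C1 D *
    (1 / \<sigma> + (if \<gamma> * (\<sigma> - 1) \<le> 2 - \<alpha> then varsigma_L \<alpha> \<sigma> \<gamma> ((t n / t 1) powr (1 / \<gamma>)) else 0)) *
    \<tau> powr min (\<sigma> * \<gamma>) (2 - \<alpha>)"
  proof (rule temporal_error_le_mesh[OF n \<gamma>])
    have "C1 * \<tau> powr \<gamma> \<le> step t 1" using M1 unfolding mesh_M1_def \<tau>_def by blast
    then show "C1 * \<tau> powr \<gamma> \<le> t 1" unfolding step1 .
    show "step t k \<le> D * \<tau> * t k powr (1 - 1 / \<gamma>)" if k: "1 \<le> k" "k \<le> N" for k
    proof -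
      have "step t k \<le> C\<gamma> * \<tau> * min 1 (t k powr (1 - 1 / \<gamma>))"
        using M1 k by (auto simp: mesh_M1_def \<tau>_def)
      also have "\<dots> \<le> D * \<tau> * min 1 (t k powr (1 - 1 / \<gamma>))"
        using \<tau> by (intro mult_right_mono) (auto simp: D_def)
      also have "\<dots> \<le> D * \<tau> * t k powr (1 - 1 / \<gamma>)"
        using \<tau> by (intro mult_left_mono) (auto simp: D_def)
      finally show ?thesis .
    qed
    show "t k \<le> D * t (k - 1)" if k: "2 \<le> k" "k \<le> N" for k
    proof -
      have "t k \<le> C\<gamma> * t (k - 1)" using M1 k by (auto simp: mesh_M1_def)
      also have "\<dots> \<le> D * t (k - 1)" using t_pred_nonneg[of k] k by (intro mult_right_mono) (auto simp: D_def)
      finally show ?thesis .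
    qed
  qed (use data C1 \<tau> \<open>\<tau> \<le> T\<close> in \<open>auto simp: D_def\<close>)
  also have "(t n / t 1) powr (1 / \<gamma>) = n_star \<gamma> t n" unfolding n_star_def step1 ..
  also have "mesh_const G (max 1 T) C1 D *
      (1 / \<sigma> + (if \<gamma> * (\<sigma> - 1) \<le> 2 - \<alpha> then varsigma_L \<alpha> \<sigma> \<gamma> (n_star \<gamma> t n) else 0)) * \<tau> powr min (\<sigma> * \<gamma>) (2 - \<alpha>) \<le>
      max 1 (mesh_const G (max 1 T) C1 D) * (1 / \<sigma> + chi_L \<alpha> \<sigma> \<gamma> (n_star \<gamma> t n)) * \<tau> powr min (\<sigma> * \<gamma>) (2 - \<alpha>)"
    using mesh_factor_le_chi[OF \<alpha> data(4) \<gamma>(1) ns] varsigma_nonneg[OF ns, of \<alpha> \<sigma> \<gamma>] data(4)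
    by (intro mult_right_mono mult_mono) (auto intro!: add_nonneg_nonneg)
  finally show "temporal_error \<sigma> n \<le> max 1 (mesh_const G (max 1 T) C1 (max 1 C\<gamma>)) *
      ((1 / \<sigma> + chi_L \<alpha> \<sigma> \<gamma> (n_star \<gamma> t n)) * max_step N t powr min (\<sigma> * \<gamma>) (2 - \<alpha>))"
    by (simp only: D_def \<tau>_def mult.assoc)
qed simp

lemma powr_increment_le:
  fixes x y \<gamma> :: real
  assumes "0 \<le> y" "y < x" "1 \<le> \<gamma>"
  shows "x powr \<gamma> - y powr \<gamma> \<le> \<gamma> * x powr (\<gamma> - 1) * (x - y)"
proof (cases "y = 0")
  case True
  have "x powr \<gamma> = x powr (\<gamma> - 1) * x" using assms powr_add[of x "\<gamma> - 1" 1] by simp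
  also have "\<dots> \<le> \<gamma> * (x powr (\<gamma> - 1) * x)" using assms mult_right_mono[of 1 \<gamma> "x powr (\<gamma> - 1) * x"] by simp
  finally show ?thesis using True by simp
next
  case False
  then obtain z where z: "y < z" "z < x" "x powr \<gamma> - y powr \<gamma> = (x - y) * (\<gamma> * z powr (\<gamma> - 1))"
    using MVT2[of y x "\<lambda>x. x powr \<gamma>" "\<lambda>x. \<gamma> * x powr (\<gamma> - 1)"] assms by (force intro!: derivative_eq_intros)
  moreover have "z powr (\<gamma> - 1) \<le> x powr (\<gamma> - 1)" using z assms by (intro powr_mono2) auto
  ultimately show ?thesis using assms by (simp add: mult_left_mono mult_ac)
qed

text \<open>
  The graded mesh satisfies the hypotheses of \<open>temporal_error_le_mesh\<close> with \<open>\<tau> = 1/N\<close> and \<open>C1 = T\<close>, and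
  \<open>(t n / t 1)\<^bsup>1/\<gamma>\<^esup>\<close> is exactly \<open>n\<close>. The bound \<open>t k \<le> 2\<^sup>G t (k - 1)\<close> uses \<open>k \<le> 2 (k - 1)\<close> for \<open>k \<ge> 2\<close>.
\<close>

lemma temporal_error_graded_le:
  assumes mesh: "L1_mesh \<alpha> T N t" and T: "0 < T" and \<sigma>: "0 < \<sigma>" "\<sigma> < 2"
    and \<gamma>: "1 \<le> \<gamma>" "\<gamma> \<le> G" and graded: "graded_mesh \<gamma> T N t" and n: "1 \<le> n" "n \<le> N"
  shows "L1_mesh.temporal_error \<alpha> t \<sigma> n \<le> mesh_const G (max 1 T) T (max (G * max 1 T) (2 powr G)) *
    (1 / \<sigma> + (if \<gamma> * (\<sigma> - 1) \<le> 2 - \<alpha> then varsigma_L \<alpha> \<sigma> \<gamma> (real n) else 0)) *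
    real N powr (- min (\<sigma> * \<gamma>) (2 - \<alpha>))"
proof -
  interpret L1_mesh \<alpha> T N t by fact
  define R where "R = max 1 T"
  define D where "D = max (G * R) (2 powr G)"
  have N: "1 \<le> real N" using n by simp
  have t_eq: "t k = T * (real k / real N) powr \<gamma>" if "k \<le> N" for k
    using graded that by (simp add: graded_mesh_def)
  have "2 powr 0 \<le> (2::real) powr G" using \<gamma> by (intro powr_mono) auto
  then have D: "1 \<le> D" by (simp add: D_def)
  have "temporal_error \<sigma> n \<le> mesh_const G R T D *
    (1 / \<sigma> + (if \<gamma> * (\<sigma> - 1) \<le> 2 - \<alpha> then varsigma_L \<alpha> \<sigma> \<gamma> ((t n / t 1) powr (1 / \<gamma>)) else 0)) *
    (1 / real N) powr min (\<sigma> * \<gamma>) (2 - \<alpha>)"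
  proof (rule temporal_error_le_mesh[OF n \<gamma> \<sigma>])
    show "T * (1 / real N) powr \<gamma> \<le> t 1" using t_eq[of 1] n by simp
    have "1 / real N \<le> 1" using N by simp
    then show "1 / real N \<le> R" by (simp add: R_def)
    show "step t k \<le> D * (1 / real N) * t k powr (1 - 1 / \<gamma>)" if k: "1 \<le> k" "k \<le> N" for k
    proof -
      define x where "x = real k / real N"
      have x: "0 < x" using k N by (simp add: x_def)
      have y: "real (k - 1) / real N = x - 1 / real N" "0 \<le> x - 1 / real N"
        using k N by (auto simp: x_def of_nat_diff field_simps)
      have "step t k = T * (x powr \<gamma> - (x - 1 / real N) powr \<gamma>)"
      proof -
        have "t k = T * x powr \<gamma>" unfolding x_def by (rule t_eq) (use k in simp)
        moreover have "t (k - 1) = T * (x - 1 / real N) powr \<gamma>"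
          unfolding y(1)[symmetric] by (rule t_eq) (use k in simp)
        ultimately show ?thesis by (simp only: step_def right_diff_distrib)
      qed
      also have "\<dots> \<le> T * (\<gamma> * x powr (\<gamma> - 1) * (x - (x - 1 / real N)))"
        using T y N \<gamma> by (intro mult_left_mono powr_increment_le) auto
      also have "T = T powr (1 / \<gamma>) * T powr (1 - 1 / \<gamma>)"
        using T by (simp flip: powr_add)
      also have "T powr (1 / \<gamma>) * T powr (1 - 1 / \<gamma>) * (\<gamma> * x powr (\<gamma> - 1) * (x - (x - 1 / real N))) =
          (\<gamma> * T powr (1 / \<gamma>)) * (1 / real N) * (T powr (1 - 1 / \<gamma>) * x powr (\<gamma> - 1))"
        by simp
      also have "T powr (1 - 1 / \<gamma>) * x powr (\<gamma> - 1) = t k powr (1 - 1 / \<gamma>)"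
        using t_eq[of k] k T x \<gamma> by (simp add: powr_mult powr_powr x_def[symmetric] right_diff_distrib)
      also have "(\<gamma> * T powr (1 / \<gamma>)) * (1 / real N) * t k powr (1 - 1 / \<gamma>) \<le> D * (1 / real N) * t k powr (1 - 1 / \<gamma>)"
      proof (intro mult_right_mono)
        have "T powr (1 / \<gamma>) \<le> R powr 1"
          using T \<gamma> by (intro powr_le_powr_max) (auto simp: R_def)
        then have "\<gamma> * T powr (1 / \<gamma>) \<le> G * R"
          using \<gamma> by (intro mult_mono) (auto simp: R_def)
        then show "\<gamma> * T powr (1 / \<gamma>) \<le> D" by (simp add: D_def)
      qed (use N in auto)
      finally show ?thesis .
    qed
    show "t k \<le> D * t (k - 1)" if k: "2 \<le> k" "k \<le> N" for k
    proof -
      have "real k / real N \<le> 2 * (real (k - 1) / real N)"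
        using k N by (simp add: of_nat_diff field_simps)
      then have "(real k / real N) powr \<gamma> \<le> (2 * (real (k - 1) / real N)) powr \<gamma>"
        using \<gamma> by (intro powr_mono2) auto
      also have "\<dots> = 2 powr \<gamma> * (real (k - 1) / real N) powr \<gamma>" by (rule powr_mult)
      also have "2 powr \<gamma> \<le> D" using powr_mono[OF \<gamma>(2), of 2] by (simp add: D_def le_max_iff_disj)
      finally have "(real k / real N) powr \<gamma> \<le> D * (real (k - 1) / real N) powr \<gamma>"
        by (simp add: mult_right_mono)
      then have "T * (real k / real N) powr \<gamma> \<le> T * (D * (real (k - 1) / real N) powr \<gamma>)"
        using T by (intro mult_left_mono) auto
      then show ?thesis using t_eq[of k] t_eq[of "k - 1"] k by (simp add: mult_ac)
    qed
  qed (use T D N in \<open>auto simp: R_def\<close>)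
  also have "(t n / t 1) powr (1 / \<gamma>) = real n"
  proof -
    have "t n / t 1 = real n powr \<gamma>"
      using t_eq[of n] t_eq[of 1] n T N by (simp add: powr_divide)
    then show ?thesis using n \<gamma> by (simp add: powr_powr)
  qed
  also have "(1 / real N) powr min (\<sigma> * \<gamma>) (2 - \<alpha>) = real N powr (- min (\<sigma> * \<gamma>) (2 - \<alpha>))"
    using N by (simp add: powr_divide powr_minus_divide)
  finally show ?thesis by (simp only: R_def D_def)
qed

lemma error_estimate_graded:
  assumes setting: "l1_setting xl xr T \<kappa> \<sigma> K \<rho> \<alpha> f u0 u M N t U"
    and data: "xl < xr" "0 < T" "0 < K" "\<sigma> \<in> {0<..<1} \<union> {1<..<2}"
    and \<gamma>: "1 \<le> \<gamma>" "\<gamma> \<le> G" and graded: "graded_mesh \<gamma> T N t"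
    and \<Phi>: "\<And>x. 1 \<le> x \<Longrightarrow> (if \<gamma> * (\<sigma> - 1) \<le> 2 - \<alpha> then varsigma_L \<alpha> \<sigma> \<gamma> x else 0) \<le> \<Phi> x"
  shows "error_estimate (error_bound_const (xr - xl) T \<sigma> K * max 1 (mesh_const G (max 1 T) T (max (G * max 1 T) (2 powr G))))
    xl xr \<kappa> \<rho> \<alpha> u M N t U
    (\<lambda>n. (1 / \<sigma> + \<Phi> (real n)) * real N powr (- min (\<sigma> * \<gamma>) (2 - \<alpha>)))"
proof (rule error_estimateI[OF setting data])
  fix n assume n: "1 \<le> n" "n \<le> N"
  define B where "B = mesh_const G (max 1 T) T (max (G * max 1 T) (2 powr G))"
  have n1: "1 \<le> real n" using n by simp
  have "L1_mesh.temporal_error \<alpha> t \<sigma> n \<le> B *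
    (1 / \<sigma> + (if \<gamma> * (\<sigma> - 1) \<le> 2 - \<alpha> then varsigma_L \<alpha> \<sigma> \<gamma> (real n) else 0)) *
    real N powr (- min (\<sigma> * \<gamma>) (2 - \<alpha>))"
    unfolding B_def using data
    by (intro temporal_error_graded_le[OF setting_L1_mesh[OF setting] _ _ _ \<gamma> graded n]) auto
  also have "\<dots> \<le> max 1 B * (1 / \<sigma> + \<Phi> (real n)) * real N powr (- min (\<sigma> * \<gamma>) (2 - \<alpha>))"
    using \<Phi>[OF n1] varsigma_nonneg[OF n1, of \<alpha> \<sigma> \<gamma>] data(4)
    by (intro mult_right_mono mult_mono) (auto intro!: add_nonneg_nonneg)
  finally show "L1_mesh.temporal_error \<alpha> t \<sigma> n \<le> max 1 (mesh_const G (max 1 T) T (max (G * max 1 T) (2 powr G))) *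
      ((1 / \<sigma> + \<Phi> (real n)) * real N powr (- min (\<sigma> * \<gamma>) (2 - \<alpha>)))"
    by (simp only: B_def mult.assoc)
qed simp

lemma gamma_opt_bounds:
  assumes "0 < \<alpha>" "0 < \<sigma>"
  shows "1 \<le> gamma_opt \<alpha> \<sigma>" "gamma_opt \<alpha> \<sigma> \<le> max 1 (2 / \<sigma>)"
  using assms by (auto simp: gamma_opt_def divide_right_mono le_max_iff_disj)

lemma min_gamma_opt:
  assumes "0 < \<sigma>"
  shows "min (\<sigma> * gamma_opt \<alpha> \<sigma>) (2 - \<alpha>) = 2 - \<alpha>"
proof -
  have "\<sigma> * ((2 - \<alpha>) / \<sigma>) \<le> \<sigma> * gamma_opt \<alpha> \<sigma>"
    using assms by (intro mult_left_mono) (auto simp: gamma_opt_def)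
  then show ?thesis using assms by simp
qed

section \<open>The convergence theorem\<close>

theorem theorem3p1:
  fixes xl xr T \<kappa> \<sigma> K :: real
  assumes "xl < xr" and "T > 0" and "K > 0" and "\<sigma> \<in> {0<..<1} \<union> {1<..<2}"
  shows
    "(\<exists>Cu>0. \<forall>\<rho> \<alpha> f u0 u M N t U.
        l1_setting xl xr T \<kappa> \<sigma> K \<rho> \<alpha> f u0 u M N t U \<longrightarrow>
        error_estimate Cu xl xr \<kappa> \<rho> \<alpha> u M N t U
          (\<lambda>n. step t 1 powr \<sigma> / \<sigma> +
             (\<Sum>j=2..n. step t j * (MAX k\<in>{j..n}.
                t (k - 1) powr (\<sigma> - 2) * t k powr (\<alpha> - 1) * step t k powr (2 - \<alpha>)))))
   \<and> (\<exists>Cu>0. \<forall>\<rho> \<alpha> f u0 u M N t U.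
        l1_setting xl xr T \<kappa> \<sigma> K \<rho> \<alpha> f u0 u M N t U \<and> uniform_mesh T N t \<longrightarrow>
        error_estimate Cu xl xr \<kappa> \<rho> \<alpha> u M N t U
          (\<lambda>n. (1 / \<sigma> + varsigma_L \<alpha> \<sigma> 1 (real n)) * real N powr (- min \<sigma> (2 - \<alpha>))))
   \<and> (\<forall>\<gamma>\<ge>1. \<exists>Cu>0. \<forall>\<rho> \<alpha> f u0 u M N t U.
        l1_setting xl xr T \<kappa> \<sigma> K \<rho> \<alpha> f u0 u M N t U \<and> graded_mesh \<gamma> T N t \<longrightarrow>
        error_estimate Cu xl xr \<kappa> \<rho> \<alpha> u M N t U
          (\<lambda>n. (1 / \<sigma> + chi_L \<alpha> \<sigma> \<gamma> (real n)) * real N powr (- min (\<sigma> * \<gamma>) (2 - \<alpha>))))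
   \<and> (\<forall>\<gamma>\<ge>1. \<forall>\<rho>>0. \<forall>C1>0. \<forall>C\<gamma>>0. \<exists>Cu>0. \<forall>\<alpha> f u0 u M N t U.
        l1_setting xl xr T \<kappa> \<sigma> K \<rho> \<alpha> f u0 u M N t U \<and> mesh_M1 \<gamma> C1 C\<gamma> N t \<longrightarrow>
        error_estimate Cu xl xr \<kappa> \<rho> \<alpha> u M N t U
          (\<lambda>n. (1 / \<sigma> + chi_L \<alpha> \<sigma> \<gamma> (n_star \<gamma> t n)) *
               max_step N t powr min (\<sigma> * \<gamma>) (2 - \<alpha>)))
   \<and> (\<forall>\<alpha>. 0 < \<alpha> \<and> \<alpha> < 1 \<longrightarrow>
        is_arg_max (\<lambda>\<gamma>. min (\<sigma> * \<gamma>) (2 - \<alpha>)) (\<lambda>\<gamma>. 1 \<le> \<gamma>) (gamma_opt \<alpha> \<sigma>) \<and>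
        min (\<sigma> * gamma_opt \<alpha> \<sigma>) (2 - \<alpha>) = 2 - \<alpha>)
   \<and> (\<exists>Cu>0. \<forall>\<rho> \<alpha> f u0 u M N t U.
        l1_setting xl xr T \<kappa> \<sigma> K \<rho> \<alpha> f u0 u M N t U \<and> graded_mesh (gamma_opt \<alpha> \<sigma>) T N t \<longrightarrow>
        error_estimate Cu xl xr \<kappa> \<rho> \<alpha> u M N t U
          (\<lambda>n. (1 / \<sigma> + chi_L \<alpha> \<sigma> (gamma_opt \<alpha> \<sigma>) (real n)) * real N powr (- (2 - \<alpha>))))
   \<and> (\<forall>\<rho>>0. \<forall>C1>0. \<forall>C\<gamma>>0. \<exists>Cu>0. \<forall>\<alpha> f u0 u M N t U.
        l1_setting xl xr T \<kappa> \<sigma> K \<rho> \<alpha> f u0 u M N t U \<and>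
        mesh_M1 (gamma_opt \<alpha> \<sigma>) C1 C\<gamma> N t \<longrightarrow>
        error_estimate Cu xl xr \<kappa> \<rho> \<alpha> u M N t U
          (\<lambda>n. (1 / \<sigma> + chi_L \<alpha> \<sigma> (gamma_opt \<alpha> \<sigma>) (n_star (gamma_opt \<alpha> \<sigma>) t n)) *
               max_step N t powr (2 - \<alpha>)))"
proof -
  note data = assms
  define C where "C = error_bound_const (xr - xl) T \<sigma> K"
  have C: "0 < C" using error_bound_const_ge_two[of "xr - xl" K T \<sigma>] data by (simp add: C_def)
  have \<sigma>: "0 < \<sigma>" "\<sigma> < 2" using data by auto
  \<comment> \<open>A bound on the optimal grading that does not depend on \<open>\<alpha>\<close>.\<close>
  define G where "G = max 1 (2 / \<sigma>)"
  define Cg where "Cg \<gamma> = C * max 1 (mesh_const \<gamma> (max 1 T) T (max (\<gamma> * max 1 T) (2 powr \<gamma>)))" for \<gamma>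
  define Cm where "Cm \<gamma> C1 C\<gamma> = C * max 1 (mesh_const \<gamma> (max 1 T) C1 (max 1 C\<gamma>))" for \<gamma> C1 C\<gamma>
  have pos: "0 < Cg \<gamma>" "0 < Cm \<gamma> C1 C\<gamma>" for \<gamma> C1 C\<gamma>
    using C by (auto simp: Cg_def Cm_def)
  have alpha: "0 < \<alpha> \<and> \<alpha> < 1" if "l1_setting xl xr T \<kappa> \<sigma> K \<rho> \<alpha> f u0 u M N t U" for \<rho> \<alpha> f u0 u M N t U
    using that by (simp add: l1_setting_def)
  have general: "error_estimate C xl xr \<kappa> \<rho> \<alpha> u M N t U
          (\<lambda>n. step t 1 powr \<sigma> / \<sigma> +
             (\<Sum>j=2..n. step t j * (MAX k\<in>{j..n}.
                t (k - 1) powr (\<sigma> - 2) * t k powr (\<alpha> - 1) * step t k powr (2 - \<alpha>))))"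
    if s: "l1_setting xl xr T \<kappa> \<sigma> K \<rho> \<alpha> f u0 u M N t U" for \<rho> \<alpha> f u0 u M N t U
  proof -
    interpret L1_mesh \<alpha> T N t by (rule setting_L1_mesh[OF s])
    show ?thesis
      using error_estimateI[OF s data, of 1 "temporal_error \<sigma>"]
      unfolding C_def temporal_error_def mesh_weight_def by simp
  qed
  have graded: "error_estimate (Cg G') xl xr \<kappa> \<rho> \<alpha> u M N t U
      (\<lambda>n. (1 / \<sigma> + chi_L \<alpha> \<sigma> \<gamma> (real n)) * real N powr (- min (\<sigma> * \<gamma>) (2 - \<alpha>)))"
    if s: "l1_setting xl xr T \<kappa> \<sigma> K \<rho> \<alpha> f u0 u M N t U" and g: "graded_mesh \<gamma> T N t" and \<gamma>: "1 \<le> \<gamma>" "\<gamma> \<le> G'"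
    for \<gamma> G' \<rho> \<alpha> f u0 u M N t U
    unfolding Cg_def C_def
    by (rule error_estimate_graded[OF s data \<gamma> g]) (use mesh_factor_le_chi alpha[OF s] data(4) \<gamma>(1) in blast)
  have m1: "error_estimate (Cm G' C1 C\<gamma>) xl xr \<kappa> \<rho> \<alpha> u M N t U
      (\<lambda>n. (1 / \<sigma> + chi_L \<alpha> \<sigma> \<gamma> (n_star \<gamma> t n)) * max_step N t powr min (\<sigma> * \<gamma>) (2 - \<alpha>))"
    if "l1_setting xl xr T \<kappa> \<sigma> K \<rho> \<alpha> f u0 u M N t U" "mesh_M1 \<gamma> C1 C\<gamma> N t" "1 \<le> \<gamma>" "\<gamma> \<le> G'" "0 < C1"
    for \<gamma> G' C1 C\<gamma> \<rho> \<alpha> f u0 u M N t U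
    unfolding Cm_def C_def using that data by (intro error_estimate_M1)
  have uniform: "error_estimate (Cg 1) xl xr \<kappa> \<rho> \<alpha> u M N t U
      (\<lambda>n. (1 / \<sigma> + varsigma_L \<alpha> \<sigma> 1 (real n)) * real N powr (- min \<sigma> (2 - \<alpha>)))"
    if s: "l1_setting xl xr T \<kappa> \<sigma> K \<rho> \<alpha> f u0 u M N t U" and un: "uniform_mesh T N t"
    for \<rho> \<alpha> f u0 u M N t U
  proof -
    have "graded_mesh 1 T N t" using un by (simp add: uniform_mesh_def graded_mesh_def)
    then have "error_estimate (Cg 1) xl xr \<kappa> \<rho> \<alpha> u M N t U
      (\<lambda>n. (1 / \<sigma> + varsigma_L \<alpha> \<sigma> 1 (real n)) * real N powr (- min (\<sigma> * 1) (2 - \<alpha>)))"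
      unfolding Cg_def C_def using varsigma_nonneg
      by (intro error_estimate_graded[OF s data]) auto
    then show ?thesis by simp
  qed
  have opt: "1 \<le> gamma_opt \<alpha> \<sigma>" "gamma_opt \<alpha> \<sigma> \<le> G"
    if "l1_setting xl xr T \<kappa> \<sigma> K \<rho> \<alpha> f u0 u M N t U" for \<rho> \<alpha> f u0 u M N t U
    using gamma_opt_bounds[of \<alpha> \<sigma>] alpha[OF that] \<sigma> by (auto simp: G_def)
  note min_opt = min_gamma_opt[OF \<sigma>(1)]
  show ?thesis
  proof (intro conjI allI impI, goal_cases)
    case 1
    show ?case by (intro exI[of _ C] conjI C allI impI general)
  next
    case 2
    show ?case by (intro exI[of _ "Cg 1"] conjI pos allI impI, elim conjE, rule uniform)
  next
    case (3 \<gamma>)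
    then show ?case
      by (intro exI[of _ "Cg \<gamma>"] conjI pos allI impI, elim conjE, intro graded order_refl)
  next
    case (4 \<gamma> \<rho> C1 C\<gamma>)
    then show ?case
      by (intro exI[of _ "Cm \<gamma> C1 C\<gamma>"] conjI pos allI impI, elim conjE, intro m1 order_refl)
  next
    case (5 \<alpha>)
    then show ?case
      using gamma_opt_bounds(1)[of \<alpha> \<sigma>] \<sigma> by (simp add: is_arg_max_def min_opt)
  next
    case (6 \<alpha>)
    show ?case by (rule min_opt)
  next
    case 7
    show ?case
    proof (intro exI[of _ "Cg G"] conjI pos allI impI, elim conjE)
      fix \<rho> \<alpha> f u0 u M N t U
      assume s: "l1_setting xl xr T \<kappa> \<sigma> K \<rho> \<alpha> f u0 u M N t U" and "graded_mesh (gamma_opt \<alpha> \<sigma>) T N t"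
      from graded[OF this opt[OF s]]
      show "error_estimate (Cg G) xl xr \<kappa> \<rho> \<alpha> u M N t U
          (\<lambda>n. (1 / \<sigma> + chi_L \<alpha> \<sigma> (gamma_opt \<alpha> \<sigma>) (real n)) * real N powr (- (2 - \<alpha>)))"
        unfolding min_opt .
    qed
  next
    case (8 \<rho> C1 C\<gamma>)
    show ?case
    proof (intro exI[of _ "Cm G C1 C\<gamma>"] conjI pos allI impI, elim conjE)
      fix \<alpha> f u0 u M N t U
      assume s: "l1_setting xl xr T \<kappa> \<sigma> K \<rho> \<alpha> f u0 u M N t U" and "mesh_M1 (gamma_opt \<alpha> \<sigma>) C1 C\<gamma> N t"
      from m1[OF this opt[OF s] 8(2)]
      show "error_estimate (Cm G C1 C\<gamma>) xl xr \<kappa> \<rho> \<alpha> u M N t U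
          (\<lambda>n. (1 / \<sigma> + chi_L \<alpha> \<sigma> (gamma_opt \<alpha> \<sigma>) (n_star (gamma_opt \<alpha> \<sigma>) t n)) *
               max_step N t powr (2 - \<alpha>))"
        unfolding min_opt .
    qed
  qed
qed

end
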